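(* Let $S\approx (a,b)\times S^1$ be a smooth two-dimensional surface with coordinates $(r,\varphi \bmod 2\pi)$ and Riemannian metric $ds^2=dr^2+f^2(r)\,d\varphi^2$, where $-\infty\le a<b\le\infty$ and $f$ is $C^\infty$ and positive on $(a,b)$. Suppose that $f$ satisfies the identity $f''f-(f')^2=-\xi^2$ for some rational $\xi>0$, i.e. $f$ has, for some $r_0\in\mathbb{R}$, one of the forms $$f(r)=\pm\xi(r-r_0)\ (c=0),\qquad f(r)=\frac{\xi}{\sqrt{c}}\sin(\sqrt{c}(r-r_0))\ (c>0),\qquad f(r)=\pm\frac{\xi}{\sqrt{-c}}\sinh(\sqrt{-c}(r-r_0))\ (c<0),$$ where $c$ is one half of the (in this case constant) scalar curvature of the surface, and $2\pi\xi$ is the total angle at the conical point of the surface (the centre of the field). Suppose moreover that $f'$ has no zeros on $(a,b)$. Then in the class of ($C^\infty$) central potentials on $S$ there exist two and only two (up to additive and multiplicative constants) semilocally closing (respectively locally closing, closing, strongly closing, weakly closing) potentials $V_1(r)$, $V_2(r)$. These potentials are the generalized gravitational one $V_1$ and the generalized oscillator one $V_2$, i.e. they have the form $$V_i(r)=(-1)^iA_i|\theta(r)|^{2-i^2}/i+B_i,\qquad i=1,2,$$ where $A_i>0$ and $B_i$ are constants and $\theta(r)=-\frac{f'(r)}{f(r)}=\pm\sqrt{\frac{\xi^2}{f^2(r)}-c}$. The nonsingular noncircular bounded orbits corresponding to $V_i$ are given by periodic functions $r=r(\varphi)$ with minimal positive period $\Phi_i=\frac{2\pi}{i\xi}$,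 $i=1,2$. On the phase trajectory corresponding to a circular orbit $\{r\}\times S^1\subset(a,b)\times S^1$ the value of the angular momentum is $K_i=\pm\xi\sqrt{\frac{A_i}{|\theta(r)|^{i^2}}}$, $i=1,2$. The boundary circle $\{\hat r\}\times S^1$ at which $\inf f(r)$ (i.e. $\sup|\theta(r)|$) is attained is an attracting centre of the field with closing potential $V_i$ (i.e. $\inf V_i(r)$ is attained there).
   Context: A central potential is a $C^\infty$ function $V=V(r)$ on $(a,b)$. A point moves on $S$ with Lagrangian $L=\frac12(\dot r^2+f^2(r)\dot\varphi^2)-V(r)$; first integrals are the energy $\frac12(\dot r^2+f^2\dot\varphi^2)+V$ and the angular momentum $K=f^2(r)\dot\varphi$. A trajectory is a solution defined on a maximal time interval; its orbit is its image in $S$; the phase trajectory is the trajectory with its velocity in $TS$. An orbit (trajectory) is circular if it is an orbit $\{r_0\}\times S^1$ of the rotation group. A circular orbit is strongly stable if on it the effective potential $V(r)+\frac{K_0^2}{2f^2(r)}$ has a nondegenerate local minimum for some $K_0\ne0$. A closed orbit is orbitally stable if the corresponding phase trajectory is orbitally stable for the restriction of the system to the level set of $K$ containing it. A trajectory (orbit) is bounded if it is defined for all $t\in\mathbb{R}$ and its image lies in a compact set $[r_1,r_2]\times S^1\subset(a,b)\times S^1$. It is singular if $K=0$ on it (i.e. $\varphi=\mathrm{const}$). Conditions on $V$: ($\exists$) there exists a nonsingular bounded noncircular orbit $\gamma$ in $S$; ($\forall$) every nonsingular bounded orbit in $S$ is closed; ($\exists$)$^{\rm loc}$ there exists a strongly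 stable circular orbit in $S$; ($\forall$)$^{\rm loc}$ for every strongly stable circular orbit $\{r_0\}\times S^1$ there is $\varepsilon>0$ such that every nonsingular bounded orbit contained in $[r_0-\varepsilon,r_0+\varepsilon]\times S^1$ with angular momentum in $(K_0-\varepsilon,K_0+\varepsilon)$ is closed, where $K_0$ is the angular momentum of the corresponding circular trajectory; ($\forall$)$^{\rm s-loc}$ every nonsingular bounded orbit in the annulus $[a',b']\times S^1$ with angular momentum $\hat K$ is closed, where $a'=\inf r|_\gamma$, $b'=\sup r|_\gamma$, $\gamma$ is the orbit from ($\exists$) and $\hat K$ is its angular momentum. $V$ is called: closing if ($\exists$) and ($\forall$) hold; locally closing if ($\exists$)$^{\rm loc}$ and ($\forall$)$^{\rm loc}$ hold; semilocally closing if ($\exists$), ($\forall$)$^{\rm loc}$ and ($\forall$)$^{\rm s-loc}$ hold; strongly (resp. weakly) closing if ($\forall$)$^{\rm loc}$ (resp. its analogue for every orbitally stable circular orbit) holds and every circle $\{r\}\times S^1$ is a strongly stable (resp. orbitally stable) circular orbit. A boundary circle is $\{\hat r\}\times S^1$ with $\hat r\in\{a,b\}$; infima and suprema are "attained" there in the sense of limits as $r\to\hat r$. *)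

theory Defs
  imports "HOL-Analysis.Analysis"
begin

section \<open>Surface of revolution and central potentials\<close>

text \<open>
  The surface is \<open>S = (a,b) \<times> S\<^sup>1\<close>, where \<open>S\<^sup>1\<close> is the unit circle
  of \<open>\<complex>\<close>, with the metric \<open>dr\<^sup>2 + f(r)\<^sup>2 d\<phi>\<^sup>2\<close>. The end points
  \<open>a\<close>, \<open>b\<close> may be infinite, and \<^term>\<open>einterval a b\<close> is the real interval.
  Functions on \<open>(a,b)\<close> are total functions of which only the
  values on \<^term>\<open>einterval a b\<close> matter.
\<close>

definition smooth_on :: "real set \<Rightarrow> (real \<Rightarrow> real) \<Rightarrow> bool" where
  "smooth_on U g \<longleftrightarrow> (\<forall>k. \<forall>x\<in>U. (deriv ^^ k) g differentiable (at x))"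

definition central_potential :: "ereal \<Rightarrow> ereal \<Rightarrow> (real \<Rightarrow> real) \<Rightarrow> bool" where
  "central_potential a b V \<longleftrightarrow> smooth_on (einterval a b) V"

text \<open>Scalar curvature of \<open>dr\<^sup>2 + f(r)\<^sup>2 d\<phi>\<^sup>2\<close>: twice the Gaussian
  curvature \<open>- f'' / f\<close>.\<close>

definition scalar_curvature :: "(real \<Rightarrow> real) \<Rightarrow> real \<Rightarrow> real" where
  "scalar_curvature f r = - 2 * deriv (deriv f) r / f r"

definition theta :: "(real \<Rightarrow> real) \<Rightarrow> real \<Rightarrow> real" where
  "theta f r = - deriv f r / f r"


section \<open>Motion of a point\<close>

definition lagrangian :: "(real \<Rightarrow> real) \<Rightarrow> (real \<Rightarrow> real) \<Rightarrow> real \<Rightarrow> real \<Rightarrow> real \<Rightarrow> real" where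
  "lagrangian f V r v w = (v\<^sup>2 + (f r)\<^sup>2 * w\<^sup>2) / 2 - V r"

text \<open>
  A curve in \<open>S\<close> is given by \<open>r\<close> and a continuous real-valued lift of the
  angle. The two last conjuncts are the Euler-Lagrange equations for \<open>r\<close> and for
  the cyclic coordinate \<open>\<phi>\<close>.
\<close>

definition solution_on ::
  "ereal \<Rightarrow> ereal \<Rightarrow> (real \<Rightarrow> real) \<Rightarrow> (real \<Rightarrow> real) \<Rightarrow> real set \<Rightarrow> (real \<Rightarrow> real) \<Rightarrow> (real \<Rightarrow> real) \<Rightarrow> bool"
where
  "solution_on a b f V I r \<phi> \<longleftrightarrow>
     open I \<and> is_interval I \<and> I \<noteq> {} \<and>
     (\<forall>t\<in>I. r t \<in> einterval a b \<and>
        r differentiable (at t) \<and> \<phi> differentiable (at t) \<and>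
        ((\<lambda>s. deriv (\<lambda>v. lagrangian f V (r s) v (deriv \<phi> s)) (deriv r s))
           has_real_derivative deriv (\<lambda>x. lagrangian f V x (deriv r t) (deriv \<phi> t)) (r t)) (at t) \<and>
        ((\<lambda>s. deriv (\<lambda>w. lagrangian f V (r s) (deriv r s) w) (deriv \<phi> s))
           has_real_derivative 0) (at t))"

definition trajectory ::
  "ereal \<Rightarrow> ereal \<Rightarrow> (real \<Rightarrow> real) \<Rightarrow> (real \<Rightarrow> real) \<Rightarrow> real set \<Rightarrow> (real \<Rightarrow> real) \<Rightarrow> (real \<Rightarrow> real) \<Rightarrow> bool"
where
  "trajectory a b f V I r \<phi> \<longleftrightarrow>
     solution_on a b f V I r \<phi> \<and>
     (\<forall>J r' \<phi>'. solution_on a b f V J r' \<phi>' \<and> I \<subseteq> J \<and> (\<forall>t\<in>I. r' t = r t \<and> \<phi>' t = \<phi> t)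
        \<longrightarrow> J = I)"

definition orbit :: "real set \<Rightarrow> (real \<Rightarrow> real) \<Rightarrow> (real \<Rightarrow> real) \<Rightarrow> (real \<times> complex) set" where
  "orbit I r \<phi> = (\<lambda>t. (r t, cis (\<phi> t))) ` I"

text \<open>The tangent bundle is trivialised by the velocities of \<open>r\<close> and \<open>\<phi>\<close>.\<close>

definition phase_point ::
  "(real \<Rightarrow> real) \<Rightarrow> (real \<Rightarrow> real) \<Rightarrow> real \<Rightarrow> (real \<times> complex) \<times> (real \<times> real)" where
  "phase_point r \<phi> t = ((r t, cis (\<phi> t)), (deriv r t, deriv \<phi> t))"

definition has_momentum ::
  "(real \<Rightarrow> real) \<Rightarrow> real set \<Rightarrow> (real \<Rightarrow> real) \<Rightarrow> (real \<Rightarrow> real) \<Rightarrow> real \<Rightarrow> bool" where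
  "has_momentum f I r \<phi> K \<longleftrightarrow> (\<forall>t\<in>I. (f (r t))\<^sup>2 * deriv \<phi> t = K)"

definition circle :: "real \<Rightarrow> (real \<times> complex) set" where
  "circle r0 = {r0} \<times> sphere 0 1"

definition circular :: "real set \<Rightarrow> (real \<Rightarrow> real) \<Rightarrow> (real \<Rightarrow> real) \<Rightarrow> bool" where
  "circular I r \<phi> \<longleftrightarrow> (\<exists>r0. orbit I r \<phi> = circle r0)"

definition closed_orbit :: "real set \<Rightarrow> (real \<Rightarrow> real) \<Rightarrow> (real \<Rightarrow> real) \<Rightarrow> bool" where
  "closed_orbit I r \<phi> \<longleftrightarrow>
     I = UNIV \<and> (\<exists>T>0. \<forall>t. r (t + T) = r t \<and> cis (\<phi> (t + T)) = cis (\<phi> t))"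

definition bounded_trajectory ::
  "ereal \<Rightarrow> ereal \<Rightarrow> (real \<Rightarrow> real) \<Rightarrow> (real \<Rightarrow> real) \<Rightarrow> real set \<Rightarrow> (real \<Rightarrow> real) \<Rightarrow> (real \<Rightarrow> real) \<Rightarrow> bool"
where
  "bounded_trajectory a b f V I r \<phi> \<longleftrightarrow>
     trajectory a b f V I r \<phi> \<and> I = UNIV \<and>
     (\<exists>r1 r2. {r1..r2} \<subseteq> einterval a b \<and> (\<forall>t\<in>I. r t \<in> {r1..r2}))"

text \<open>A nonsingular bounded trajectory, together with its angular momentum \<open>K\<close>.\<close>

definition nonsingular_bounded ::
  "ereal \<Rightarrow> ereal \<Rightarrow> (real \<Rightarrow> real) \<Rightarrow> (real \<Rightarrow> real) \<Rightarrow> real set \<Rightarrow> (real \<Rightarrow> real) \<Rightarrow> (real \<Rightarrow> real) \<Rightarrow> real \<Rightarrow> bool"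
where
  "nonsingular_bounded a b f V I r \<phi> K \<longleftrightarrow>
     bounded_trajectory a b f V I r \<phi> \<and> has_momentum f I r \<phi> K \<and> K \<noteq> 0"


section \<open>Circular orbits and their stability\<close>

definition circular_trajectory ::
  "ereal \<Rightarrow> ereal \<Rightarrow> (real \<Rightarrow> real) \<Rightarrow> (real \<Rightarrow> real) \<Rightarrow> real \<Rightarrow> real \<Rightarrow> real set \<Rightarrow> (real \<Rightarrow> real) \<Rightarrow> (real \<Rightarrow> real) \<Rightarrow> bool"
where
  "circular_trajectory a b f V r0 K I r \<phi> \<longleftrightarrow>
     trajectory a b f V I r \<phi> \<and> orbit I r \<phi> = circle r0 \<and> has_momentum f I r \<phi> K"

definition circular_orbit ::
  "ereal \<Rightarrow> ereal \<Rightarrow> (real \<Rightarrow> real) \<Rightarrow> (real \<Rightarrow> real) \<Rightarrow> real \<Rightarrow> real \<Rightarrow> bool" where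
  "circular_orbit a b f V r0 K \<longleftrightarrow> (\<exists>I r \<phi>. circular_trajectory a b f V r0 K I r \<phi>)"

definition effective_potential :: "(real \<Rightarrow> real) \<Rightarrow> (real \<Rightarrow> real) \<Rightarrow> real \<Rightarrow> real \<Rightarrow> real" where
  "effective_potential f V K r = V r + K\<^sup>2 / (2 * (f r)\<^sup>2)"

definition nondegenerate_local_min :: "(real \<Rightarrow> real) \<Rightarrow> real \<Rightarrow> bool" where
  "nondegenerate_local_min g x \<longleftrightarrow>
     (\<forall>\<^sub>F y in nhds x. g x \<le> g y) \<and> deriv (deriv g) x \<noteq> 0"

definition strongly_stable ::
  "ereal \<Rightarrow> ereal \<Rightarrow> (real \<Rightarrow> real) \<Rightarrow> (real \<Rightarrow> real) \<Rightarrow> real \<Rightarrow> real \<Rightarrow> bool" where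
  "strongly_stable a b f V r0 K \<longleftrightarrow>
     circular_orbit a b f V r0 K \<and> K \<noteq> 0 \<and>
     nondegenerate_local_min (effective_potential f V K) r0"

text \<open>Lyapunov stability, within the level set of the angular momentum, of the
  set traced by a phase trajectory; this set is compact for a closed orbit, so
  metric neighbourhoods suffice.\<close>

definition orbitally_stable ::
  "ereal \<Rightarrow> ereal \<Rightarrow> (real \<Rightarrow> real) \<Rightarrow> (real \<Rightarrow> real) \<Rightarrow> real set \<Rightarrow> (real \<Rightarrow> real) \<Rightarrow> (real \<Rightarrow> real) \<Rightarrow> bool"
where
  "orbitally_stable a b f V I r \<phi> \<longleftrightarrow>
     (\<exists>K. has_momentum f I r \<phi> K \<and>
       (\<forall>\<epsilon>>0. \<exists>\<delta>>0. \<forall>J r' \<phi>'.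
          trajectory a b f V J r' \<phi>' \<and> has_momentum f J r' \<phi>' K \<and> 0 \<in> J \<and>
          infdist (phase_point r' \<phi>' 0) (phase_point r \<phi> ` I) < \<delta>
          \<longrightarrow> {0..} \<subseteq> J \<and>
              (\<forall>t\<ge>0. infdist (phase_point r' \<phi>' t) (phase_point r \<phi> ` I) < \<epsilon>)))"

definition orbitally_stable_circular ::
  "ereal \<Rightarrow> ereal \<Rightarrow> (real \<Rightarrow> real) \<Rightarrow> (real \<Rightarrow> real) \<Rightarrow> real \<Rightarrow> real \<Rightarrow> bool" where
  "orbitally_stable_circular a b f V r0 K \<longleftrightarrow>
     (\<exists>I r \<phi>. circular_trajectory a b f V r0 K I r \<phi> \<and> orbitally_stable a b f V I r \<phi>)"


section \<open>Classes of closing potentials\<close>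

definition cond_exists ::
  "ereal \<Rightarrow> ereal \<Rightarrow> (real \<Rightarrow> real) \<Rightarrow> (real \<Rightarrow> real) \<Rightarrow> bool" where
  "cond_exists a b f V \<longleftrightarrow>
     (\<exists>I r \<phi> K. nonsingular_bounded a b f V I r \<phi> K \<and> \<not> circular I r \<phi>)"

definition cond_forall ::
  "ereal \<Rightarrow> ereal \<Rightarrow> (real \<Rightarrow> real) \<Rightarrow> (real \<Rightarrow> real) \<Rightarrow> bool" where
  "cond_forall a b f V \<longleftrightarrow>
     (\<forall>I r \<phi> K. nonsingular_bounded a b f V I r \<phi> K \<longrightarrow> closed_orbit I r \<phi>)"

definition cond_exists_loc ::
  "ereal \<Rightarrow> ereal \<Rightarrow> (real \<Rightarrow> real) \<Rightarrow> (real \<Rightarrow> real) \<Rightarrow> bool" where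
  "cond_exists_loc a b f V \<longleftrightarrow> (\<exists>r0 K. strongly_stable a b f V r0 K)"

definition closed_near ::
  "ereal \<Rightarrow> ereal \<Rightarrow> (real \<Rightarrow> real) \<Rightarrow> (real \<Rightarrow> real) \<Rightarrow> real \<Rightarrow> real \<Rightarrow> bool" where
  "closed_near a b f V r0 K0 \<longleftrightarrow>
     (\<exists>\<epsilon>>0. \<forall>I r \<phi> K.
        nonsingular_bounded a b f V I r \<phi> K \<and>
        orbit I r \<phi> \<subseteq> {r0 - \<epsilon>..r0 + \<epsilon>} \<times> sphere 0 1 \<and> K \<in> {K0 - \<epsilon><..<K0 + \<epsilon>}
        \<longrightarrow> closed_orbit I r \<phi>)"

definition cond_forall_loc ::
  "ereal \<Rightarrow> ereal \<Rightarrow> (real \<Rightarrow> real) \<Rightarrow> (real \<Rightarrow> real) \<Rightarrow> bool" where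
  "cond_forall_loc a b f V \<longleftrightarrow>
     (\<forall>r0 K0. strongly_stable a b f V r0 K0 \<longrightarrow> closed_near a b f V r0 K0)"

definition cond_forall_loc_orbital ::
  "ereal \<Rightarrow> ereal \<Rightarrow> (real \<Rightarrow> real) \<Rightarrow> (real \<Rightarrow> real) \<Rightarrow> bool" where
  "cond_forall_loc_orbital a b f V \<longleftrightarrow>
     (\<forall>r0 K0. orbitally_stable_circular a b f V r0 K0 \<longrightarrow> closed_near a b f V r0 K0)"

text \<open>The orbit of condition \<open>(\<exists>)\<close> to which the semilocal condition refers is
  given here by its function \<open>r\<close> and its angular momentum \<open>K\<close>.\<close>

definition cond_forall_semiloc ::
  "ereal \<Rightarrow> ereal \<Rightarrow> (real \<Rightarrow> real) \<Rightarrow> (real \<Rightarrow> real) \<Rightarrow> real set \<Rightarrow> (real \<Rightarrow> real) \<Rightarrow> real \<Rightarrow> bool" where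
  "cond_forall_semiloc a b f V I r K \<longleftrightarrow>
     (\<forall>J r' \<phi>'.
        nonsingular_bounded a b f V J r' \<phi>' K \<and>
        orbit J r' \<phi>' \<subseteq> {Inf (r ` I)..Sup (r ` I)} \<times> sphere 0 1
        \<longrightarrow> closed_orbit J r' \<phi>')"

definition closing ::
  "ereal \<Rightarrow> ereal \<Rightarrow> (real \<Rightarrow> real) \<Rightarrow> (real \<Rightarrow> real) \<Rightarrow> bool" where
  "closing a b f V \<longleftrightarrow> cond_exists a b f V \<and> cond_forall a b f V"

definition locally_closing ::
  "ereal \<Rightarrow> ereal \<Rightarrow> (real \<Rightarrow> real) \<Rightarrow> (real \<Rightarrow> real) \<Rightarrow> bool" where
  "locally_closing a b f V \<longleftrightarrow> cond_exists_loc a b f V \<and> cond_forall_loc a b f V"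

definition semilocally_closing ::
  "ereal \<Rightarrow> ereal \<Rightarrow> (real \<Rightarrow> real) \<Rightarrow> (real \<Rightarrow> real) \<Rightarrow> bool" where
  "semilocally_closing a b f V \<longleftrightarrow>
     cond_forall_loc a b f V \<and>
     (\<exists>I r \<phi> K. nonsingular_bounded a b f V I r \<phi> K \<and> \<not> circular I r \<phi> \<and>
        cond_forall_semiloc a b f V I r K)"

definition strongly_closing ::
  "ereal \<Rightarrow> ereal \<Rightarrow> (real \<Rightarrow> real) \<Rightarrow> (real \<Rightarrow> real) \<Rightarrow> bool" where
  "strongly_closing a b f V \<longleftrightarrow>
     cond_forall_loc a b f V \<and>
     (\<forall>r0\<in>einterval a b. \<exists>K. strongly_stable a b f V r0 K)"

definition weakly_closing ::
  "ereal \<Rightarrow> ereal \<Rightarrow> (real \<Rightarrow> real) \<Rightarrow> (real \<Rightarrow> real) \<Rightarrow> bool" where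
  "weakly_closing a b f V \<longleftrightarrow>
     cond_forall_loc_orbital a b f V \<and>
     (\<forall>r0\<in>einterval a b. \<exists>K. orbitally_stable_circular a b f V r0 K)"


section \<open>The generalized gravitational and oscillator potentials\<close>

text \<open>\<open>i = 1\<close> is the gravitational potential, \<open>i = 2\<close> the oscillator potential.\<close>

definition bertrand_potential :: "(real \<Rightarrow> real) \<Rightarrow> nat \<Rightarrow> real \<Rightarrow> real \<Rightarrow> real \<Rightarrow> real" where
  "bertrand_potential f i A B r =
     (- 1) ^ i * A * (\<bar>theta f r\<bar> powi (2 - (int i)\<^sup>2)) / real i + B"

definition minimal_period :: "(real \<Rightarrow> real) \<Rightarrow> real \<Rightarrow> bool" where
  "minimal_period \<rho> T \<longleftrightarrow>
     T > 0 \<and> (\<forall>x. \<rho> (x + T) = \<rho> x) \<and>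
     (\<forall>T'. 0 < T' \<and> T' < T \<longrightarrow> \<not> (\<forall>x. \<rho> (x + T') = \<rho> x))"

text \<open>Real points of \<open>(a,b)\<close> close to the end point \<open>e\<close>, which may be infinite.\<close>

definition near_end :: "ereal \<Rightarrow> ereal \<Rightarrow> ereal \<Rightarrow> real filter" where
  "near_end a b e = filtercomap ereal (at e within {a<..<b})"

definition inf_attained_at_end :: "ereal \<Rightarrow> ereal \<Rightarrow> (real \<Rightarrow> real) \<Rightarrow> ereal \<Rightarrow> bool" where
  "inf_attained_at_end a b g e \<longleftrightarrow>
     ((\<lambda>r. ereal (g r)) \<longlongrightarrow> (INF r\<in>einterval a b. ereal (g r))) (near_end a b e)"

definition sup_attained_at_end :: "ereal \<Rightarrow> ereal \<Rightarrow> (real \<Rightarrow> real) \<Rightarrow> ereal \<Rightarrow> bool" where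
  "sup_attained_at_end a b g e \<longleftrightarrow>
     ((\<lambda>r. ereal (g r)) \<longlongrightarrow> (SUP r\<in>einterval a b. ereal (g r))) (near_end a b e)"

end

theory Submission
  imports Defs
begin

text \<open>
  In the coordinate \<open>w = |\<theta>|\<close>, for which \<open>w' = \<plusminus> \<xi>\<^sup>2 / f\<^sup>2\<close> and \<open>w\<^sup>2 + c = \<xi>\<^sup>2 / f\<^sup>2\<close>, the orbits satisfy
  Binet's equation \<open>d\<^sup>2w/d\<phi>\<^sup>2 + \<xi>\<^sup>2 w = - (\<xi>\<^sup>4 / K\<^sup>2) dV/dw\<close> of the Euclidean problem, with \<open>\<xi>\<close> as frequency;
  for the two potentials \<open>w\<close>, respectively \<open>w\<^sup>2\<close>, oscillates harmonically with frequency \<open>\<xi>\<close>,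
  respectively \<open>2\<xi>\<close>, and \<open>\<xi>\<close> rational closes the orbits.

  Conversely, near a strongly stable circle all orbits are written down by quadratures. Being closed
  makes their angular period a rational multiple of \<open>2\<pi>\<close>, and continuity makes it independent of
  the amplitude. The limit at amplitude zero shows that \<open>\<beta> = 1 - w D\<^sup>2V / DV\<close>, \<open>D = d/dw\<close>, is rational,
  hence locally constant; the set where \<open>DV\<close> follows the resulting power law is open and closed,
  so it is the whole interval. The next order in the amplitude gives
  \<open>5 (D\<^sup>3U)\<^sup>2 = 3 D\<^sup>2U D\<^sup>4U\<close> for the effective potential \<open>U\<close>, which leaves only \<open>\<beta> = 1\<close> and \<open>\<beta> = 4\<close>.
\<close>

section \<open>Smooth functions\<close>

text \<open>The argument lives near strongly stable circles, and this shapes the proof. Each of the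
  five classes must first supply one such circle: along a bounded noncircular orbit the radial force
  points outwards somewhere and inwards further out, and in between the squared momentum of the
  circles varies in the stable direction; in the weak class, if there were none, an orbitally stable
  circle would be a global maximum of the effective potential, where stability fails. Moreover
  \<beta> is controlled only where \<open>D V < 0\<close> and \<beta> > 0; the power law itself
  preserves both signs, which makes its domain open and closed. The integral of the angle over the
  radius is singular at the turning points. In the Morse coordinate \<open>s\<close> it becomes the
  integral over a full circle of one fixed function of \<rho> sin \<alpha>, so that continuity in
  the amplitude \<rho> and the value at \<rho> = 0 are immediate. The next order says that the
  second derivative of this function vanishes at 0, that is, that \<open>w\<close> as a function of
  \<open>s\<close> has no cubic term.\<close>

definition diffk :: "nat \<Rightarrow> real set \<Rightarrow> (real \<Rightarrow> real) \<Rightarrow> bool" where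
  "diffk n U g \<longleftrightarrow> (\<forall>k<n. \<forall>x\<in>U. (deriv ^^ k) g differentiable (at x))"

lemma smooth_on_diffk: "smooth_on U g \<longleftrightarrow> (\<forall>n. diffk n U g)"
  unfolding smooth_on_def diffk_def by blast

lemma diffk_0 [simp]: "diffk 0 U g"
  by (simp add: diffk_def)

lemma diffk_Suc:
  "diffk (Suc n) U g \<longleftrightarrow> (\<forall>x\<in>U. g differentiable (at x)) \<and> diffk n U (deriv g)"
proof -
  have "(deriv ^^ Suc k) g = (deriv ^^ k) (deriv g)" for k
    by (simp only: funpow_Suc_right o_apply)
  then show ?thesis
    unfolding diffk_def All_less_Suc2 by (simp add: ball_conj_distrib)
qed

lemma diffk_mono: "diffk n U g \<Longrightarrow> m \<le> n \<Longrightarrow> diffk m U g"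
  by (auto simp: diffk_def)

lemma diffk_SucD: "diffk (Suc n) U g \<Longrightarrow> diffk n U g"
  by (rule diffk_mono) auto

lemma deriv_cong_open:
  fixes g h :: "real \<Rightarrow> real"
  assumes "open U" "x \<in> U" "\<And>y. y \<in> U \<Longrightarrow> g y = h y"
  shows "deriv g x = deriv h x"
proof (rule deriv_cong_ev)
  show "\<forall>\<^sub>F y in nhds x. g y = h y"
    using assms by (auto simp: eventually_nhds)
qed simp

lemma differentiable_cong_open:
  fixes g h :: "real \<Rightarrow> real"
  assumes "open U" "x \<in> U" "\<And>y. y \<in> U \<Longrightarrow> g y = h y" "h differentiable (at x)"
  shows "g differentiable (at x)"
proof -
  obtain d where "(h has_derivative d) (at x)" using assms(4) by (auto simp: differentiable_def)
  then have "(g has_derivative d) (at x)"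
    by (rule has_derivative_transform_within_open[OF _ assms(1,2)]) (simp add: assms(3))
  then show ?thesis by (auto simp: differentiable_def)
qed

lemma diffk_cong:
  assumes "open U" "\<And>y. y \<in> U \<Longrightarrow> g y = h y" "diffk n U h"
  shows "diffk n U g"
  using assms(2,3)
proof (induction n arbitrary: g h)
  case (Suc n)
  have "diffk n U (deriv g)"
  proof (rule Suc.IH)
    show "deriv g y = deriv h y" if "y \<in> U" for y
      by (rule deriv_cong_open[OF assms(1) that Suc.prems(1)])
    show "diffk n U (deriv h)" using Suc.prems(2) by (simp add: diffk_Suc)
  qed
  moreover have "g differentiable (at x)" if "x \<in> U" for x
    by (rule differentiable_cong_open[OF assms(1) that Suc.prems(1)])
      (use Suc.prems(2) that in \<open>simp_all add: diffk_Suc\<close>)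
  ultimately show ?case by (simp add: diffk_Suc)
qed simp

text \<open>The step of the closure inductions below: any formula for the derivative that holds on
  \<open>U\<close> may stand in for \<open>deriv g\<close>, because iterated derivatives on an open
  set depend only on the values there.\<close>

lemma diffk_SucI:
  assumes "open U" "\<And>x. x \<in> U \<Longrightarrow> (g has_real_derivative g' x) (at x)" "diffk n U g'"
  shows "diffk (Suc n) U g"
  unfolding diffk_Suc
proof
  show "\<forall>x\<in>U. g differentiable (at x)"
    using assms(2) real_differentiable_def by blast
  show "diffk n U (deriv g)"
    by (rule diffk_cong[OF assms(1) DERIV_imp_deriv[OF assms(2)] assms(3)])
qed

lemma diffk_Suc_DERIV:
  "diffk (Suc n) U g \<Longrightarrow> x \<in> U \<Longrightarrow> (g has_real_derivative deriv g x) (at x)"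
  unfolding diffk_Suc by (simp add: DERIV_deriv_iff_real_differentiable)

lemma diffk_Suc_deriv: "diffk (Suc n) U g \<Longrightarrow> diffk n U (deriv g)"
  unfolding diffk_Suc by simp

lemma diffk_const: "open U \<Longrightarrow> diffk n U (\<lambda>x. c)"
proof (induction n arbitrary: c)
  case (Suc n)
  show ?case by (rule diffk_SucI[OF Suc.prems DERIV_const Suc.IH[OF Suc.prems]])
qed simp

lemma diffk_ident: "open U \<Longrightarrow> diffk n U (\<lambda>x. x)"
proof (cases n)
  case (Suc m)
  assume U: "open U"
  show ?thesis unfolding Suc
    by (rule diffk_SucI[OF U DERIV_ident diffk_const[OF U]])
qed simp

lemma diffk_add: "open U \<Longrightarrow> diffk n U g \<Longrightarrow> diffk n U h \<Longrightarrow> diffk n U (\<lambda>x. g x + h x)"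
proof (induction n arbitrary: g h)
  case (Suc n)
  show ?case
    by (rule diffk_SucI[OF Suc.prems(1)],
        rule DERIV_add[OF diffk_Suc_DERIV[OF Suc.prems(2)] diffk_Suc_DERIV[OF Suc.prems(3)]],
        assumption, assumption, rule Suc.IH[OF Suc.prems(1) Suc.prems(2,3)[THEN diffk_Suc_deriv]])
qed simp

lemma diffk_mult: "open U \<Longrightarrow> diffk n U g \<Longrightarrow> diffk n U h \<Longrightarrow> diffk n U (\<lambda>x. g x * h x)"
proof (induction n arbitrary: g h)
  case (Suc n)
  show ?case
  proof (rule diffk_SucI[OF Suc.prems(1)])
    show "((\<lambda>x. g x * h x) has_real_derivative deriv g x * h x + deriv h x * g x) (at x)" if "x \<in> U" for x
      by (intro DERIV_mult diffk_Suc_DERIV[OF Suc.prems(2)] diffk_Suc_DERIV[OF Suc.prems(3)] that)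
    show "diffk n U (\<lambda>x. deriv g x * h x + deriv h x * g x)"
      by (intro diffk_add Suc.IH Suc.prems(1) Suc.prems(2,3)[THEN diffk_SucD]
          Suc.prems(2,3)[THEN diffk_Suc_deriv])
  qed
qed simp

lemma diffk_inverse:
  assumes "open U" "\<And>x. x \<in> U \<Longrightarrow> g x \<noteq> 0"
  shows "diffk n U g \<Longrightarrow> diffk n U (\<lambda>x. inverse (g x))"
proof (induction n)
  case (Suc n)
  show ?case
  proof (rule diffk_SucI[OF assms(1)])
    show "((\<lambda>x. inverse (g x)) has_real_derivative (-1) * deriv g x * (inverse (g x) * inverse (g x))) (at x)"
      if "x \<in> U" for x
      using DERIV_inverse'[OF diffk_Suc_DERIV[OF Suc.prems that] assms(2)[OF that]] by (simp add: mult_ac)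
    show "diffk n U (\<lambda>x. (-1) * deriv g x * (inverse (g x) * inverse (g x)))"
      by (rule diffk_mult[OF assms(1) diffk_mult[OF assms(1) diffk_const[OF assms(1)]
            diffk_Suc_deriv[OF Suc.prems]] diffk_mult[OF assms(1)]])
        (rule Suc.IH[OF diffk_SucD[OF Suc.prems]])+
  qed
qed simp

lemma diffk_powr:
  assumes "open U" "\<And>x. x \<in> U \<Longrightarrow> g x > 0"
  shows "diffk n U g \<Longrightarrow> diffk n U (\<lambda>x. g x powr c)"
\<comment> \<open>Differentiation lowers the exponent, so the induction hypothesis is needed at
  \<open>c - 1\<close>.\<close>
proof (induction n arbitrary: c)
  case (Suc n)
  show ?case
  proof (rule diffk_SucI[OF assms(1)])
    show "((\<lambda>x. g x powr c) has_real_derivative c * g x powr (c - 1) * deriv g x) (at x)"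
      if "x \<in> U" for x
      using DERIV_chain2[OF has_real_derivative_powr[OF assms(2)[OF that]] diffk_Suc_DERIV[OF Suc.prems that]]
      by simp
    show "diffk n U (\<lambda>x. c * g x powr (c - 1) * deriv g x)"
      by (rule diffk_mult[OF assms(1) diffk_mult[OF assms(1) diffk_const[OF assms(1)]
            Suc.IH[OF diffk_SucD[OF Suc.prems]]] diffk_Suc_deriv[OF Suc.prems]])
  qed
qed simp

lemma smooth_on_const: "open U \<Longrightarrow> smooth_on U (\<lambda>x. c)"
  and smooth_on_ident: "open U \<Longrightarrow> smooth_on U (\<lambda>x. x)"
  and smooth_on_add: "open U \<Longrightarrow> smooth_on U g \<Longrightarrow> smooth_on U h \<Longrightarrow> smooth_on U (\<lambda>x. g x + h x)"
  and smooth_on_mult: "open U \<Longrightarrow> smooth_on U g \<Longrightarrow> smooth_on U h \<Longrightarrow> smooth_on U (\<lambda>x. g x * h x)"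
  unfolding smooth_on_diffk by (simp_all add: diffk_const diffk_ident diffk_add diffk_mult)

lemma smooth_on_inverse:
  "open U \<Longrightarrow> (\<And>x. x \<in> U \<Longrightarrow> g x \<noteq> 0) \<Longrightarrow> smooth_on U g \<Longrightarrow> smooth_on U (\<lambda>x. inverse (g x))"
  unfolding smooth_on_diffk by (simp add: diffk_inverse)

lemma smooth_on_powr:
  "open U \<Longrightarrow> (\<And>x. x \<in> U \<Longrightarrow> g x > 0) \<Longrightarrow> smooth_on U g \<Longrightarrow> smooth_on U (\<lambda>x. g x powr c)"
  unfolding smooth_on_diffk by (simp add: diffk_powr)

lemma smooth_on_cong:
  assumes "open U" "\<And>x. x \<in> U \<Longrightarrow> g x = h x" "smooth_on U h"
  shows "smooth_on U g"
  unfolding smooth_on_diffk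
proof
  show "diffk n U g" for n
    by (rule diffk_cong[OF assms(1,2)]) (use assms(3) in \<open>simp_all add: smooth_on_diffk\<close>)
qed

lemma smooth_on_minus: "open U \<Longrightarrow> smooth_on U g \<Longrightarrow> smooth_on U (\<lambda>x. - g x)"
  using smooth_on_mult[OF _ smooth_on_const[of U "-1"]] by simp

lemma smooth_on_diff:
  "open U \<Longrightarrow> smooth_on U g \<Longrightarrow> smooth_on U h \<Longrightarrow> smooth_on U (\<lambda>x. g x - h x)"
  using smooth_on_add[OF _ _ smooth_on_minus] by simp

lemma smooth_on_divide:
  "open U \<Longrightarrow> (\<And>x. x \<in> U \<Longrightarrow> h x \<noteq> 0) \<Longrightarrow> smooth_on U g \<Longrightarrow> smooth_on U h
    \<Longrightarrow> smooth_on U (\<lambda>x. g x / h x)"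
  unfolding divide_inverse by (intro smooth_on_mult smooth_on_inverse)

lemma smooth_on_power: "open U \<Longrightarrow> smooth_on U g \<Longrightarrow> smooth_on U (\<lambda>x. g x ^ n)"
  by (induction n) (simp_all add: smooth_on_const smooth_on_mult)

lemma smooth_on_DERIV:
  "smooth_on U g \<Longrightarrow> x \<in> U \<Longrightarrow> (g has_real_derivative deriv g x) (at x)"
  unfolding smooth_on_diffk by (rule diffk_Suc_DERIV) blast+

lemma smooth_on_deriv: "smooth_on U g \<Longrightarrow> smooth_on U (deriv g)"
  unfolding smooth_on_diffk using diffk_Suc_deriv by blast

lemma smooth_on_subset: "smooth_on U g \<Longrightarrow> W \<subseteq> U \<Longrightarrow> smooth_on W g"
  unfolding smooth_on_def by blast

lemma smooth_on_isCont: "smooth_on U g \<Longrightarrow> x \<in> U \<Longrightarrow> isCont g x"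
  using smooth_on_DERIV DERIV_isCont by blast

lemma smooth_on_continuous_on: "smooth_on U g \<Longrightarrow> continuous_on U g"
  by (simp add: continuous_at_imp_continuous_on smooth_on_isCont)

lemmas smooth_intros = smooth_on_const smooth_on_ident smooth_on_add smooth_on_mult
  smooth_on_minus smooth_on_diff smooth_on_divide smooth_on_power smooth_on_deriv


section \<open>Hadamard's lemma and the normal form at a nondegenerate minimum\<close>

lemma open_Collect_pos:
  fixes h :: "real \<Rightarrow> real"
  assumes "open E" "continuous_on E h"
  shows "open {x \<in> E. 0 < h x}"
proof -
  have "open (E \<inter> h -` {0<..})"
    using continuous_open_preimage[OF assms(2,1)] by simp
  moreover have "E \<inter> h -` {0<..} = {x \<in> E. 0 < h x}" by auto
  ultimately show ?thesis by simp
qed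

text \<open>The weight \<open>s ^ j\<close> makes this family of parameter integrals closed under
  differentiation in \<open>x\<close>: the chain rule produces one more factor \<open>s\<close> and
  replaces \<open>h\<close> by its derivative. Smoothness of the whole family then follows by
  induction over all \<open>j\<close> and \<open>h\<close> at once.\<close>

lemma hadamard_integral_DERIV:
  fixes h :: "real \<Rightarrow> real"
  assumes E: "open E" "convex E" and x0: "x0 \<in> E" and x: "x \<in> E"
    and h: "\<And>y. y \<in> E \<Longrightarrow> (h has_real_derivative h' y) (at y)" "continuous_on E h'"
  shows "((\<lambda>x. integral {0..1} (\<lambda>s. s ^ j * h (x0 + s * (x - x0))))
     has_real_derivative integral {0..1} (\<lambda>s. s ^ Suc j * h' (x0 + s * (x - x0)))) (at x)"
proof -
  have seg: "x0 + s * (y - x0) \<in> E" if "y \<in> E" "s \<in> {0..1}" for s y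
  proof -
    have "x0 + s * (y - x0) = (1 - s) *\<^sub>R x0 + s *\<^sub>R y" by (simp add: algebra_simps)
    then show ?thesis using convexD_alt[OF E(2) x0 that(1)] that by simp
  qed
  have ch: "continuous_on E h"
    by (rule continuous_at_imp_continuous_on) (blast intro: DERIV_isCont h(1))
  have "((\<lambda>x. integral (cbox 0 1) (\<lambda>s. s ^ j * h (x0 + s * (x - x0))))
     has_real_derivative integral (cbox 0 1) (\<lambda>s. s ^ Suc j * h' (x0 + s * (x - x0)))) (at x within E)"
  proof (rule leibniz_rule_field_derivative[OF _ _ _ x E(2)])
    fix y s :: real assume y: "y \<in> E" "s \<in> cbox 0 1"
    have "((\<lambda>y. s ^ j * h (x0 + s * (y - x0))) has_real_derivative
        s ^ j * (h' (x0 + s * (y - x0)) * s)) (at y)"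
      by (rule DERIV_cmult, rule DERIV_chain2[OF h(1)])
        (use seg y in \<open>auto intro!: derivative_eq_intros\<close>)
    then show "((\<lambda>y. s ^ j * h (x0 + s * (y - x0))) has_real_derivative
        s ^ Suc j * h' (x0 + s * (y - x0))) (at y within E)"
      by (simp add: has_field_derivative_at_within mult_ac)
  next
    fix y assume y: "y \<in> E"
    show "(\<lambda>s. s ^ j * h (x0 + s * (y - x0))) integrable_on cbox 0 1"
      by (rule integrable_continuous, rule continuous_on_mult, intro continuous_intros,
          rule continuous_on_compose2[OF ch]) (use seg y in \<open>auto intro!: continuous_intros\<close>)
  next
    show "continuous_on (E \<times> cbox 0 1) (\<lambda>(y, s). s ^ Suc j * h' (x0 + s * (y - x0)))"
      unfolding case_prod_unfold
      by (rule continuous_on_mult, intro continuous_intros,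
          rule continuous_on_compose2[OF h(2)]) (use seg in \<open>auto intro!: continuous_intros\<close>)
  qed
  then show ?thesis using at_within_open[OF x E(1)] by simp
qed

lemma smooth_on_hadamard_integral:
  assumes E: "open E" "convex E" and x0: "x0 \<in> E" and h: "smooth_on E h"
  shows "smooth_on E (\<lambda>x. integral {0..1} (\<lambda>s. s ^ j * h (x0 + s * (x - x0))))"
proof -
  have "diffk n E (\<lambda>x. integral {0..1} (\<lambda>s. s ^ j * h (x0 + s * (x - x0))))" for n
    using h
  proof (induction n arbitrary: j h)
    case (Suc n)
    show ?case
      by (rule diffk_SucI[OF E(1) hadamard_integral_DERIV[OF E x0 _ smooth_on_DERIV[OF Suc.prems]]])
        (use smooth_on_continuous_on[OF smooth_on_deriv[OF Suc.prems]]
          Suc.IH[OF smooth_on_deriv[OF Suc.prems], of "Suc j"] in auto)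
  qed simp
  then show ?thesis by (simp add: smooth_on_diffk)
qed

text \<open>The quotient is the mean of \<open>deriv g\<close> over the segment from
  \<open>x0\<close> to \<open>x\<close>; the identity is the fundamental theorem of calculus along
  that segment.\<close>

lemma hadamard:
  assumes E: "open E" "convex E" and x0: "x0 \<in> E" and g: "smooth_on E g"
  obtains h where "smooth_on E h" "\<And>x. x \<in> E \<Longrightarrow> g x = g x0 + (x - x0) * h x" "h x0 = deriv g x0"
proof
  let ?h = "\<lambda>x. integral {0..1} (\<lambda>s. s ^ 0 * deriv g (x0 + s * (x - x0)))"
  show "smooth_on E ?h"
    by (rule smooth_on_hadamard_integral[OF E x0 smooth_on_deriv[OF g]])
  show "?h x0 = deriv g x0" by simp
  fix x assume x: "x \<in> E"
  have seg: "x0 + s * (x - x0) \<in> E" if "s \<in> {0..1}" for s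
  proof -
    have "x0 + s * (x - x0) = (1 - s) *\<^sub>R x0 + s *\<^sub>R x" by (simp add: algebra_simps)
    then show ?thesis using convexD_alt[OF E(2) x0 x] that by simp
  qed
  have I: "((\<lambda>s. deriv g (x0 + s * (x - x0)) * (x - x0)) has_integral
      g (x0 + 1 * (x - x0)) - g (x0 + 0 * (x - x0))) {0..1}"
  proof (rule fundamental_theorem_of_calculus)
    fix s :: real assume s: "s \<in> {0..1}"
    have "((\<lambda>s. g (x0 + s * (x - x0))) has_real_derivative deriv g (x0 + s * (x - x0)) * (x - x0)) (at s)"
      by (rule DERIV_chain2[OF smooth_on_DERIV[OF g]])
        (use seg s in \<open>auto intro!: derivative_eq_intros\<close>)
    then show "((\<lambda>s. g (x0 + s * (x - x0))) has_vector_derivative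
        deriv g (x0 + s * (x - x0)) * (x - x0)) (at s within {0..1})"
      by (simp add: has_real_derivative_iff_has_vector_derivative has_vector_derivative_at_within)
  qed simp
  show "g x = g x0 + (x - x0) * ?h x" using integral_unique[OF I] by (simp add: mult.commute)
qed

text \<open>Hadamard's lemma applied twice; the linear term drops out because \<open>x0\<close> is
  critical. Differentiating the first factorization twice at \<open>x0\<close> gives the factor
  1/2.\<close>

lemma hadamard_second_order:
  assumes E: "open E" "convex E" and x0: "x0 \<in> E" and g: "smooth_on E g"
    and "deriv g x0 = 0"
  obtains H where "smooth_on E H" "\<And>x. x \<in> E \<Longrightarrow> g x = g x0 + (x - x0)\<^sup>2 * H x"
    "H x0 = deriv (deriv g) x0 / 2"
proof -
  obtain h where h: "smooth_on E h" "\<And>x. x \<in> E \<Longrightarrow> g x = g x0 + (x - x0) * h x" "h x0 = deriv g x0"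
    using hadamard[OF E x0 g] by blast
  obtain H where H: "smooth_on E H" "\<And>x. x \<in> E \<Longrightarrow> h x = h x0 + (x - x0) * H x" "H x0 = deriv h x0"
    using hadamard[OF E x0 h(1)] by blast
  have dg: "deriv g x = h x + (x - x0) * deriv h x" if "x \<in> E" for x
  proof -
    have "deriv g x = deriv (\<lambda>x. g x0 + (x - x0) * h x) x"
      by (rule deriv_cong_open[OF E(1) that]) (use h(2) in blast)
    also have "\<dots> = h x + (x - x0) * deriv h x"
      by (rule DERIV_imp_deriv) (use smooth_on_DERIV[OF h(1) that] in \<open>auto intro!: derivative_eq_intros\<close>)
    finally show ?thesis .
  qed
  have "deriv (deriv g) x0 = deriv (\<lambda>x. h x + (x - x0) * deriv h x) x0"
    by (rule deriv_cong_open[OF E(1) x0]) (use dg in blast)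
  also have "\<dots> = 2 * deriv h x0"
    by (rule DERIV_imp_deriv)
      (use smooth_on_DERIV[OF h(1) x0] smooth_on_DERIV[OF smooth_on_deriv[OF h(1)] x0] in
        \<open>auto intro!: derivative_eq_intros\<close>)
  finally have "H x0 = deriv (deriv g) x0 / 2" using H(3) by simp
  moreover have "g x = g x0 + (x - x0)\<^sup>2 * H x" if "x \<in> E" for x
    using h(2,3) H(2)[OF that] that assms(5) by (simp add: power2_eq_square)
  ultimately show ?thesis using that H(1) by blast
qed

text \<open>The one-dimensional Morse lemma. With \<open>g - g x0 = (x - x0)\<^sup>2 * H\<close> and
  \<open>H > 0\<close> near \<open>x0\<close>, the function \<open>(x - x0) * sqrt (2 * H)\<close>
  is a smooth signed root of \<open>2 * (g - g x0)\<close>. The neighbourhood can be taken inside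
  any prescribed ball, which the stability proof relies on.\<close>

lemma morse_normal_form:
  assumes E: "open E" "convex E" and x0: "x0 \<in> E" and g: "smooth_on E g"
    and d: "deriv g x0 = 0" "deriv (deriv g) x0 > 0" and e: "e > 0"
  obtains N s where "open N" "convex N" "N \<subseteq> E" "N \<subseteq> ball x0 e" "x0 \<in> N" "smooth_on N s" "s x0 = 0"
    "\<And>x. x \<in> N \<Longrightarrow> deriv s x > 0" "\<And>x. x \<in> N \<Longrightarrow> (s x)\<^sup>2 = 2 * (g x - g x0)"
proof -
  obtain H where H: "smooth_on E H" "\<And>x. x \<in> E \<Longrightarrow> g x = g x0 + (x - x0)\<^sup>2 * H x"
    "H x0 = deriv (deriv g) x0 / 2"
    using hadamard_second_order[OF E x0 g d(1)] by blast
  define s where "s = (\<lambda>x. (x - x0) * (2 * H x) powr (1 / 2))"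
  define G where "G = {x \<in> E. 0 < H x}"
  have G: "open G" "G \<subseteq> E"
    unfolding G_def using open_Collect_pos[OF E(1) smooth_on_continuous_on[OF H(1)]] by auto
  have x0G: "x0 \<in> G" using H(3) d(2) x0 by (simp add: G_def)
  have HG: "smooth_on G H" by (rule smooth_on_subset[OF H(1) G(2)])
  have sG: "smooth_on G s" unfolding s_def
    by (intro smooth_intros smooth_on_powr HG G) (auto simp: G_def)
  have "((\<lambda>x. (2 * H x) powr (1 / 2)) has_real_derivative
      deriv (\<lambda>x. (2 * H x) powr (1 / 2)) x0) (at x0)"
    by (rule smooth_on_DERIV[OF _ x0G], intro smooth_on_powr smooth_intros HG G)
      (auto simp: G_def)
  \<comment> \<open>At \<open>x0\<close> the product rule leaves only the root, since its derivative
    is multiplied by \<open>x - x0\<close>.\<close>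
  then have "(s has_real_derivative (2 * H x0) powr (1 / 2)) (at x0)"
    unfolding s_def by (rule DERIV_mult[THEN DERIV_cong, rotated]) (auto intro!: derivative_eq_intros)
  then have ds0: "deriv s x0 > 0"
    using DERIV_imp_deriv[of s] x0G by (simp add: G_def)
  define G2 where "G2 = {x \<in> G. 0 < deriv s x}"
  have G2: "open G2" "G2 \<subseteq> G" "x0 \<in> G2"
    unfolding G2_def
    using open_Collect_pos[OF G(1) smooth_on_continuous_on[OF smooth_on_deriv[OF sG]]]
      x0G ds0 by auto
  obtain d where dd: "d > 0" "ball x0 d \<subseteq> G2" using G2 open_contains_ball by blast
  let ?N = "ball x0 (min d e)"
  have N: "?N \<subseteq> G2" using dd by auto
  have NE: "?N \<subseteq> E" using N G2(2) G(2) by (rule order_trans[OF order_trans])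
  show ?thesis
  proof (rule that[of ?N s])
    show "smooth_on ?N s" by (rule smooth_on_subset[OF sG]) (use N G2 in auto)
    show "(s x)\<^sup>2 = 2 * (g x - g x0)" if "x \<in> ?N" for x
    proof -
      have x: "x \<in> G" "x \<in> E" using subsetD[OF N that] G2(2) subsetD[OF NE that] by auto
      then have "H x > 0" by (simp add: G_def)
      then have "((2 * H x) powr (1/2))\<^sup>2 = 2 * H x"
        by (simp add: powr_half_sqrt)
      then show ?thesis using H(2)[OF x(2)] by (simp add: s_def power_mult_distrib)
    qed
    show "deriv s x > 0" if "x \<in> ?N" for x using that N by (auto simp: G2_def)
  qed (use NE dd(1) e in \<open>auto simp: s_def\<close>)
qed

section \<open>Inverse functions and quadratures\<close>

text \<open>The inverse function theorem on an interval. It inverts the Morse coordinate and, in the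
  instability proof, the time elapsed as a function of the radius.\<close>

lemma interval_inverse:
  fixes P :: "real \<Rightarrow> real"
  assumes E: "open E" "convex E"
    and P: "\<And>x. x \<in> E \<Longrightarrow> (P has_real_derivative P' x) (at x)" "\<And>x. x \<in> E \<Longrightarrow> P' x > 0"
  defines "Q \<equiv> inv_into E P"
  shows "open (P ` E)" "convex (P ` E)"
    and "\<And>x y. x \<in> E \<Longrightarrow> y \<in> E \<Longrightarrow> x < y \<Longrightarrow> P x < P y"
    and "\<And>x. x \<in> E \<Longrightarrow> Q (P x) = x"
    and "\<And>y. y \<in> P ` E \<Longrightarrow> Q y \<in> E"
    and "\<And>y. y \<in> P ` E \<Longrightarrow> P (Q y) = y"
    and "\<And>y. y \<in> P ` E \<Longrightarrow> (Q has_real_derivative inverse (P' (Q y))) (at y)"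
proof -
  have cont: "isCont P x" if "x \<in> E" for x by (rule DERIV_isCont[OF P(1)[OF that]])
  then have cP: "continuous_on E P" by (simp add: continuous_at_imp_continuous_on)
  have mono: "P x < P y" if "x \<in> E" "y \<in> E" "x < y" for x y
  proof (rule DERIV_pos_imp_increasing[OF that(3)])
    fix z assume "x \<le> z" "z \<le> y"
    then have "z \<in> E" using E(2) that
      by (meson is_interval_convex_1 mem_is_interval_1_I)
    then show "\<exists>d. (P has_real_derivative d) (at z) \<and> 0 < d" using P by blast
  qed
  have inj: "inj_on P E"
    by (rule linorder_inj_onI') (use mono in force)
  have op: "open (P ` E)"
    using injective_eq_1d_open_map_UNIV[OF cP] E inj by (simp add: is_interval_convex_1)
  have cvx: "convex (P ` E)"
    using connected_continuous_image[OF cP] E(2)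
    by (simp add: is_interval_connected_1 flip: is_interval_convex_1)
  have QE: "Q y \<in> E" "P (Q y) = y" if "y \<in> P ` E" for y
    using that by (auto simp: Q_def inv_into_into f_inv_into_f)
  have QP: "Q (P x) = x" if "x \<in> E" for x
    using inj that by (simp add: Q_def)
  show "(Q has_real_derivative inverse (P' (Q y))) (at y)" if y: "y \<in> P ` E" for y
  proof -
    define x where "x = Q y"
    have xE: "x \<in> E" and Px: "P x = y" using QE y by (auto simp: x_def)
    obtain d where d: "d > 0" "cball x d \<subseteq> E" using xE E open_contains_cball by blast
    have near: "z \<in> E" if "\<bar>z - x\<bar> \<le> d" for z
      using d that by (auto simp: dist_real_def subset_iff abs_minus_commute)
    have "isCont Q (P x)"
      by (rule isCont_inverse_function[where f = P and x = x, OF d(1)])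
        (use near QP cont in auto)
    then have "isCont Q y" by (simp add: Px)
    obtain e where e: "e > 0" "ball y e \<subseteq> P ` E" using op y open_contains_ball by blast
    have img: "z \<in> P ` E" if "y - e < z" "z < y + e" for z
      using e(2) that by (auto simp: dist_real_def subset_iff)
    have "P' x \<noteq> 0" using P(2)[OF xE] by simp
    then show ?thesis
      by (intro DERIV_inverse_function[where f = P and a = "y - e" and b = "y + e"])
        (use e(1) xE P \<open>isCont Q y\<close> QE(2) img in \<open>auto simp flip: x_def\<close>)
  qed
  show "open (P ` E)" "convex (P ` E)" by (fact op, fact cvx)
  show "\<And>x y. x \<in> E \<Longrightarrow> y \<in> E \<Longrightarrow> x < y \<Longrightarrow> P x < P y" by (fact mono)
  show "\<And>x. x \<in> E \<Longrightarrow> Q (P x) = x" by (fact QP)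
  show "\<And>y. y \<in> P ` E \<Longrightarrow> Q y \<in> E" "\<And>y. y \<in> P ` E \<Longrightarrow> P (Q y) = y" by (fact QE)+
qed

text \<open>A derivative bounded below by \<open>c > 0\<close> forces surjectivity:
  \<open>P x - c * x\<close> is nondecreasing, so \<open>P\<close> passes the value \<open>y\<close>
  within distance \<bar>y - P 0\<bar> / c of 0.\<close>

lemma global_inverse:
  fixes P :: "real \<Rightarrow> real"
  assumes P: "\<And>x. (P has_real_derivative P' x) (at x)" and c: "c > 0" "\<And>x. P' x \<ge> c"
  obtains Q where "\<And>x. Q (P x) = x" "\<And>y. P (Q y) = y"
    "\<And>y. (Q has_real_derivative inverse (P' (Q y))) (at y)"
proof -
  have pos: "P' x > 0" for x using c(2)[of x] c(1) by linarith
  have mono: "P x - c * x \<le> P y - c * y" if "x \<le> y" for x y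
  proof (rule DERIV_nonneg_imp_nondecreasing[OF that])
    fix z
    have "((\<lambda>x. P x - c * x) has_real_derivative P' z - c) (at z)"
      by (auto intro!: derivative_eq_intros P)
    then show "\<exists>d. ((\<lambda>x. P x - c * x) has_real_derivative d) (at z) \<and> 0 \<le> d"
      using c(2)[of z] by (intro exI[of _ "P' z - c"]) simp
  qed
  have img: "y \<in> range P" for y
  proof -
    let ?h = "\<bar>y - P 0\<bar> / c"
    have "P (- ?h) \<le> y" "y \<le> P ?h"
      using mono[of "- ?h" 0] mono[of 0 ?h] c(1) by auto
    moreover have "- ?h \<le> ?h" using c(1) by simp
    moreover have "continuous_on {- ?h..?h} P"
      by (intro continuous_at_imp_continuous_on ballI DERIV_isCont[OF P])
    ultimately obtain x where "P x = y" using IVT'[of P "- ?h" y ?h] by blast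
    then show ?thesis by blast
  qed
  let ?Q = "inv_into UNIV P"
  have inv: "?Q (P x) = x" "P (?Q x) = x" "(?Q has_real_derivative inverse (P' (?Q x))) (at x)" for x
    using interval_inverse[of UNIV P P', OF open_UNIV convex_UNIV P pos] img by simp_all
  show ?thesis by (rule that[of ?Q]) (rule inv)+
qed

lemma antiderivative_exists:
  fixes g :: "real \<Rightarrow> real"
  assumes "a < b" "\<And>x. x \<in> einterval a b \<Longrightarrow> isCont g x"
  obtains G where "\<And>x. x \<in> einterval a b \<Longrightarrow> (G has_real_derivative g x) (at x)"
  using einterval_antiderivative[OF assms(1), of g] assms(2)
  by (auto simp: einterval_iff has_real_derivative_iff_has_vector_derivative)

lemma antiderivative_exists_UNIV:
  fixes g :: "real \<Rightarrow> real"
  assumes "\<And>x. isCont g x"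
  obtains G where "\<And>x. (G has_real_derivative g x) (at x)"
  using antiderivative_exists[of "-\<infinity>" "\<infinity>" g] assms by (auto simp: einterval_iff)

text \<open>Separation of variables: the solution is the inverse of the time \<open>P\<close>, an
  antiderivative of \<open>1 / p\<close>. The upper bound \<open>M\<close> keeps the slope of
  \<open>P\<close> away from 0, so \<open>P\<close> is onto and the solution exists for all
  times.\<close>

lemma autonomous_flow:
  fixes p :: "real \<Rightarrow> real"
  assumes "\<And>x. isCont p x" and m: "m > 0" "\<And>x. m \<le> p x" "\<And>x. p x \<le> M"
  obtains \<alpha> where "\<alpha> t0 = \<alpha>0" "\<And>t. (\<alpha> has_real_derivative p (\<alpha> t)) (at t)"
proof -
  have pos: "p x > 0" for x using m(1) m(2)[of x] by linarith
  obtain P where P: "\<And>x. (P has_real_derivative inverse (p x)) (at x)"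
    by (rule antiderivative_exists_UNIV[of "\<lambda>x. inverse (p x)"])
      (use assms(1) pos in \<open>auto intro!: continuous_intros simp: less_imp_neq[symmetric]\<close>)
  have M: "inverse M > 0" "inverse M \<le> inverse (p x)" for x
    using pos[of x] m(3)[of x] by (auto intro!: le_imp_inverse_le)
  show ?thesis
  proof (rule global_inverse[OF P M])
    fix Q assume Q: "\<And>x. Q (P x) = x" "\<And>y. (Q has_real_derivative inverse (inverse (p (Q y)))) (at y)"
    show ?thesis
    proof (rule that[of "\<lambda>t. Q (t + (P \<alpha>0 - t0))"])
      show "((\<lambda>t. Q (t + (P \<alpha>0 - t0))) has_real_derivative p (Q (t + (P \<alpha>0 - t0)))) (at t)" for t
        using Q(2)[of "t + (P \<alpha>0 - t0)"] by (simp add: DERIV_shift)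
    qed (simp add: Q)
  qed
qed

section \<open>Criteria for constancy, and means over small circles\<close>

lemma DERIV_0_const_interval:
  fixes g :: "real \<Rightarrow> real"
  assumes "convex I" "\<And>t. t \<in> I \<Longrightarrow> (g has_real_derivative 0) (at t)" "s \<in> I" "t \<in> I"
  shows "g s = g t"
  using has_field_derivative_zero_constant[OF assms(1), of g] assms(2-4)
  by (metis has_field_derivative_at_within)

text \<open>Two distinct values would bring in the whole interval between them. This is how
  rationality of a continuous quantity becomes constancy.\<close>

lemma constant_of_countable_range:
  fixes g :: "real \<Rightarrow> real"
  assumes "connected S" "continuous_on S g" "countable (g ` S)" "x \<in> S" "y \<in> S"
  shows "g x = g y"
proof -
  have *: "\<not> u < v" if "u \<in> g ` S" "v \<in> g ` S" for u v
  proof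
    assume "u < v"
    have "{u..v} \<subseteq> g ` S"
      using connected_contains_Icc[OF connected_continuous_image[OF assms(2,1)] that] .
    then show False
      using uncountable_closed_interval[of u v] \<open>u < v\<close> countable_subset[OF _ assms(3)] by blast
  qed
  show ?thesis using *[of "g x" "g y"] *[of "g y" "g x"] assms(4,5) by fastforce
qed

text \<open>The mean of \<open>M\<close> over a small circle sees only the even part of \<open>M\<close>, whose graph would
  otherwise leave the value \<open>M 0\<close> strictly in one direction.\<close>

lemma circle_mean_pos:
  fixes M :: "real \<Rightarrow> real"
  assumes \<delta>: "\<delta> > 0" and M: "\<And>y. \<bar>y\<bar> < \<delta> \<Longrightarrow> (M has_real_derivative M1 y) (at y)"
    and M1: "(M1 has_real_derivative M2) (at 0)"
    and C: "\<And>\<rho>. \<bar>\<rho>\<bar> < \<delta> \<Longrightarrow> integral {0..2 * pi} (\<lambda>\<alpha>. M (\<rho> * sin \<alpha>)) = C"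
  shows "\<not> M2 > 0"
proof
  assume "M2 > 0"
  \<comment> \<open>Twice the even part of \<open>M\<close>, normalised to vanish at 0; the slope of
    its derivative at 0 is \<open>2 * M2\<close>.\<close>
  define N where "N y = M y + M (- y) - 2 * M 0" for y
  have N': "(N has_real_derivative M1 y - M1 (- y)) (at y)" if "\<bar>y\<bar> < \<delta>" for y
  proof -
    have "((\<lambda>y. M (- y)) has_real_derivative M1 (- y) * (- 1)) (at y)"
      by (rule DERIV_chain2[of M]) (use M that in \<open>auto intro!: derivative_eq_intros\<close>)
    then show ?thesis unfolding N_def by (auto intro!: derivative_eq_intros M that)
  qed
  have "((\<lambda>y. M1 (- y)) has_real_derivative M2 * (- 1)) (at 0)"
    by (rule DERIV_chain2[of M1]) (use M1 in \<open>auto intro!: derivative_eq_intros\<close>)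
  then have "((\<lambda>y. M1 y - M1 (- y)) has_real_derivative 2 * M2) (at 0)"
    by (auto intro!: derivative_eq_intros M1)
  then obtain d where d: "d > 0" "\<And>h. 0 < h \<Longrightarrow> h < d \<Longrightarrow> M1 h - M1 (- h) > 0"
    using DERIV_pos_inc_right[of "\<lambda>y. M1 y - M1 (- y)" "2 * M2" 0] \<open>M2 > 0\<close> by auto
  have pos: "N y > 0" if "0 < y" "y < min d \<delta>" for y
  proof -
    have "N 0 < N y"
    proof (rule DERIV_pos_imp_increasing_open[OF that(1)])
      fix x assume "0 < x" "x < y"
      then show "\<exists>z. (N has_real_derivative z) (at x) \<and> 0 < z" using N'[of x] d(2)[of x] that by auto
    next
      show "continuous_on {0..y} N"
        by (intro continuous_at_imp_continuous_on ballI DERIV_isCont[OF N']) (use that in auto)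
    qed
    then show ?thesis by (simp add: N_def)
  qed
  have nonneg: "N y \<ge> 0" if "\<bar>y\<bar> < min d \<delta>" for y
  proof -
    have "N y = N \<bar>y\<bar>" by (auto simp: N_def abs_if)
    moreover have "N 0 = 0" by (simp add: N_def)
    ultimately show ?thesis using pos[of "\<bar>y\<bar>"] that by (cases "y = 0") auto
  qed
  define \<rho> where "\<rho> = min d \<delta> / 2"
  have \<rho>: "0 < \<rho>" "\<rho> < min d \<delta>" using d(1) \<delta> by (auto simp: \<rho>_def)
  have small: "\<bar>\<rho> * sin \<alpha>\<bar> < min d \<delta>" for \<alpha>
  proof -
    have "\<bar>\<rho> * sin \<alpha>\<bar> \<le> \<rho> * 1"
      unfolding abs_mult using \<rho>(1) abs_sin_le_one[of \<alpha>] by (intro mult_mono) auto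
    then show ?thesis using \<rho>(2) by linarith
  qed
  have small2: "\<rho> * sin \<alpha> < \<delta>" "- (\<rho> * sin \<alpha>) < \<delta>" "- \<delta> < \<rho> * sin \<alpha>" for \<alpha>
    using small[of \<alpha>] by linarith+
  have cM: "continuous_on {- \<delta><..<\<delta>} M"
    by (intro continuous_at_imp_continuous_on ballI DERIV_isCont[OF M]) auto
  have c: "continuous_on {0..2 * pi} (\<lambda>\<alpha>. M (\<epsilon> * (\<rho> * sin \<alpha>)))" if "\<epsilon> = 1 \<or> \<epsilon> = - 1" for \<epsilon>
    by (rule continuous_on_compose2[OF cM])
      (use small2 that in \<open>auto intro!: continuous_intros\<close>)
  note c1 = c[of 1, simplified] and c2 = c[of "- 1", simplified]
  have "integral {0..2 * pi} (\<lambda>\<alpha>. N (\<rho> * sin \<alpha>)) =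
      integral {0..2 * pi} (\<lambda>\<alpha>. M (\<rho> * sin \<alpha>)) + integral {0..2 * pi} (\<lambda>\<alpha>. M (- (\<rho> * sin \<alpha>)))
      - integral {0..2 * pi} (\<lambda>\<alpha>. 2 * M 0)"
    unfolding N_def
    by (subst integral_diff integral_add, auto intro!: integrable_continuous_interval continuous_intros c1 c2)+
  \<comment> \<open>The three integrals are the mean at amplitude \<rho>, the one at -\<rho>, and
    twice the one at 0: \<open>C + C - 2 * C\<close>.\<close>
  also have "\<dots> = 0"
    using C[of \<rho>] C[of "- \<rho>"] C[of 0] \<rho> \<delta> by simp
  finally have "integral {0..2 * pi} (\<lambda>\<alpha>. N (\<rho> * sin \<alpha>)) = 0" .
  moreover have "continuous_on {0..2 * pi} (\<lambda>\<alpha>. N (\<rho> * sin \<alpha>))"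
    unfolding N_def by (intro continuous_intros c1 c2)
  \<comment> \<open>A nonnegative continuous function with integral 0 vanishes, also at \<alpha> =
    pi / 2, where \<open>N \<rho> > 0\<close> was shown.\<close>
  ultimately have "\<forall>\<alpha>\<in>{0..2 * pi}. N (\<rho> * sin \<alpha>) = 0"
    using integral_eq_0_iff[of 0 "2 * pi" "\<lambda>\<alpha>. N (\<rho> * sin \<alpha>)"] nonneg[OF small] by simp
  then have "N (\<rho> * sin (pi / 2)) = 0" using pi_gt_zero by (intro bspec[of "{0..2*pi}" "\<lambda>\<alpha>. N (\<rho> * sin \<alpha>) = 0"]) simp_all
  then show False using pos[OF \<rho>] by simp
qed

lemma circle_mean_constant:
  fixes M :: "real \<Rightarrow> real"
  assumes "\<delta> > 0" "\<And>y. \<bar>y\<bar> < \<delta> \<Longrightarrow> (M has_real_derivative M1 y) (at y)"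
    "(M1 has_real_derivative M2) (at 0)"
    "\<And>\<rho>. \<bar>\<rho>\<bar> < \<delta> \<Longrightarrow> integral {0..2 * pi} (\<lambda>\<alpha>. M (\<rho> * sin \<alpha>)) = C"
  shows "M2 = 0"
proof -
  have "\<not> M2 > 0" by (rule circle_mean_pos[OF assms])
  moreover have "\<not> - M2 > 0"
    by (rule circle_mean_pos[where M = "\<lambda>y. - M y" and ?M1.0 = "\<lambda>y. - M1 y" and C = "- C" and \<delta> = \<delta>])
      (use assms in \<open>auto intro!: DERIV_minus\<close>)
  ultimately show ?thesis by simp
qed

section \<open>The equations of motion\<close>

lemma convex_einterval: "convex (einterval a b)"
proof (rule is_interval_convex, unfold is_interval_1, intro ballI allI impI)
  fix x y z assume "x \<in> einterval a b" "y \<in> einterval a b" "x \<le> z \<and> z \<le> y"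
  then have *: "a < ereal x" "ereal x \<le> ereal z" "ereal z \<le> ereal y" "ereal y < b"
    by (simp_all add: einterval_iff)
  show "z \<in> einterval a b"
    using less_le_trans[OF *(1,2)] le_less_trans[OF *(3,4)] by (simp add: einterval_iff)
qed

text \<open>The sign \<sigma> of \<theta> is a parameter, so that decreasing \<open>f\<close>
  (\<sigma> = 1) and increasing \<open>f\<close> (\<sigma> = - 1) are treated together. The last two
  assumptions encode that \<open>deriv f\<close> has no zero.\<close>

locale surface =
  fixes a b :: ereal and f :: "real \<Rightarrow> real" and \<xi> \<sigma> :: real
  assumes ab: "a < b"
    and smooth_f: "smooth_on (einterval a b) f"
    and f_pos: "\<And>r. r \<in> einterval a b \<Longrightarrow> f r > 0"
    and \<xi>_pos: "\<xi> > 0"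
    and f_ode: "\<And>r. r \<in> einterval a b \<Longrightarrow> deriv (deriv f) r * f r - (deriv f r)\<^sup>2 = - \<xi>\<^sup>2"
    and \<sigma>: "\<sigma> = 1 \<or> \<sigma> = - 1"
    and \<sigma>_theta: "\<And>r. r \<in> einterval a b \<Longrightarrow> \<sigma> * theta f r > 0"
begin

abbreviation "E \<equiv> einterval a b"

definition w :: "real \<Rightarrow> real" where "w r = \<sigma> * theta f r"

lemmas E_convex = convex_einterval[of a b]

lemma E_between: "x \<in> E \<Longrightarrow> y \<in> E \<Longrightarrow> x \<le> z \<Longrightarrow> z \<le> y \<Longrightarrow> z \<in> E"
  using E_convex by (meson is_interval_convex_1 mem_is_interval_1_I)

lemma \<sigma>_sq: "\<sigma> * \<sigma> = 1" "\<sigma>\<^sup>2 = 1" "\<sigma> \<noteq> 0" "\<bar>\<sigma>\<bar> = 1"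
  using \<sigma> by auto

lemma abs_theta: "r \<in> E \<Longrightarrow> \<bar>theta f r\<bar> = w r"
  using \<sigma>_theta[of r] \<sigma> by (auto simp: w_def)

lemma w_pos: "r \<in> E \<Longrightarrow> w r > 0"
  using \<sigma>_theta by (simp add: w_def)

lemma deriv_f: "r \<in> E \<Longrightarrow> deriv f r = - \<sigma> * w r * f r"
  using f_pos[of r] \<sigma>_sq(1) by (simp add: w_def theta_def flip: mult.assoc)

lemmas f_DERIV = smooth_on_DERIV[OF smooth_f]
lemmas f'_DERIV = smooth_on_DERIV[OF smooth_on_deriv[OF smooth_f]]

lemma smooth_w: "smooth_on E w"
proof (rule smooth_on_cong)
  show "smooth_on E (\<lambda>r. \<sigma> * (- deriv f r / f r))"
    by (rule smooth_on_mult smooth_on_const smooth_on_divide smooth_on_minus smooth_on_deriv smooth_f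
        open_einterval | simp add: f_pos less_imp_neq[symmetric])+
qed (simp_all add: w_def theta_def)

text \<open>The left side of the equation for \<open>f\<close> is, up to sign, the numerator that
  the quotient rule produces for \<theta>.\<close>

lemma w_DERIV: "r \<in> E \<Longrightarrow> (w has_real_derivative \<sigma> * \<xi>\<^sup>2 / (f r)\<^sup>2) (at r)"
proof -
  assume r: "r \<in> E"
  have fr: "f r \<noteq> 0" using f_pos[OF r] by simp
  have "((\<lambda>r. \<sigma> * (- deriv f r / f r)) has_real_derivative
      \<sigma> * ((- deriv (deriv f) r * f r - (- deriv f r) * deriv f r) / (f r * f r))) (at r)"
    by (intro DERIV_cmult DERIV_divide DERIV_minus f_DERIV f'_DERIV r fr)
  also have "(\<lambda>r. \<sigma> * (- deriv f r / f r)) = w" by (auto simp: w_def theta_def)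
  also have "- deriv (deriv f) r * f r - (- deriv f r) * deriv f r = \<xi>\<^sup>2"
    using f_ode[OF r] by (simp add: power2_eq_square)
  finally show ?thesis by (simp add: power2_eq_square)
qed

lemma DERIV_0_const_E:
  assumes "\<And>r. r \<in> E \<Longrightarrow> (g has_real_derivative 0) (at r)"
  obtains c where "\<And>r. r \<in> E \<Longrightarrow> g r = c"
  using DERIV_0_const_interval[OF E_convex assms] by metis

text \<open>The function \<open>g\<close> is a first integral: both of its terms have the derivative
  \<open>2 * w * \<sigma> * \<xi>\<^sup>2 / (f r)\<^sup>2\<close>. Multiplied by
  \<open>(f r)\<^sup>2\<close>, its constancy is the energy integral of
  \<open>f'' = - c * f\<close>, and \<open>c\<close> is half the scalar curvature.\<close>

lemma curvature_constant:
  obtains c where "\<And>r. r \<in> E \<Longrightarrow> deriv (deriv f) r = - c * f r"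
    "\<And>r. r \<in> E \<Longrightarrow> (deriv f r)\<^sup>2 + c * (f r)\<^sup>2 = \<xi>\<^sup>2"
    "\<And>r. r \<in> E \<Longrightarrow> (w r)\<^sup>2 + c = \<xi>\<^sup>2 / (f r)\<^sup>2"
proof -
  define g where "g r = \<xi>\<^sup>2 / (f r)\<^sup>2 - (w r)\<^sup>2" for r
  have "(g has_real_derivative 0) (at r)" if r: "r \<in> E" for r
  proof -
    have "(g has_real_derivative - (\<xi>\<^sup>2 * (2 * f r * deriv f r)) / ((f r)\<^sup>2 * (f r)\<^sup>2)
        - 2 * w r * (\<sigma> * \<xi>\<^sup>2 / (f r)\<^sup>2)) (at r)"
      unfolding g_def using f_pos[OF r]
      by (auto intro!: derivative_eq_intros f_DERIV[OF r] w_DERIV[OF r] simp: mult_ac)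
    then show ?thesis using f_pos[OF r] by (simp add: deriv_f[OF r] field_simps power2_eq_square)
  qed
  then obtain c where c: "\<And>r. r \<in> E \<Longrightarrow> g r = c" using DERIV_0_const_E by blast
  have w2: "(w r)\<^sup>2 + c = \<xi>\<^sup>2 / (f r)\<^sup>2" if "r \<in> E" for r
    using c[OF that] by (simp add: g_def)
  have f2: "(deriv f r)\<^sup>2 + c * (f r)\<^sup>2 = \<xi>\<^sup>2" if r: "r \<in> E" for r
  proof -
    have "(deriv f r)\<^sup>2 + c * (f r)\<^sup>2 = ((w r)\<^sup>2 + c) * (f r)\<^sup>2"
      using \<sigma>_sq(2) by (simp add: deriv_f[OF r] power_mult_distrib distrib_right)
    then show ?thesis using w2[OF r] f_pos[OF r] by simp
  qed
  have "deriv (deriv f) r = - c * f r" if r: "r \<in> E" for r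
  proof -
    have "deriv (deriv f) r * f r = (- c * f r) * f r"
      using f_ode[OF r] f2[OF r] by (simp add: power2_eq_square)
    then show ?thesis using f_pos[OF r] by (metis mult_right_cancel less_irrefl)
  qed
  then show ?thesis using that w2 f2 by blast
qed

lemma smooth_effective_potential:
  "smooth_on E V \<Longrightarrow> smooth_on E (effective_potential f V K)"
  unfolding effective_potential_def
  by (rule smooth_on_mult smooth_on_const smooth_on_divide smooth_on_add smooth_on_power smooth_f
        open_einterval | simp add: f_pos less_imp_neq[symmetric] | assumption)+

text \<open>The first form matches the Euler-Lagrange equation; the second, with
  \<open>deriv f = - \<sigma> * w * f\<close>, prepares the passage to the coordinate
  \<open>w\<close>.\<close>

lemma deriv_effective_potential:
  assumes "smooth_on E V" "r \<in> E"
  shows "deriv (effective_potential f V K) r = deriv V r - K\<^sup>2 * deriv f r / (f r) ^ 3"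
    and "deriv (effective_potential f V K) r = deriv V r + \<sigma> * K\<^sup>2 * w r / (f r)\<^sup>2"
proof -
  have "(effective_potential f V K has_real_derivative
      deriv V r + - (K\<^sup>2 * (2 * (2 * f r * deriv f r))) / (2 * (f r)\<^sup>2 * (2 * (f r)\<^sup>2))) (at r)"
    unfolding effective_potential_def using f_pos[OF assms(2)]
    by (auto intro!: derivative_eq_intros f_DERIV[OF assms(2)] smooth_on_DERIV[OF assms])
  then have *: "deriv (effective_potential f V K) r =
      deriv V r + - (K\<^sup>2 * (2 * (2 * f r * deriv f r))) / (2 * (f r)\<^sup>2 * (2 * (f r)\<^sup>2))"
    by (rule DERIV_imp_deriv)
  show "deriv (effective_potential f V K) r = deriv V r - K\<^sup>2 * deriv f r / (f r) ^ 3"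
    using f_pos[OF assms(2)] unfolding * by (simp add: field_simps power2_eq_square power3_eq_cube)
  then show "deriv (effective_potential f V K) r = deriv V r + \<sigma> * K\<^sup>2 * w r / (f r)\<^sup>2"
    using f_pos[OF assms(2)] by (simp add: deriv_f[OF assms(2)] field_simps power2_eq_square power3_eq_cube)
qed

text \<open>First-order form of the equations of motion at fixed angular momentum. The radial
  velocity is a separate function, so that motions found by quadrature can supply it by a
  formula.\<close>

definition motion ::
  "(real \<Rightarrow> real) \<Rightarrow> real \<Rightarrow> real set \<Rightarrow> (real \<Rightarrow> real) \<Rightarrow> (real \<Rightarrow> real) \<Rightarrow> (real \<Rightarrow> real) \<Rightarrow> bool" where
  "motion V K I r v \<phi> \<longleftrightarrow> (\<forall>t\<in>I. r t \<in> E \<and> (r has_real_derivative v t) (at t) \<and>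
     (v has_real_derivative - deriv (effective_potential f V K) (r t)) (at t) \<and>
     (\<phi> has_real_derivative K / (f (r t))\<^sup>2) (at t))"

lemma motionD:
  assumes "motion V K I r v \<phi>" "t \<in> I"
  shows "r t \<in> E" "(r has_real_derivative v t) (at t)"
    "(v has_real_derivative - deriv (effective_potential f V K) (r t)) (at t)"
    "(\<phi> has_real_derivative K / (f (r t))\<^sup>2) (at t)"
  using assms by (auto simp: motion_def)

lemma deriv_lagrangian_velocities:
  "deriv (\<lambda>v. lagrangian f V x v u) v = v"
  "deriv (\<lambda>u. lagrangian f V x v u) u = (f x)\<^sup>2 * u"
  unfolding lagrangian_def by (rule DERIV_imp_deriv, auto intro!: derivative_eq_intros)+

lemma deriv_lagrangian_position:
  assumes "smooth_on E V" "x \<in> E"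
  shows "deriv (\<lambda>x. lagrangian f V x v u) x = f x * deriv f x * u\<^sup>2 - deriv V x"
  unfolding lagrangian_def
  by (rule DERIV_imp_deriv)
    (auto intro!: derivative_eq_intros f_DERIV[OF assms(2)] smooth_on_DERIV[OF assms])

lemma solution_imp_motion:
  assumes V: "smooth_on E V" and sol: "solution_on a b f V I r \<phi>" and K: "has_momentum f I r \<phi> K"
  shows "motion V K I r (deriv r) \<phi>"
  unfolding motion_def
proof (intro ballI conjI)
  fix t assume t: "t \<in> I"
  have *: "r t \<in> E" "r differentiable (at t)" "\<phi> differentiable (at t)"
    "(deriv r has_real_derivative f (r t) * deriv f (r t) * (deriv \<phi> t)\<^sup>2 - deriv V (r t)) (at t)"
    using sol t deriv_lagrangian_position[OF V]
    by (auto simp: solution_on_def deriv_lagrangian_velocities)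
  have \<phi>: "deriv \<phi> t = K / (f (r t))\<^sup>2"
    using K t f_pos[OF *(1)] by (auto simp: has_momentum_def field_simps)
  have "f (r t) * deriv f (r t) * (deriv \<phi> t)\<^sup>2 - deriv V (r t)
      = - deriv (effective_potential f V K) (r t)"
    using f_pos[OF *(1)] unfolding \<phi> deriv_effective_potential(1)[OF V *(1)]
    by (simp add: field_simps power2_eq_square power3_eq_cube)
  then show "(deriv r has_real_derivative - deriv (effective_potential f V K) (r t)) (at t)"
    using *(4) by simp
  show "r t \<in> E" by (fact *(1))
  show "(r has_real_derivative deriv r t) (at t)" "(\<phi> has_real_derivative K / (f (r t))\<^sup>2) (at t)"
    using *(2,3) \<phi> by (metis DERIV_deriv_iff_real_differentiable)+
qed

lemma motion_imp_solution:
  assumes V: "smooth_on E V" and I: "open I" "is_interval I" "I \<noteq> {}" and m: "motion V K I r v \<phi>"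
  shows "solution_on a b f V I r \<phi>" "has_momentum f I r \<phi> K" "\<And>t. t \<in> I \<Longrightarrow> deriv r t = v t"
proof -
  note mD = motionD[OF m]
  show dr: "deriv r t = v t" if "t \<in> I" for t using DERIV_imp_deriv[OF mD(2)[OF that]] .
  have d\<phi>: "deriv \<phi> t = K / (f (r t))\<^sup>2" if "t \<in> I" for t using DERIV_imp_deriv[OF mD(4)[OF that]] .
  show mom: "has_momentum f I r \<phi> K"
    using f_pos mD(1) by (force simp: has_momentum_def d\<phi>)
  show "solution_on a b f V I r \<phi>"
    unfolding solution_on_def deriv_lagrangian_velocities
  proof (intro conjI ballI I)
    fix t assume t: "t \<in> I"
    note rE = mD(1)[OF t]
    show "r t \<in> E" "r differentiable at t" "\<phi> differentiable at t"
      using mD[OF t] real_differentiable_def by blast+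
    have "(deriv r has_real_derivative - deriv (effective_potential f V K) (r t)) (at t)"
      by (rule has_field_derivative_transform_within_open[OF mD(3)[OF t] I(1) t]) (simp add: dr)
    also have "- deriv (effective_potential f V K) (r t)
        = f (r t) * deriv f (r t) * (deriv \<phi> t)\<^sup>2 - deriv V (r t)"
      using f_pos[OF rE] unfolding d\<phi>[OF t] deriv_effective_potential(1)[OF V rE]
      by (simp add: field_simps power2_eq_square power3_eq_cube)
    finally show "(deriv r has_real_derivative deriv (\<lambda>x. lagrangian f V x (deriv r t) (deriv \<phi> t)) (r t)) (at t)"
      by (simp add: deriv_lagrangian_position[OF V rE])
    show "((\<lambda>s. (f (r s))\<^sup>2 * deriv \<phi> s) has_real_derivative 0) (at t)"
      by (rule has_field_derivative_transform_within_open[OF DERIV_const I(1) t])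
        (use mom in \<open>simp add: has_momentum_def\<close>)
  qed
qed

text \<open>A solution on the whole time axis admits no proper extension, so maximality is
  automatic.\<close>

lemma motion_UNIV_imp_trajectory:
  assumes "smooth_on E V" "motion V K UNIV r v \<phi>"
  shows "trajectory a b f V UNIV r \<phi>" "has_momentum f UNIV r \<phi> K" "\<And>t. deriv r t = v t"
  using motion_imp_solution[OF assms(1) _ _ _ assms(2)] by (auto simp: trajectory_def)

lemma motion_energy:
  assumes V: "smooth_on E V" and "convex I" and m: "motion V K I r v \<phi>" and "s \<in> I" "t \<in> I"
  shows "(v s)\<^sup>2 / 2 + effective_potential f V K (r s) = (v t)\<^sup>2 / 2 + effective_potential f V K (r t)"
proof (rule DERIV_0_const_interval[where I = I and g = "\<lambda>t. (v t)\<^sup>2 / 2 + effective_potential f V K (r t)"])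
  fix t assume t: "t \<in> I"
  note mD = motionD[OF m t]
  have "((\<lambda>t. (v t)\<^sup>2 / 2 + effective_potential f V K (r t)) has_real_derivative
      2 * v t * (- deriv (effective_potential f V K) (r t)) / 2 +
      deriv (effective_potential f V K) (r t) * v t) (at t)"
    by (intro DERIV_add DERIV_chain2[OF smooth_on_DERIV[OF smooth_effective_potential[OF V] mD(1)] mD(2)]
        DERIV_cdivide) (use mD(3) in \<open>auto intro!: derivative_eq_intros\<close>)
  then show "((\<lambda>t. (v t)\<^sup>2 / 2 + effective_potential f V K (r t)) has_real_derivative 0) (at t)"
    by simp
qed (use assms in auto)


section \<open>Circular orbits\<close>

text \<open>A critical point of the effective potential is a rest point of the radial equation, and
  for \<open>K \<noteq> 0\<close> the uniformly moving angle sweeps the entire circle.\<close>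

lemma circular_motion:
  assumes V: "smooth_on E V" and "r0 \<in> E" "deriv (effective_potential f V K) r0 = 0" "K \<noteq> 0"
  shows "circular_trajectory a b f V r0 K UNIV (\<lambda>_. r0) (\<lambda>t. K / (f r0)\<^sup>2 * t)"
proof -
  let ?c = "K / (f r0)\<^sup>2"
  have c: "?c \<noteq> 0" using assms f_pos[of r0] by auto
  have "motion V K UNIV (\<lambda>_. r0) (\<lambda>_. 0) (\<lambda>t. ?c * t)"
    unfolding motion_def using assms by (auto intro!: derivative_eq_intros)
  note tr = motion_UNIV_imp_trajectory[OF V this]
  have "orbit UNIV (\<lambda>_. r0) (\<lambda>t. ?c * t) = circle r0"
  proof -
    have *: "\<exists>t. z = cis (?c * t)" if "cmod z = 1" for z
    proof -
      have "z = cis (?c * (Arg z / ?c))" using that c cis_Arg[of z] by (cases "z = 0") (simp_all add: sgn_eq)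
      then show ?thesis by blast
    qed
    show ?thesis
    proof
      show "circle r0 \<subseteq> orbit UNIV (\<lambda>_. r0) (\<lambda>t. ?c * t)"
        using * unfolding circle_def orbit_def by force
    qed (auto simp: orbit_def circle_def)
  qed
  then show ?thesis using tr by (simp add: circular_trajectory_def)
qed

text \<open>Since the orbit is required to be the full circle, \<open>K = 0\<close> is impossible:
  the angle would be constant and the orbit a single point, whereas the circle contains two
  antipodal ones.\<close>

lemma circular_trajectoryD:
  assumes V: "smooth_on E V" and ct: "circular_trajectory a b f V r0 K I r \<phi>"
  shows "r0 \<in> E" "deriv (effective_potential f V K) r0 = 0" "K \<noteq> 0"
    "phase_point r \<phi> ` I = circle r0 \<times> {(0, K / (f r0)\<^sup>2)}"
proof -
  have sol: "solution_on a b f V I r \<phi>" and orb: "orbit I r \<phi> = circle r0" and K: "has_momentum f I r \<phi> K"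
    using ct by (auto simp: circular_trajectory_def trajectory_def)
  have I: "open I" "is_interval I" "I \<noteq> {}" using sol by (auto simp: solution_on_def)
  note mD = motionD[OF solution_imp_motion[OF V sol K]]
  have r: "r t = r0" if "t \<in> I" for t
    using orb that by (auto simp: orbit_def circle_def)
  have v: "deriv r t = 0" if "t \<in> I" for t
    using deriv_cong_open[OF I(1) that r] by simp
  obtain t where t: "t \<in> I" using I by blast
  show r0: "r0 \<in> E" using mD(1)[OF t] r[OF t] by simp
  have "deriv (deriv r) t = 0" using deriv_cong_open[OF I(1) t v] by simp
  then show "deriv (effective_potential f V K) r0 = 0"
    using DERIV_imp_deriv[OF mD(3)[OF t]] r[OF t] by simp
  show "K \<noteq> 0"
  proof
    assume "K = 0"
    then have "\<phi> s = \<phi> t" if "s \<in> I" for s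
      using DERIV_0_const_interval[of I \<phi> s t] mD(4) that t I(2) by (simp add: is_interval_convex_1)
    then have sub: "circle r0 \<subseteq> {(r0, cis (\<phi> t))}"
      using r unfolding orb[symmetric] by (auto simp: orbit_def)
    have "(r0, 1) \<in> circle r0" "(r0, - 1) \<in> circle r0" by (auto simp: circle_def)
    then have "cis (\<phi> t) = 1" "cis (\<phi> t) = - 1" using sub by auto
    then show False by simp
  qed
  have "phase_point r \<phi> ` I = (\<lambda>z. (z, (0, K / (f r0)\<^sup>2))) ` orbit I r \<phi>"
    using r v DERIV_imp_deriv[OF mD(4)] by (auto simp: phase_point_def orbit_def image_image)
  then show "phase_point r \<phi> ` I = circle r0 \<times> {(0, K / (f r0)\<^sup>2)}" by (auto simp: orb)
qed

lemma circular_orbit_iff: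
  assumes "smooth_on E V"
  shows "circular_orbit a b f V r0 K \<longleftrightarrow> r0 \<in> E \<and> K \<noteq> 0 \<and> deriv (effective_potential f V K) r0 = 0"
proof
  assume "circular_orbit a b f V r0 K"
  then obtain I r \<phi> where "circular_trajectory a b f V r0 K I r \<phi>" by (auto simp: circular_orbit_def)
  from circular_trajectoryD[OF assms this]
  show "r0 \<in> E \<and> K \<noteq> 0 \<and> deriv (effective_potential f V K) r0 = 0" by blast
next
  assume "r0 \<in> E \<and> K \<noteq> 0 \<and> deriv (effective_potential f V K) r0 = 0"
  then have "circular_trajectory a b f V r0 K UNIV (\<lambda>_. r0) (\<lambda>t. K / (f r0)\<^sup>2 * t)"
    by (intro circular_motion assms) auto
  then show "circular_orbit a b f V r0 K" unfolding circular_orbit_def by blast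
qed

text \<open>Nondegeneracy only says that the second derivative is not 0. A negative one would make
  \<open>U\<close> decrease to the right of \<open>x\<close>, against minimality; conversely the
  Morse normal form exhibits the minimum.\<close>

lemma nondegenerate_local_min_iff:
  fixes U :: "real \<Rightarrow> real"
  assumes S: "open S" "x \<in> S" and U: "smooth_on S U"
  shows "nondegenerate_local_min U x \<longleftrightarrow> deriv U x = 0 \<and> deriv (deriv U) x > 0"
proof
  note dU = smooth_on_DERIV[OF U] and ddU = smooth_on_DERIV[OF smooth_on_deriv[OF U]]
  obtain e where e: "e > 0" "ball x e \<subseteq> S" using S open_contains_ball by blast
  {
    assume n: "nondegenerate_local_min U x"
    then obtain d where d: "d > 0" "\<And>y. dist y x < d \<Longrightarrow> U x \<le> U y"
      by (auto simp: nondegenerate_local_min_def eventually_nhds_metric)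
    have 0: "deriv U x = 0"
      by (rule DERIV_local_min[OF dU[OF S(2)] d(1)]) (use d(2) in \<open>auto simp: dist_real_def abs_minus_commute\<close>)
    have "\<not> deriv (deriv U) x < 0"
    proof
      assume neg: "deriv (deriv U) x < 0"
      obtain d' where d': "d' > 0" "\<And>h. 0 < h \<Longrightarrow> h < d' \<Longrightarrow> deriv U (x + h) < deriv U x"
        using DERIV_neg_dec_right[OF ddU[OF S(2)] neg] by blast
      define h where "h = min (min d d') e / 2"
      have h: "0 < h" "h < d" "h < d'" "h < e" using d(1) d'(1) e(1) by (auto simp: h_def)
      have "U (x + h) < U x"
      proof (rule DERIV_neg_imp_decreasing_open[of x "x + h"])
        fix z assume z: "x < z" "z < x + h"
        have "z \<in> S" using e(2) z h by (auto simp: subset_iff dist_real_def)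
        moreover have "deriv U z < 0" using d'(2)[of "z - x"] z h 0 by auto
        ultimately show "\<exists>y. (U has_real_derivative y) (at z) \<and> y < 0" using dU by blast
      next
        show "continuous_on {x..x + h} U"
          by (rule continuous_on_subset[OF smooth_on_continuous_on[OF U]])
            (use e(2) h in \<open>auto simp: subset_iff dist_real_def\<close>)
      qed (use h in auto)
      moreover have "U x \<le> U (x + h)" using d(2)[of "x + h"] h by (simp add: dist_real_def)
      ultimately show False by simp
    qed
    then show "deriv U x = 0 \<and> deriv (deriv U) x > 0"
      using 0 n by (simp add: nondegenerate_local_min_def)
  }
  assume *: "deriv U x = 0 \<and> deriv (deriv U) x > 0"
  show "nondegenerate_local_min U x"
  proof (rule morse_normal_form[of "ball x e" x U 1])
    fix N s assume N: "open N" "x \<in> N" "\<And>y. y \<in> N \<Longrightarrow> (s y)\<^sup>2 = 2 * (U y - U x)"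
    have "U x \<le> U y" if "y \<in> N" for y using N(3)[OF that] zero_le_power2[of "s y"] by simp
    then show "nondegenerate_local_min U x"
      using * N(1,2) by (auto simp: nondegenerate_local_min_def eventually_nhds)
  qed (use * e smooth_on_subset[OF U e(2)] in auto)
qed

lemma strongly_stable_iff:
  assumes V: "smooth_on E V"
  shows "strongly_stable a b f V r0 K \<longleftrightarrow> r0 \<in> E \<and> K \<noteq> 0 \<and>
    deriv (effective_potential f V K) r0 = 0 \<and> deriv (deriv (effective_potential f V K)) r0 > 0"
  using circular_orbit_iff[OF V, of r0 K]
    nondegenerate_local_min_iff[OF open_einterval _ smooth_effective_potential[OF V], of r0 K]
  unfolding strongly_stable_def by blast

end

section \<open>Oscillations near a strongly stable circular orbit\<close>

text \<open>In the coordinate \<open>s\<close>, for which the effective potential is \<open>s\<^sup>2 / 2\<close> up to a constant, the energy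
  integral is a circle \<open>s = \<rho> sin \<alpha>\<close>, \<open>r' = \<rho> cos \<alpha>\<close>, and \<open>\<alpha>\<close> solves an autonomous equation.\<close>

locale well = surface +
  fixes V :: "real \<Rightarrow> real" and K r0 :: real and N :: "real set" and s :: "real \<Rightarrow> real" and l :: real
  assumes V: "smooth_on (einterval a b) V"
    and N: "open N" "convex N" "N \<subseteq> einterval a b" "r0 \<in> N"
    and s: "smooth_on N s" "s r0 = 0" "\<And>x. x \<in> N \<Longrightarrow> deriv s x > 0"
      "\<And>x. x \<in> N \<Longrightarrow> (s x)\<^sup>2 = 2 * (effective_potential f V K x - effective_potential f V K r0)"
    and l: "l > 0" "\<And>y. \<bar>y\<bar> < l \<Longrightarrow> y \<in> s ` N"

lemma (in surface) strongly_stable_well: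
  assumes V: "smooth_on E V" and "strongly_stable a b f V r0 K" and e: "e > 0"
  obtains N s l where "well a b f \<xi> \<sigma> V K r0 N s l" "N \<subseteq> ball r0 e"
proof -
  have r0: "r0 \<in> E" and U: "deriv (effective_potential f V K) r0 = 0"
    "deriv (deriv (effective_potential f V K)) r0 > 0"
    using assms(2) by (auto simp: strongly_stable_iff[OF V])
  show ?thesis
  proof (rule morse_normal_form[OF open_einterval E_convex r0 smooth_effective_potential[OF V] U e])
    fix N s assume N: "open N" "convex N" "N \<subseteq> E" "N \<subseteq> ball r0 e" "r0 \<in> N" "smooth_on N s" "s r0 = 0"
      "\<And>x. x \<in> N \<Longrightarrow> deriv s x > 0"
      "\<And>x. x \<in> N \<Longrightarrow> (s x)\<^sup>2 = 2 * (effective_potential f V K x - effective_potential f V K r0)"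
    have "open (s ` N)"
      by (rule interval_inverse(1)[OF N(1,2) smooth_on_DERIV[OF N(6)] N(8)])
    moreover have "0 \<in> s ` N" using N(5,7) by force
    ultimately obtain l where l: "l > 0" "ball 0 l \<subseteq> s ` N" using open_contains_ball by blast
    have "well a b f \<xi> \<sigma> V K r0 N s l"
      by unfold_locales (use V N l in \<open>auto simp: subset_iff\<close>)
    then show thesis using that N(4) by blast
  qed
qed

context well
begin

abbreviation "U \<equiv> effective_potential f V K"

definition X :: "real \<Rightarrow> real" where "X = inv_into N s"

text \<open>Rate of the angle \<phi> with respect to the phase \<alpha>: the quotient of
  \<open>\<phi>' = K / (f r)\<^sup>2\<close> by \<open>\<alpha>' = deriv s r\<close>.\<close>

definition m :: "real \<Rightarrow> real" where "m x = K / ((f x)\<^sup>2 * deriv s x)"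

text \<open>The angular period: the angle gained during one full radial oscillation of amplitude
  \<rho>.\<close>

definition advance :: "real \<Rightarrow> real" where
  "advance \<rho> = integral {0..2 * pi} (\<lambda>\<alpha>. m (X (\<rho> * sin \<alpha>)))"

lemmas s_DERIV = smooth_on_DERIV[OF s(1)]

lemma
  shows s_mono: "x \<in> N \<Longrightarrow> y \<in> N \<Longrightarrow> x < y \<Longrightarrow> s x < s y"
    and X_s: "x \<in> N \<Longrightarrow> X (s x) = x"
    and X_N: "\<bar>z\<bar> < l \<Longrightarrow> X z \<in> N"
    and s_X: "\<bar>z\<bar> < l \<Longrightarrow> s (X z) = z"
    and X_DERIV: "\<bar>z\<bar> < l \<Longrightarrow> (X has_real_derivative inverse (deriv s (X z))) (at z)"
  using interval_inverse[OF N(1,2) s_DERIV s(3)] l(2) unfolding X_def by simp_all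

lemma N_E: "x \<in> N \<Longrightarrow> x \<in> E" using N(3) by blast

lemma X_E: "\<bar>y\<bar> < l \<Longrightarrow> X y \<in> E" by (rule N_E[OF X_N])

lemma X_0: "X 0 = r0" using X_s[OF N(4)] s(2) by simp

lemma X_mono: "\<bar>y\<bar> < l \<Longrightarrow> \<bar>z\<bar> < l \<Longrightarrow> y \<le> z \<Longrightarrow> X y \<le> X z"
  using s_mono[OF X_N X_N, of z y] s_X[of y] s_X[of z] by force

lemma deriv_U: "x \<in> N \<Longrightarrow> deriv U x = s x * deriv s x"
proof -
  assume x: "x \<in> N"
  have "((\<lambda>x. 2 * (U x - U r0)) has_real_derivative 2 * (deriv U x)) (at x)"
    by (auto intro!: derivative_eq_intros smooth_on_DERIV[OF smooth_effective_potential[OF V] N_E[OF x]])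
  then have "((\<lambda>x. (s x)\<^sup>2) has_real_derivative 2 * (deriv U x)) (at x)"
    by (rule has_field_derivative_transform_within_open[OF _ N(1) x]) (simp add: s(4))
  moreover have "((\<lambda>x. (s x)\<^sup>2) has_real_derivative 2 * (s x * deriv s x)) (at x)"
    by (auto intro!: derivative_eq_intros s_DERIV x)
  ultimately show "deriv U x = s x * deriv s x" using DERIV_unique by fastforce
qed

lemma small: "\<bar>\<rho>\<bar> < l \<Longrightarrow> \<bar>\<rho> * sin \<alpha>\<bar> < l" for \<rho> \<alpha> :: real
proof -
  have "\<bar>\<rho> * sin \<alpha>\<bar> \<le> \<bar>\<rho>\<bar> * 1"
    using mult_left_mono[OF abs_sin_le_one[of \<alpha>], of "\<bar>\<rho>\<bar>"] by (simp add: abs_mult)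
  then show "\<bar>\<rho>\<bar> < l \<Longrightarrow> \<bar>\<rho> * sin \<alpha>\<bar> < l" by linarith
qed

lemma small_le: "- \<bar>\<rho>\<bar> \<le> \<rho> * sin \<alpha>" "\<rho> * sin \<alpha> \<le> \<bar>\<rho>\<bar>" for \<rho> \<alpha> :: real
proof -
  have "\<bar>\<rho> * sin \<alpha>\<bar> \<le> \<bar>\<rho>\<bar> * 1"
    using mult_left_mono[OF abs_sin_le_one[of \<alpha>], of "\<bar>\<rho>\<bar>"] by (simp add: abs_mult)
  then show "- \<bar>\<rho>\<bar> \<le> \<rho> * sin \<alpha>" "\<rho> * sin \<alpha> \<le> \<bar>\<rho>\<bar>" by linarith+
qed

lemma isCont_comp_X:
  assumes "smooth_on N g" "\<bar>y\<bar> < l"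
  shows "isCont (\<lambda>y. g (X y)) y"
  by (rule isCont_o2[OF DERIV_isCont[OF X_DERIV[OF assms(2)]] smooth_on_isCont[OF assms(1) X_N[OF assms(2)]]])

lemma isCont_comp_X_sin:
  assumes "smooth_on N g" "\<bar>\<rho>\<bar> < l"
  shows "isCont (\<lambda>\<alpha>. g (X (\<rho> * sin \<alpha>))) \<alpha>"
proof -
  have "isCont (\<lambda>\<alpha>. \<rho> * sin \<alpha>) \<alpha>" by (intro continuous_intros)
  then show ?thesis by (rule isCont_o2) (rule isCont_comp_X[OF assms(1) small[OF assms(2)]])
qed

lemma smooth_f_N: "smooth_on N f"
  by (rule smooth_on_subset[OF smooth_f N(3)])

lemma smooth_m: "smooth_on N m"
  unfolding m_def
proof (intro smooth_on_divide smooth_on_const smooth_on_mult smooth_on_power smooth_f_N smooth_on_deriv s(1) N(1))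
  fix x assume "x \<in> N"
  then show "(f x)\<^sup>2 * deriv s x \<noteq> 0" using s(3)[of x] f_pos[OF N_E, of x] by auto
qed

text \<open>Because \<open>deriv U = s * deriv s\<close>, the ansatz
  \<open>s = \<rho> * sin \<alpha>\<close>, \<open>r' = \<rho> * cos \<alpha>\<close> turns both
  radial equations into \<open>\<alpha>' = deriv s\<close>. The rate lies between positive constants
  on the compact range of \<open>s\<close>, so the phase runs for all times. Initial phase and angle
  are free, so that any nearby initial state can be matched.\<close>

lemma oscillation:
  assumes \<rho>: "\<bar>\<rho>\<bar> < l"
  obtains \<alpha> \<phi> where "\<alpha> t0 = \<alpha>0" "\<phi> t0 = \<phi>0"
    "\<And>t. (\<alpha> has_real_derivative deriv s (X (\<rho> * sin (\<alpha> t)))) (at t)"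
    "motion V K UNIV (\<lambda>t. X (\<rho> * sin (\<alpha> t))) (\<lambda>t. \<rho> * cos (\<alpha> t)) \<phi>"
proof -
  define q where "q y = deriv s (X y)" for y
  have q_cont: "continuous_on {- \<bar>\<rho>\<bar>..\<bar>\<rho>\<bar>} q"
    unfolding q_def
    by (intro continuous_at_imp_continuous_on ballI isCont_comp_X smooth_on_deriv s(1)) (use \<rho> in auto)
  obtain y0 where y0: "y0 \<in> {- \<bar>\<rho>\<bar>..\<bar>\<rho>\<bar>}" "\<And>y. y \<in> {- \<bar>\<rho>\<bar>..\<bar>\<rho>\<bar>} \<Longrightarrow> q y0 \<le> q y"
    using continuous_attains_inf[OF compact_Icc _ q_cont] by auto
  obtain y1 where y1: "\<forall>y\<in>{- \<bar>\<rho>\<bar>..\<bar>\<rho>\<bar>}. q y \<le> q y1"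
    using continuous_attains_sup[OF compact_Icc _ q_cont] by auto
  have pos: "q y0 > 0" unfolding q_def by (rule s(3)[OF X_N]) (use y0(1) \<rho> in auto)
  obtain \<alpha> where \<alpha>: "\<alpha> t0 = \<alpha>0" "\<And>t. (\<alpha> has_real_derivative q (\<rho> * sin (\<alpha> t))) (at t)"
  proof (rule autonomous_flow[of "\<lambda>\<alpha>. q (\<rho> * sin \<alpha>)" "q y0" "q y1" t0 \<alpha>0])
    show "isCont (\<lambda>\<alpha>. q (\<rho> * sin \<alpha>)) x" for x
      unfolding q_def by (rule isCont_comp_X_sin[OF smooth_on_deriv[OF s(1)] \<rho>])
    have "\<rho> * sin x \<in> {- \<bar>\<rho>\<bar>..\<bar>\<rho>\<bar>}" for x using small_le[of \<rho> x] by simp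
    then show "q y0 \<le> q (\<rho> * sin x)" "q (\<rho> * sin x) \<le> q y1" for x using y0(2) y1 by blast+
  qed (use pos in auto)
  have r: "((\<lambda>t. X (\<rho> * sin (\<alpha> t))) has_real_derivative \<rho> * cos (\<alpha> t)) (at t)" for t
  proof -
    have "((\<lambda>t. X (\<rho> * sin (\<alpha> t))) has_real_derivative
        inverse (q (\<rho> * sin (\<alpha> t))) * (\<rho> * (cos (\<alpha> t) * q (\<rho> * sin (\<alpha> t))))) (at t)"
      unfolding q_def
      by (rule DERIV_chain2[where f = X and g = "\<lambda>t. \<rho> * sin (\<alpha> t)"], rule X_DERIV[OF small[OF \<rho>]])
        (auto intro!: derivative_eq_intros \<alpha>(2)[unfolded q_def])
    moreover have "q (\<rho> * sin (\<alpha> t)) \<noteq> 0"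
      using s(3)[OF X_N[OF small[OF \<rho>]], of "\<alpha> t"] by (simp add: q_def)
    ultimately show ?thesis by (simp add: field_simps)
  qed
  have v: "((\<lambda>t. \<rho> * cos (\<alpha> t)) has_real_derivative - deriv U (X (\<rho> * sin (\<alpha> t)))) (at t)" for t
    using deriv_U[OF X_N[OF small[OF \<rho>]], of "\<alpha> t"] s_X[OF small[OF \<rho>], of "\<alpha> t"]
    by (auto intro!: derivative_eq_intros \<alpha>(2) simp: q_def)
  have "isCont (\<lambda>t. K / (f (X (\<rho> * sin (\<alpha> t))))\<^sup>2) t" for t
  proof -
    have "isCont (\<lambda>t. f (X (\<rho> * sin (\<alpha> t)))) t"
      by (rule isCont_o2[where g = f, OF DERIV_isCont[OF r]])
        (rule smooth_on_isCont[OF smooth_f X_E[OF small[OF \<rho>]]])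
    then show ?thesis
      using f_pos[OF X_E[OF small[OF \<rho>]], of "\<alpha> t"] by (intro continuous_intros) auto
  qed
  then obtain \<phi> where \<phi>: "\<And>t. (\<phi> has_real_derivative K / (f (X (\<rho> * sin (\<alpha> t))))\<^sup>2) (at t)"
    using antiderivative_exists_UNIV[of "\<lambda>t. K / (f (X (\<rho> * sin (\<alpha> t))))\<^sup>2"] by blast
  have "motion V K UNIV (\<lambda>t. X (\<rho> * sin (\<alpha> t))) (\<lambda>t. \<rho> * cos (\<alpha> t)) (\<lambda>t. \<phi> t + (\<phi>0 - \<phi> t0))"
    unfolding motion_def using X_E[OF small[OF \<rho>]] r v \<phi>
    by (auto intro!: derivative_eq_intros)
  then show ?thesis using that[of \<alpha> "\<lambda>t. \<phi> t + (\<phi>0 - \<phi> t0)"] \<alpha> by (simp add: q_def)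
qed

lemma oscillation_bounded:
  assumes \<rho>: "\<bar>\<rho>\<bar> < l" and K: "K \<noteq> 0"
    and m: "motion V K UNIV (\<lambda>t. X (\<rho> * sin (\<alpha> t))) (\<lambda>t. \<rho> * cos (\<alpha> t)) \<phi>"
  shows "nonsingular_bounded a b f V UNIV (\<lambda>t. X (\<rho> * sin (\<alpha> t))) \<phi> K"
proof -
  have "{X (- \<bar>\<rho>\<bar>)..X \<bar>\<rho>\<bar>} \<subseteq> E"
  proof
    fix x assume "x \<in> {X (- \<bar>\<rho>\<bar>)..X \<bar>\<rho>\<bar>}"
    then show "x \<in> E" by (intro E_between[OF X_E X_E, of "- \<bar>\<rho>\<bar>" "\<bar>\<rho>\<bar>"]) (use \<rho> in auto)
  qed
  moreover have "X (\<rho> * sin (\<alpha> t)) \<in> {X (- \<bar>\<rho>\<bar>)..X \<bar>\<rho>\<bar>}" for t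
    using small_le[of \<rho> "\<alpha> t"] small[OF \<rho>] \<rho> by (auto intro!: X_mono)
  ultimately show ?thesis
    unfolding nonsingular_bounded_def bounded_trajectory_def
    using K motion_UNIV_imp_trajectory(1,2)[OF V m] by blast
qed

lemma oscillation_angle:
  assumes \<rho>: "\<bar>\<rho>\<bar> < l" and Q: "\<And>x. (Q has_real_derivative m (X (\<rho> * sin x))) (at x)"
    and \<alpha>: "\<And>t. (\<alpha> has_real_derivative deriv s (X (\<rho> * sin (\<alpha> t)))) (at t)"
    and mo: "motion V K UNIV (\<lambda>t. X (\<rho> * sin (\<alpha> t))) (\<lambda>t. \<rho> * cos (\<alpha> t)) \<phi>"
  shows "\<phi> t - \<phi> t' = Q (\<alpha> t) - Q (\<alpha> t')"
proof -
  have "((\<lambda>t. \<phi> t - Q (\<alpha> t)) has_real_derivative 0) (at t)" for t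
  proof -
    have "((\<lambda>t. \<phi> t - Q (\<alpha> t)) has_real_derivative K / (f (X (\<rho> * sin (\<alpha> t))))\<^sup>2
        - m (X (\<rho> * sin (\<alpha> t))) * deriv s (X (\<rho> * sin (\<alpha> t)))) (at t)"
      using motionD(4)[OF mo UNIV_I] by (intro DERIV_diff DERIV_chain2[OF Q \<alpha>])
    moreover have "deriv s (X (\<rho> * sin (\<alpha> t))) \<noteq> 0"
      using s(3)[OF X_N[OF small[OF \<rho>]], of "\<alpha> t"] by simp
    ultimately show ?thesis by (simp add: m_def)
  qed
  then have "\<phi> t - Q (\<alpha> t) = \<phi> t' - Q (\<alpha> t')"
    by (intro DERIV_0_const_interval[of UNIV "\<lambda>t. \<phi> t - Q (\<alpha> t)"]) auto
  then show ?thesis by simp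
qed

text \<open>A period \<open>T\<close> restores radius and radial velocity, so the increasing phase
  has gained \<open>2 * pi * k\<close> with \<open>k > 0\<close>. The angle has then gained
  \<open>k\<close> times the advance, and by closedness also an integer multiple of
  \<open>2 * pi\<close>.\<close>

lemma closed_imp_advance_rational:
  assumes \<rho>: "\<bar>\<rho>\<bar> < l" "\<rho> \<noteq> 0" and \<alpha>0: "\<alpha> 0 = 0"
    and \<alpha>: "\<And>t. (\<alpha> has_real_derivative deriv s (X (\<rho> * sin (\<alpha> t)))) (at t)"
    and mo: "motion V K UNIV (\<lambda>t. X (\<rho> * sin (\<alpha> t))) (\<lambda>t. \<rho> * cos (\<alpha> t)) \<phi>"
    and closed: "closed_orbit UNIV (\<lambda>t. X (\<rho> * sin (\<alpha> t))) \<phi>"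
  shows "advance \<rho> / (2 * pi) \<in> \<rat>"
proof -
  obtain T where T: "T > 0" "\<And>t. X (\<rho> * sin (\<alpha> (t + T))) = X (\<rho> * sin (\<alpha> t))"
    "cis (\<phi> (0 + T)) = cis (\<phi> 0)"
    using closed unfolding closed_orbit_def by blast
  have "sin (\<alpha> (0 + T)) = sin (\<alpha> 0)"
    using arg_cong[OF T(2)[of 0], of s] s_X[OF small[OF \<rho>(1)]] \<rho>(2) by simp
  \<comment> \<open>Equality of the radii only fixes the sine of the phase; the cosine comes from
    differentiating the periodicity of the radius at time 0.\<close>
  moreover have "cos (\<alpha> (0 + T)) = cos (\<alpha> 0)"
  proof -
    have "((\<lambda>t. X (\<rho> * sin (\<alpha> (t + T)))) has_real_derivative \<rho> * cos (\<alpha> (0 + T))) (at 0)"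
      using motionD(2)[OF mo UNIV_I, of "0 + T"] by (subst (asm) DERIV_shift)
    then have "((\<lambda>t. X (\<rho> * sin (\<alpha> t))) has_real_derivative \<rho> * cos (\<alpha> (0 + T))) (at 0)"
      by (simp add: T(2))
    then show ?thesis
      using DERIV_unique[OF motionD(2)[OF mo UNIV_I, of 0]] \<rho>(2) by fastforce
  qed
  ultimately have "sin (\<alpha> T) = 0" "cos (\<alpha> T) = 1" by (simp_all add: \<alpha>0)
  then obtain k :: int where k: "\<alpha> T = of_int k * 2 * pi" using cos_one_2pi_int by auto
  have "\<alpha> 0 < \<alpha> T"
  proof (rule DERIV_pos_imp_increasing[OF T(1)])
    show "\<exists>y. (\<alpha> has_real_derivative y) (at x) \<and> 0 < y" for x
      using \<alpha>[of x] s(3)[OF X_N[OF small[OF \<rho>(1)]]] by blast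
  qed
  then have kpos: "k > 0" by (simp add: \<alpha>0 k zero_less_mult_iff)
  obtain Q where Q: "\<And>x. (Q has_real_derivative m (X (\<rho> * sin x))) (at x)"
    using antiderivative_exists_UNIV[of "\<lambda>x. m (X (\<rho> * sin x))"] isCont_comp_X_sin[OF smooth_m \<rho>(1)] by blast
  define \<Delta> where "\<Delta> = Q (2 * pi) - Q 0"
  have adv: "advance \<rho> = \<Delta>"
    unfolding advance_def \<Delta>_def
    by (rule integral_unique, rule fundamental_theorem_of_calculus)
      (use Q in \<open>auto simp: has_real_derivative_iff_has_vector_derivative[symmetric] has_field_derivative_at_within\<close>)
  have per: "Q (x + 2 * pi) - Q x = \<Delta>" for x
  proof -
    have "((\<lambda>x. Q (x + 2 * pi) - Q x) has_real_derivative 0) (at x)" for x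
    proof -
      have "((\<lambda>x. Q (x + 2 * pi)) has_real_derivative m (X (\<rho> * sin (x + 2 * pi)))) (at x)"
        using Q[of "x + 2 * pi"] by (subst (asm) DERIV_shift)
      then show ?thesis using DERIV_diff[OF _ Q[of x]] by fastforce
    qed
    then show ?thesis
      using DERIV_0_const_interval[of UNIV "\<lambda>x. Q (x + 2 * pi) - Q x" x 0] by (simp add: \<Delta>_def)
  qed
  have mult: "Q (real n * (2 * pi)) - Q 0 = real n * \<Delta>" for n
  proof (induction n)
    case (Suc n)
    have "real (Suc n) * (2 * pi) = real n * (2 * pi) + 2 * pi" by (simp add: algebra_simps)
    then show ?case using Suc per[of "real n * (2 * pi)"] by (simp only: of_nat_Suc) (simp add: algebra_simps)
  qed simp
  have "\<phi> T - \<phi> 0 = real_of_int k * \<Delta>"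
    using oscillation_angle[OF \<rho>(1) Q \<alpha> mo, of T 0] mult[of "nat k"] kpos by (simp add: k \<alpha>0 mult.assoc)
  moreover obtain j :: int where "\<phi> T - \<phi> 0 = of_int j * 2 * pi"
  proof -
    have "cis (\<phi> T - \<phi> 0) = 1" using T(3) by (simp flip: cis_divide)
    then have "cos (\<phi> T - \<phi> 0) = 1" by (simp add: complex_eq_iff)
    then show ?thesis using that cos_one_2pi_int by auto
  qed
  ultimately have "advance \<rho> / (2 * pi) = of_int j / of_int k"
    using kpos by (simp add: adv field_simps)
  then show ?thesis by simp
qed

lemma continuous_on_advance: "continuous_on {- l<..<l} advance"
proof -
  have cm: "continuous_on {- l<..<l} (\<lambda>y. m (X y))"
    by (intro continuous_at_imp_continuous_on ballI isCont_comp_X[OF smooth_m]) auto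
  have "continuous_on {- l<..<l} (\<lambda>\<rho>. integral (cbox 0 (2 * pi)) (\<lambda>\<alpha>. m (X (\<rho> * sin \<alpha>))))"
  proof (rule integral_continuous_on_param)
    have "- l < \<rho> * sin \<alpha> \<and> \<rho> * sin \<alpha> < l" if "- l < \<rho>" "\<rho> < l" for \<rho> \<alpha>
      using small[of \<rho> \<alpha>] that by (simp add: abs_less_iff)
    then show "continuous_on ({- l<..<l} \<times> cbox 0 (2 * pi)) (\<lambda>(\<rho>, \<alpha>). m (X (\<rho> * sin \<alpha>)))"
      unfolding case_prod_unfold
      by (intro continuous_on_compose2[OF cm]) (auto intro!: continuous_intros)
  qed
  then show ?thesis by (simp add: advance_def[abs_def])
qed

lemma advance_0: "advance 0 = 2 * pi * m r0"
  by (simp add: advance_def X_0)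

text \<open>For amplitudes different from 0 the advance is a rational multiple of
  \<open>2 * pi\<close>; the amplitude 0 adds at most one value, so the range stays countable and
  continuity makes the advance constant. Comparison with the amplitude \<delta> / 2 then shows that
  \<open>m r0\<close>, the limit at the circle itself, is rational too.\<close>

lemma closed_near_imp_isochronous:
  assumes K: "K \<noteq> 0" and closed: "closed_near a b f V r0 K"
  obtains \<delta> where "0 < \<delta>" "\<delta> \<le> l" "\<And>\<rho>. \<bar>\<rho>\<bar> < \<delta> \<Longrightarrow> advance \<rho> = 2 * pi * m r0" "m r0 \<in> \<rat>"
proof -
  obtain e where e: "e > 0" and cl: "\<And>I r \<phi> K'. nonsingular_bounded a b f V I r \<phi> K' \<Longrightarrow>
      orbit I r \<phi> \<subseteq> {r0 - e..r0 + e} \<times> sphere 0 1 \<Longrightarrow> K' \<in> {K - e<..<K + e} \<Longrightarrow> closed_orbit I r \<phi>"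
    using closed unfolding closed_near_def by blast
  have "isCont X 0" by (rule DERIV_isCont[OF X_DERIV]) (use l in simp)
  then obtain d where d: "d > 0" "\<And>y. \<bar>y\<bar> < d \<Longrightarrow> \<bar>X y - r0\<bar> < e"
    using e by (auto simp: continuous_at_eps_delta dist_real_def X_0)
  define \<delta> where "\<delta> = min d l"
  have \<delta>: "0 < \<delta>" "\<delta> \<le> l" "\<delta> \<le> d" using d(1) l(1) by (auto simp: \<delta>_def)
  have rat: "advance \<rho> / (2 * pi) \<in> \<rat>" if \<rho>: "\<bar>\<rho>\<bar> < \<delta>" "\<rho> \<noteq> 0" for \<rho>
  proof -
    have \<rho>l: "\<bar>\<rho>\<bar> < l" using \<rho> \<delta> by simp
    show ?thesis
    proof (rule oscillation[OF \<rho>l, of 0 0 0])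
      fix \<alpha> \<phi> assume *: "\<alpha> 0 = 0" "\<And>t. (\<alpha> has_real_derivative deriv s (X (\<rho> * sin (\<alpha> t)))) (at t)"
        "motion V K UNIV (\<lambda>t. X (\<rho> * sin (\<alpha> t))) (\<lambda>t. \<rho> * cos (\<alpha> t)) \<phi>"
      have "orbit UNIV (\<lambda>t. X (\<rho> * sin (\<alpha> t))) \<phi> \<subseteq> {r0 - e..r0 + e} \<times> sphere 0 1"
      proof -
        have "r0 - e \<le> X (\<rho> * sin (\<alpha> t)) \<and> X (\<rho> * sin (\<alpha> t)) \<le> r0 + e" for t
          using d(2)[of "\<rho> * sin (\<alpha> t)"] small_le[of \<rho> "\<alpha> t"] \<rho> \<delta> by (simp add: abs_le_iff abs_less_iff)
        then show ?thesis by (auto simp: orbit_def)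
      qed
      then have "closed_orbit UNIV (\<lambda>t. X (\<rho> * sin (\<alpha> t))) \<phi>"
        using cl[OF oscillation_bounded[OF \<rho>l K *(3)]] e by simp
      then show ?thesis by (rule closed_imp_advance_rational[where \<alpha> = \<alpha>, OF \<rho>l \<rho>(2) *])
    qed
  qed
  have const: "advance \<rho> = advance 0" if \<rho>: "\<bar>\<rho>\<bar> < \<delta>" for \<rho>
  proof (rule constant_of_countable_range[of "{- \<delta><..<\<delta>}" advance])
    show "continuous_on {- \<delta><..<\<delta>} advance"
      by (rule continuous_on_subset[OF continuous_on_advance]) (use \<delta> in auto)
    have "advance ` {- \<delta><..<\<delta>} \<subseteq> insert (advance 0) ((\<lambda>q. 2 * pi * q) ` \<rat>)"
    proof (intro image_subsetI)
      fix \<rho> assume "\<rho> \<in> {- \<delta><..<\<delta>}"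
      then have "advance \<rho> = 2 * pi * (advance \<rho> / (2 * pi)) \<and> advance \<rho> / (2 * pi) \<in> \<rat>" if "\<rho> \<noteq> 0"
        using rat[of \<rho>] that by (simp add: abs_less_iff)
      then show "advance \<rho> \<in> insert (advance 0) ((\<lambda>q. 2 * pi * q) ` \<rat>)" by (cases "\<rho> = 0") blast+
    qed
    then show "countable (advance ` {- \<delta><..<\<delta>})"
      by (rule countable_subset) (simp add: countable_rat)
  qed (use \<rho> \<delta> in auto)
  have "m r0 = advance (\<delta> / 2) / (2 * pi)"
    using const[of "\<delta> / 2"] \<delta> by (simp add: advance_0)
  then have "m r0 \<in> \<rat>" using rat[of "\<delta> / 2"] \<delta> by simp
  then show ?thesis using that[of \<delta>] \<delta> const by (simp add: advance_0)
qed

end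

section \<open>The derivation with respect to the coordinate \<open>w = |\<theta>|\<close>\<close>

context surface
begin

text \<open>The factor is \<open>dr/dw\<close>, the reciprocal of
  \<open>\<sigma> * \<xi>\<^sup>2 / (f r)\<^sup>2\<close>, where \<sigma> is its own inverse.
  Functions stay functions of \<open>r\<close>, so no change of variables is carried out.\<close>

definition D :: "(real \<Rightarrow> real) \<Rightarrow> real \<Rightarrow> real" where
  "D g r = \<sigma> * (f r)\<^sup>2 / \<xi>\<^sup>2 * deriv g r"

lemma smooth_D:
  assumes "open S" "S \<subseteq> E" "smooth_on S g"
  shows "smooth_on S (D g)"
  unfolding D_def using \<xi>_pos
  by (intro smooth_on_mult smooth_on_divide smooth_on_const smooth_on_power smooth_on_deriv assms
      smooth_on_subset[OF smooth_f]) auto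

lemma smooth_D_E: "smooth_on E g \<Longrightarrow> smooth_on E (D g)"
  by (rule smooth_D) auto

lemma D_eqI: "(g has_real_derivative d) (at r) \<Longrightarrow> D g r = \<sigma> * (f r)\<^sup>2 / \<xi>\<^sup>2 * d"
  by (simp add: D_def DERIV_imp_deriv)

lemma \<sigma>_cancel:
  "r \<in> E \<Longrightarrow> \<sigma> * (f r)\<^sup>2 / \<xi>\<^sup>2 * (x * (\<sigma> * \<xi>\<^sup>2 / (f r)\<^sup>2)) = x"
  "r \<in> E \<Longrightarrow> \<sigma> * \<xi>\<^sup>2 / (f r)\<^sup>2 * (\<sigma> * (f r)\<^sup>2 / \<xi>\<^sup>2 * x) = x"
  using f_pos[of r] \<xi>_pos \<sigma> by auto

lemma deriv_D: "r \<in> E \<Longrightarrow> deriv g r = \<sigma> * \<xi>\<^sup>2 / (f r)\<^sup>2 * D g r"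
  unfolding D_def by (simp only: \<sigma>_cancel)

lemma D_DERIV: "r \<in> E \<Longrightarrow> smooth_on S g \<Longrightarrow> r \<in> S \<Longrightarrow>
    (g has_real_derivative \<sigma> * \<xi>\<^sup>2 / (f r)\<^sup>2 * D g r) (at r)"
  using smooth_on_DERIV deriv_D by metis

lemma D_cong:
  "open S \<Longrightarrow> r \<in> S \<Longrightarrow> (\<And>x. x \<in> S \<Longrightarrow> g x = h x) \<Longrightarrow> D g r = D h r"
  unfolding D_def using deriv_cong_open[of S r g h] by simp

lemma D_add:
  assumes "smooth_on S g" "smooth_on S h" "r \<in> S"
  shows "D (\<lambda>x. g x + h x) r = D g r + D h r"
  by (subst D_eqI, rule DERIV_add[OF smooth_on_DERIV smooth_on_DERIV])
    (use assms in \<open>auto simp: D_def algebra_simps add_divide_distrib\<close>)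

lemma D_mult:
  assumes "smooth_on S g" "smooth_on S h" "r \<in> S"
  shows "D (\<lambda>x. g x * h x) r = D g r * h r + g r * D h r"
  by (subst D_eqI, rule DERIV_mult[OF smooth_on_DERIV smooth_on_DERIV])
    (use assms in \<open>auto simp: D_def algebra_simps add_divide_distrib\<close>)

lemma D_const: "D (\<lambda>x. c) r = 0"
  by (simp add: D_def)

lemma D_cmult:
  assumes "smooth_on S g" "r \<in> S"
  shows "D (\<lambda>x. c * g x) r = c * D g r"
  by (subst D_eqI, rule DERIV_cmult[OF smooth_on_DERIV])
    (use assms in \<open>auto simp: D_def algebra_simps add_divide_distrib\<close>)

lemma D_w: "r \<in> E \<Longrightarrow> D w r = 1"
  using D_eqI[OF w_DERIV, of r] \<sigma>_cancel(1)[of r 1] by simp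

lemma D_0_const:
  assumes "smooth_on E g" "\<And>r. r \<in> E \<Longrightarrow> D g r = 0"
  obtains c where "\<And>r. r \<in> E \<Longrightarrow> g r = c"
proof -
  have "(g has_real_derivative 0) (at r)" if "r \<in> E" for r
    using D_DERIV[OF that assms(1) that] assms(2)[OF that] by simp
  then show ?thesis using DERIV_0_const_E[of g] that by blast
qed

text \<open>This is what recommends \<open>w\<close>: since
  \<open>\<xi>\<^sup>2 / (f r)\<^sup>2 = w\<^sup>2 + c\<close>, the centrifugal term is quadratic in
  \<open>w\<close>. It contributes a constant to the second derivative and nothing to the third and
  fourth.\<close>

lemma D_effective_potential:
  assumes V: "smooth_on E V" and r: "r \<in> E"
  shows "D (effective_potential f V K) r = D V r + K\<^sup>2 / \<xi>\<^sup>2 * w r"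
proof -
  have "\<sigma> * (f r)\<^sup>2 / \<xi>\<^sup>2 * (\<sigma> * K\<^sup>2 * w r / (f r)\<^sup>2) = K\<^sup>2 / \<xi>\<^sup>2 * w r"
    using f_pos[OF r] \<sigma> by auto
  then show ?thesis
    by (simp add: D_def deriv_effective_potential(2)[OF assms] distrib_left del: times_divide_eq_left times_divide_eq_right)
qed

lemma DD_effective_potential:
  assumes V: "smooth_on E V" and r: "r \<in> E"
  shows "D (D (effective_potential f V K)) r = D (D V) r + K\<^sup>2 / \<xi>\<^sup>2"
    "D (D (D (effective_potential f V K))) r = D (D (D V)) r"
    "D (D (D (D (effective_potential f V K)))) r = D (D (D (D V))) r"
proof -
  let ?U = "effective_potential f V K"
  note sV = smooth_D_E[OF V] smooth_D_E[OF smooth_D_E[OF V]]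
  have 1: "D (D ?U) r = D (D V) r + K\<^sup>2 / \<xi>\<^sup>2" if r: "r \<in> E" for r
  proof -
    have "D (D ?U) r = D (\<lambda>r. D V r + K\<^sup>2 / \<xi>\<^sup>2 * w r) r"
      by (rule D_cong[OF open_einterval r]) (rule D_effective_potential[OF V])
    also have "\<dots> = D (D V) r + D (\<lambda>r. K\<^sup>2 / \<xi>\<^sup>2 * w r) r"
      by (rule D_add[OF sV(1) _ r]) (intro smooth_on_mult smooth_on_const smooth_w open_einterval)
    finally show ?thesis using D_cmult[OF smooth_w r, of "K\<^sup>2 / \<xi>\<^sup>2"] D_w[OF r] by simp
  qed
  have 2: "D (D (D ?U)) r = D (D (D V)) r" if r: "r \<in> E" for r
  proof -
    have "D (D (D ?U)) r = D (\<lambda>r. D (D V) r + K\<^sup>2 / \<xi>\<^sup>2) r"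
      by (rule D_cong[OF open_einterval r]) (rule 1)
    also have "\<dots> = D (D (D V)) r + D (\<lambda>r. K\<^sup>2 / \<xi>\<^sup>2) r"
      by (rule D_add[OF sV(2) _ r]) (intro smooth_on_const open_einterval)
    finally show ?thesis by (simp add: D_const)
  qed
  show "D (D ?U) r = D (D V) r + K\<^sup>2 / \<xi>\<^sup>2" "D (D (D ?U)) r = D (D (D V)) r" by (fact 1[OF r] 2[OF r])+
  show "D (D (D (D ?U))) r = D (D (D (D V))) r"
    by (rule D_cong[OF open_einterval r]) (rule 2)
qed

text \<open>At a critical point the term with the derivative of the factor in \<open>D\<close>
  vanishes, so both second derivatives agree up to the positive factor
  \<open>((f r0)\<^sup>2 / \<xi>\<^sup>2)\<^sup>2\<close>.\<close>

lemma strongly_stable_iff_D: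
  assumes V: "smooth_on E V"
  shows "strongly_stable a b f V r0 K \<longleftrightarrow> r0 \<in> E \<and> K \<noteq> 0 \<and>
    D V r0 = - (K\<^sup>2 / \<xi>\<^sup>2 * w r0) \<and> D (D V) r0 + K\<^sup>2 / \<xi>\<^sup>2 > 0"
proof (cases "r0 \<in> E")
  case r0: True
  let ?U = "effective_potential f V K"
  note sU = smooth_effective_potential[OF V, of K]
  have 1: "deriv ?U r0 = 0 \<longleftrightarrow> D V r0 = - (K\<^sup>2 / \<xi>\<^sup>2 * w r0)"
    using D_effective_potential[OF V r0, of K] deriv_D[OF r0, of ?U] f_pos[OF r0] \<xi>_pos \<sigma>_sq(3) by auto
  have "D (D ?U) r0 = ((f r0)\<^sup>2 / \<xi>\<^sup>2)\<^sup>2 * deriv (deriv ?U) r0" if "deriv ?U r0 = 0"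
  proof -
    have s1: "smooth_on E (\<lambda>r. \<sigma> * (f r)\<^sup>2 / \<xi>\<^sup>2)"
      using \<xi>_pos by (intro smooth_on_divide smooth_on_mult smooth_on_const smooth_on_power smooth_f open_einterval) auto
    have "D (D ?U) r0 = D (\<lambda>r. \<sigma> * (f r)\<^sup>2 / \<xi>\<^sup>2 * deriv ?U r) r0"
      by (simp add: D_def[abs_def])
    also have "\<dots> = \<sigma> * (f r0)\<^sup>2 / \<xi>\<^sup>2 * D (deriv ?U) r0"
      using D_mult[OF s1 smooth_on_deriv[OF sU] r0] that by simp
    also have "\<dots> = (\<sigma> * \<sigma>) * ((f r0)\<^sup>2 / \<xi>\<^sup>2)\<^sup>2 * deriv (deriv ?U) r0"
      by (simp add: D_def power2_eq_square)
    finally show ?thesis by (simp add: \<sigma>_sq)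
  qed
  then have "deriv (deriv ?U) r0 > 0 \<longleftrightarrow> D (D V) r0 + K\<^sup>2 / \<xi>\<^sup>2 > 0" if "deriv ?U r0 = 0"
    using that f_pos[OF r0] \<xi>_pos DD_effective_potential(1)[OF V r0, of K] by (simp add: zero_less_mult_iff)
  then show ?thesis using 1 r0 by (auto simp: strongly_stable_iff[OF V])
qed (simp add: strongly_stable_iff[OF V])

end

context well
begin

lemmas smooth_D_N = smooth_D[OF N(1,3)]
lemmas Ds = smooth_D_N[OF s(1)]
lemmas DDs = smooth_D_N[OF Ds]
lemmas DDDs = smooth_D_N[OF DDs]
lemmas D_cong_N = D_cong[OF N(1)]

lemma D_s_nz: "x \<in> N \<Longrightarrow> D s x \<noteq> 0"
  using s(3)[of x] f_pos[OF N_E, of x] \<xi>_pos \<sigma>_sq(3) by (simp add: D_def)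

lemma m_D: "x \<in> N \<Longrightarrow> m x * D s x = K * \<sigma> / \<xi>\<^sup>2"
  using s(3)[of x] f_pos[OF N_E, of x] by (simp add: D_def m_def)

lemma D_U_s:
  assumes "x \<in> N"
  shows "D U x = s x * D s x"
    and "D (D U) x = (D s x)\<^sup>2 + s x * D (D s) x"
    and "D (D (D U)) x = 3 * D s x * D (D s) x + s x * D (D (D s)) x"
    and "D (D (D (D U))) x = 3 * (D (D s) x)\<^sup>2 + 4 * D s x * D (D (D s)) x + s x * D (D (D (D s))) x"
proof -
  have 1: "D U x = s x * D s x" if "x \<in> N" for x
    using deriv_U[OF that] by (simp add: D_def)
  have 2: "D (D U) x = (D s x)\<^sup>2 + s x * D (D s) x" if x: "x \<in> N" for x
  proof -
    have "D (D U) x = D (\<lambda>x. s x * D s x) x" by (rule D_cong_N[OF x 1])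
    then show ?thesis using D_mult[OF s(1) Ds x] by (simp add: power2_eq_square)
  qed
  have 3: "D (D (D U)) x = 3 * D s x * D (D s) x + s x * D (D (D s)) x" if x: "x \<in> N" for x
  proof -
    have "D (D (D U)) x = D (\<lambda>x. D s x * D s x + s x * D (D s) x) x"
      by (rule D_cong_N[OF x]) (simp add: 2 power2_eq_square)
    also have "\<dots> = D (\<lambda>x. D s x * D s x) x + D (\<lambda>x. s x * D (D s) x) x"
      by (rule D_add[OF _ _ x]) (intro smooth_on_mult N(1) Ds DDs s(1))+
    finally show ?thesis using D_mult[OF Ds Ds x] D_mult[OF s(1) DDs x] by simp
  qed
  have 4: "D (D (D (D U))) x = 3 * (D (D s) x)\<^sup>2 + 4 * D s x * D (D (D s)) x + s x * D (D (D (D s))) x"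
    if x: "x \<in> N" for x
  proof -
    have "D (D (D (D U))) x = D (\<lambda>x. 3 * (D s x * D (D s) x) + s x * D (D (D s)) x) x"
      by (rule D_cong_N[OF x]) (simp add: 3)
    also have "\<dots> = D (\<lambda>x. 3 * (D s x * D (D s) x)) x + D (\<lambda>x. s x * D (D (D s)) x) x"
      by (rule D_add[OF _ _ x]) (intro smooth_on_mult smooth_on_const N(1) Ds DDs DDDs s(1))+
    also have "D (\<lambda>x. 3 * (D s x * D (D s) x)) x = 3 * D (\<lambda>x. D s x * D (D s) x) x"
      by (rule D_cmult[OF _ x]) (intro smooth_on_mult N(1) Ds DDs)
    finally show ?thesis using D_mult[OF Ds DDs x] D_mult[OF s(1) DDDs x]
      by (simp add: power2_eq_square)
  qed
  show "D U x = s x * D s x"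
    "D (D U) x = (D s x)\<^sup>2 + s x * D (D s) x"
    "D (D (D U)) x = 3 * D s x * D (D s) x + s x * D (D (D s)) x"
    "D (D (D (D U))) x = 3 * (D (D s) x)\<^sup>2 + 4 * D s x * D (D (D s)) x + s x * D (D (D (D s))) x"
    by (fact 1[OF assms] 2[OF assms] 3[OF assms] 4[OF assms])+
qed

text \<open>By \<open>m_D\<close>, the function \<open>m\<close> is a constant times
  \<open>1 / D s\<close>, the derivative of \<open>w\<close> with respect to \<open>s\<close>.
  Constancy of its circle means kills its second derivative at \<open>s = 0\<close>, hence the third
  derivative of \<open>w\<close> with respect to \<open>s\<close>; the first claim restates this for
  \<open>U\<close>. The second claim is the rationality of \<open>m r0\<close>, squared.\<close>

lemma isochronous_identity:
  assumes K: "K \<noteq> 0" and closed: "closed_near a b f V r0 K"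
  shows "5 * (D (D (D U)) r0)\<^sup>2 = 3 * D (D U) r0 * D (D (D (D U))) r0"
    and "K\<^sup>2 / (\<xi> ^ 4 * D (D U) r0) \<in> \<rat>"
proof -
  obtain \<delta> where \<delta>: "0 < \<delta>" "\<delta> \<le> l" "\<And>\<rho>. \<bar>\<rho>\<bar> < \<delta> \<Longrightarrow> advance \<rho> = 2 * pi * m r0" "m r0 \<in> \<rat>"
    using closed_near_imp_isochronous[OF assms] by blast
  define m1 where "m1 x = D m x / D s x" for x
  note Dm = smooth_D_N[OF smooth_m]
  have sm1: "smooth_on N m1" unfolding m1_def by (intro smooth_on_divide N(1) Dm Ds D_s_nz)
  have comp: "((\<lambda>y. g (X y)) has_real_derivative D g (X y) / D s (X y)) (at y)"
    if g: "smooth_on N g" and y: "\<bar>y\<bar> < l" for g y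
  proof -
    note x = X_N[OF y]
    have "((\<lambda>y. g (X y)) has_real_derivative deriv g (X y) * inverse (deriv s (X y))) (at y)"
      by (rule DERIV_chain2[OF smooth_on_DERIV[OF g x] X_DERIV[OF y]])
    also have "deriv g (X y) * inverse (deriv s (X y)) = D g (X y) / D s (X y)"
      using f_pos[OF N_E[OF x]] \<xi>_pos \<sigma>_sq(3) s(3)[OF x] by (simp add: D_def field_simps)
    finally show ?thesis .
  qed
  \<comment> \<open>Along \<open>X\<close> one has \<open>d/ds = (1 / D s) * D\<close>; the left
    side is the second derivative of \<open>m\<close> with respect to \<open>s\<close> at 0.\<close>
  have "D m1 (X 0) / D s (X 0) = 0"
  proof (rule circle_mean_constant[OF \<delta>(1), where M = "\<lambda>y. m (X y)" and ?M1.0 = "\<lambda>y. m1 (X y)"])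
    show "((\<lambda>y. m (X y)) has_real_derivative m1 (X y)) (at y)" if "\<bar>y\<bar> < \<delta>" for y
      using comp[OF smooth_m, of y] that \<delta>(2) by (simp add: m1_def)
    show "((\<lambda>y. m1 (X y)) has_real_derivative D m1 (X 0) / D s (X 0)) (at 0)"
      by (rule comp[OF sm1]) (use l in simp)
    show "integral {0..2 * pi} (\<lambda>\<alpha>. m (X (\<rho> * sin \<alpha>))) = 2 * pi * m r0" if "\<bar>\<rho>\<bar> < \<delta>" for \<rho>
      using \<delta>(3)[OF that] by (simp add: advance_def)
  qed
  then have m2: "D m1 r0 = 0" using D_s_nz[OF N(4)] by (simp add: X_0)
  have e0: "m1 x * D s x = D m x" if "x \<in> N" for x using D_s_nz[OF that] by (simp add: m1_def)
  have e1: "D m x * D s x + m x * D (D s) x = 0" if x: "x \<in> N" for x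
    using D_cong_N[OF x m_D] D_mult[OF smooth_m Ds x] by (simp add: D_const)
  have e2: "m1 x * (D s x * D s x) + m x * D (D s) x = 0" if x: "x \<in> N" for x
    using e1[OF x] e0[OF x] by algebra
  have s2: "smooth_on N (\<lambda>x. D s x * D s x)" by (intro smooth_on_mult N(1) Ds)
  have "D (\<lambda>x. m1 x * (D s x * D s x) + m x * D (D s) x) r0 = 0"
    using D_cong_N[OF N(4) e2] by (simp add: D_const)
  moreover have "D (\<lambda>x. m1 x * (D s x * D s x) + m x * D (D s) x) r0
      = D (\<lambda>x. m1 x * (D s x * D s x)) r0 + D (\<lambda>x. m x * D (D s) x) r0"
    by (rule D_add[OF _ _ N(4)]) (intro smooth_on_mult N(1) Ds DDs smooth_m sm1)+
  ultimately have e3: "2 * m1 r0 * D s r0 * D (D s) r0 + D m r0 * D (D s) r0 + m r0 * D (D (D s)) r0 = 0"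
    using D_mult[OF sm1 s2 N(4)] D_mult[OF Ds Ds N(4)] D_mult[OF smooth_m DDs N(4)] m2
    by (simp add: algebra_simps)
  have mnz: "m r0 \<noteq> 0" using m_D[OF N(4)] K \<sigma>_sq(3) \<xi>_pos by auto
  have "m r0 * (D s r0 * D (D (D s)) r0) = m r0 * (3 * (D (D s) r0)\<^sup>2)"
  proof -
    have 1: "m r0 * D (D (D s)) r0 = - 3 * (m1 r0 * D s r0) * D (D s) r0"
      using e3 unfolding e0[OF N(4), symmetric] by simp
    have 2: "m1 r0 * (D s r0 * D s r0) = - (m r0 * D (D s) r0)" using e2[OF N(4)] by simp
    have "m r0 * (D s r0 * D (D (D s)) r0) = D s r0 * (m r0 * D (D (D s)) r0)" by simp
    also have "\<dots> = - 3 * (m1 r0 * (D s r0 * D s r0)) * D (D s) r0" unfolding 1 by simp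
    also have "\<dots> = m r0 * (3 * (D (D s) r0)\<^sup>2)" unfolding 2 by (simp add: power2_eq_square)
    finally show ?thesis .
  qed
  \<comment> \<open>The classical condition for the third derivative of an inverse function to
    vanish. With \<open>s r0 = 0\<close> it gives \<open>D\<^sup>2U = (D s)\<^sup>2\<close>,
    \<open>D\<^sup>3U = 3 * D s * D\<^sup>2s\<close> and
    \<open>D\<^sup>4U = 15 * (D\<^sup>2s)\<^sup>2\<close>, so both sides of the claim are
    \<open>45 * (D s)\<^sup>2 * (D\<^sup>2s)\<^sup>2\<close>.\<close>
  then have e4: "D s r0 * D (D (D s)) r0 = 3 * (D (D s) r0)\<^sup>2" using mnz by (metis mult_left_cancel)
  show "5 * (D (D (D U)) r0)\<^sup>2 = 3 * D (D U) r0 * D (D (D (D U))) r0"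
    using e4 unfolding D_U_s[OF N(4)] s(2) by algebra
  have "K\<^sup>2 / (\<xi> ^ 4 * D (D U) r0) = (K * \<sigma> / \<xi>\<^sup>2 / D s r0)\<^sup>2"
    by (simp add: D_U_s[OF N(4)] s(2) power_divide power_mult_distrib \<sigma>_sq(2) flip: power_mult)
  also have "K * \<sigma> / \<xi>\<^sup>2 / D s r0 = m r0" unfolding m_D[OF N(4), symmetric] using D_s_nz[OF N(4)] by simp
  finally show "K\<^sup>2 / (\<xi> ^ 4 * D (D U) r0) \<in> \<rat>" using \<delta>(4) by simp
qed

end

section \<open>Classification: from the local identities to the power law\<close>

context surface
begin

lemma bertrand_potential_w:
  assumes "r \<in> E"
  shows "bertrand_potential f 1 A B r = - A * w r + B"
    and "bertrand_potential f 2 A B r = A / (2 * (w r)\<^sup>2) + B"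
proof -
  have e: "2 - (int 1)\<^sup>2 = 1" "2 - (int 2)\<^sup>2 = - 2" by simp_all
  have p: "w r powi (- 2) = inverse ((w r)\<^sup>2)" by (simp add: power_int_def power_inverse)
  show "bertrand_potential f 1 A B r = - A * w r + B"
    unfolding bertrand_potential_def abs_theta[OF assms] e by simp
  show "bertrand_potential f 2 A B r = A / (2 * (w r)\<^sup>2) + B"
    unfolding bertrand_potential_def abs_theta[OF assms] e p by (simp add: field_simps)
qed

lemma strongly_stable_closed_near:
  assumes V: "smooth_on E V" and st: "strongly_stable a b f V r0 K" and cl: "closed_near a b f V r0 K"
  shows "5 * (D (D (D V)) r0)\<^sup>2 = 3 * (D (D V) r0 + K\<^sup>2 / \<xi>\<^sup>2) * D (D (D (D V))) r0"
    and "K\<^sup>2 / (\<xi> ^ 4 * (D (D V) r0 + K\<^sup>2 / \<xi>\<^sup>2)) \<in> \<rat>"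
proof -
  obtain N s l where W: "well a b f \<xi> \<sigma> V K r0 N s l"
    using strongly_stable_well[OF V st zero_less_one] by blast
  have r0: "r0 \<in> E" and K: "K \<noteq> 0" using st by (auto simp: strongly_stable_iff[OF V])
  show "5 * (D (D (D V)) r0)\<^sup>2 = 3 * (D (D V) r0 + K\<^sup>2 / \<xi>\<^sup>2) * D (D (D (D V))) r0"
    "K\<^sup>2 / (\<xi> ^ 4 * (D (D V) r0 + K\<^sup>2 / \<xi>\<^sup>2)) \<in> \<rat>"
    using well.isochronous_identity[OF W K cl] by (simp_all add: DD_effective_potential[OF V r0])
qed

text \<open>At a circle with \<open>D V < 0\<close> the squared momentum is \<open>-\<xi>\<^sup>2 D V / w\<close>, and \<open>2\<pi> / (\<xi> \<surd>\<beta>)\<close> with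
  \<open>\<beta> = 1 - w D\<^sup>2 V / D V\<close> is the limit of the angular periods of nearby orbits.\<close>

lemma strongly_stable_beta:
  assumes V: "smooth_on E V" and r: "r \<in> E" "D V r < 0" "w r * D (D V) r - D V r > 0"
  shows "strongly_stable a b f V r (\<xi> * sqrt (- D V r / w r))"
    and "\<xi> \<in> \<rat> \<Longrightarrow> closed_near a b f V r (\<xi> * sqrt (- D V r / w r)) \<Longrightarrow> 1 - w r * D (D V) r / D V r \<in> \<rat>"
    and "closed_near a b f V r (\<xi> * sqrt (- D V r / w r)) \<Longrightarrow>
      5 * (D (D (D V)) r)\<^sup>2 = 3 * (D (D V) r - D V r / w r) * D (D (D (D V))) r"
proof -
  define K where "K = \<xi> * sqrt (- D V r / w r)"
  note wp = w_pos[OF r(1)]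
  have K2: "K\<^sup>2 / \<xi>\<^sup>2 = - D V r / w r"
    using r(2) wp \<xi>_pos by (simp add: K_def power_mult_distrib divide_nonpos_pos)
  have "K \<noteq> 0" using r(2) wp \<xi>_pos by (simp add: K_def)
  moreover have "D (D V) r + K\<^sup>2 / \<xi>\<^sup>2 > 0"
    using r(3) wp unfolding K2 by (simp add: field_simps)
  ultimately have st: "strongly_stable a b f V r K"
    using r(1) wp by (simp add: strongly_stable_iff_D[OF V] K2)
  then show "strongly_stable a b f V r (\<xi> * sqrt (- D V r / w r))" by (simp add: K_def)
  {
    assume cl: "closed_near a b f V r (\<xi> * sqrt (- D V r / w r))"
    note * = strongly_stable_closed_near[OF V st cl[folded K_def]]
    show "5 * (D (D (D V)) r)\<^sup>2 = 3 * (D (D V) r - D V r / w r) * D (D (D (D V))) r"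
      using *(1) by (simp add: K2)
    assume \<xi>: "\<xi> \<in> \<rat>"
    \<comment> \<open>The rational number supplied by \<open>*(2)\<close> is the square of
      \<open>m\<close> at the circle, which equals
      \<open>1 / (\<xi>\<^sup>2 * \<beta>)\<close>.\<close>
    have "1 - w r * D (D V) r / D V r = inverse (\<xi>\<^sup>2 * (K\<^sup>2 / (\<xi> ^ 4 * (D (D V) r + K\<^sup>2 / \<xi>\<^sup>2))))"
    proof -
      have "K\<^sup>2 = \<xi>\<^sup>2 * (- D V r / w r)" using K2 \<xi>_pos by (simp add: field_simps)
      then have "\<xi>\<^sup>2 * (K\<^sup>2 / (\<xi> ^ 4 * (D (D V) r + K\<^sup>2 / \<xi>\<^sup>2)))
          = (- D V r / w r) / (D (D V) r - D V r / w r)"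
        using \<xi>_pos by (simp add: power4_eq_xxxx power2_eq_square)
      also have "\<dots> = - D V r / (w r * D (D V) r - D V r)"
        using wp r(3) by (simp add: field_simps)
      finally show ?thesis using r(2) by (simp add: field_simps)
    qed
    moreover have "inverse (\<xi>\<^sup>2 * (K\<^sup>2 / (\<xi> ^ 4 * (D (D V) r + K\<^sup>2 / \<xi>\<^sup>2)))) \<in> \<rat>"
      by (intro Rats_inverse Rats_mult Rats_power \<xi> *(2))
    ultimately show "1 - w r * D (D V) r / D V r \<in> \<rat>" by (simp only:)
  }
qed

text \<open>Where a strongly stable circle exists, \<beta> is rational and hence locally constant,
  which is the differential equation of a power of \<open>w\<close>. Continuation over the whole
  interval is the point to be secured, since stability is initially known at one circle
  only.\<close>

lemma locally_closing_imp_power_law: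
  assumes V: "smooth_on E V" and "locally_closing a b f V" and \<xi>: "\<xi> \<in> \<rat>"
  obtains n G where "n = 0 \<or> n = - 3" "G < 0" "\<And>r. r \<in> E \<Longrightarrow> D V r = G * w r powr n"
proof -
  note DV = smooth_D_E[OF V]
  note DDV = smooth_D_E[OF DV]
  note DDDV = smooth_D_E[OF DDV]
  obtain r0 K where st: "strongly_stable a b f V r0 K" and fl: "cond_forall_loc a b f V"
    using assms(2) by (auto simp: locally_closing_def cond_exists_loc_def)
  have cl: "closed_near a b f V r (\<xi> * sqrt (- D V r / w r))"
    if "r \<in> E" "D V r < 0" "w r * D (D V) r - D V r > 0" for r
    using fl strongly_stable_beta(1)[OF V that] by (auto simp: cond_forall_loc_def)
  have r0: "r0 \<in> E" "D V r0 < 0" "w r0 * D (D V) r0 - D V r0 > 0"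
  proof -
    have *: "r0 \<in> E" "K \<noteq> 0" "D V r0 = - (K\<^sup>2 / \<xi>\<^sup>2 * w r0)" "D (D V) r0 + K\<^sup>2 / \<xi>\<^sup>2 > 0"
      using st by (auto simp: strongly_stable_iff_D[OF V])
    note wp = w_pos[OF *(1)]
    show "r0 \<in> E" by (fact *(1))
    show "D V r0 < 0" using *(2) wp \<xi>_pos unfolding *(3) by simp
    have "w r0 * D (D V) r0 - D V r0 = w r0 * (D (D V) r0 + K\<^sup>2 / \<xi>\<^sup>2)"
      unfolding *(3) by (simp add: algebra_simps)
    then show "w r0 * D (D V) r0 - D V r0 > 0" using *(4) wp by simp
  qed
  \<comment> \<open>The exponent read off at the given circle. Here \<beta> = 1 - n, so stability at
    \<open>r0\<close> is the inequality \<open>n < 1\<close>.\<close>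
  define n where "n = w r0 * D (D V) r0 / D V r0"
  have n1: "n < 1" using r0(2,3) by (simp add: n_def field_simps)
  define H where "H r = D V r * w r powr (- n)" for r
  define G where "G = H r0"
  have sH: "smooth_on E H"
    unfolding H_def by (intro smooth_on_mult smooth_on_powr smooth_w DV open_einterval w_pos)
  have Gneg: "G < 0" using r0(2) w_pos[OF r0(1)] by (simp add: G_def H_def mult_neg_pos)
  define J where "J r = w r * D (D V) r - n * D V r" for r
  have sJ: "smooth_on E J"
    unfolding J_def by (intro smooth_on_diff smooth_on_mult smooth_on_const smooth_w DV DDV open_einterval)
  \<comment> \<open>The second condition records the logarithmic slope of \<open>D V\<close> as
    well. With \<open>n < 1\<close> it yields stability at each point of \<open>C\<close>, without
    which nothing would be known nearby.\<close>
  define C where "C = {r \<in> E. H r = G} \<inter> {r \<in> E. J r = 0}"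
  have r0C: "r0 \<in> C" using r0 by (simp add: C_def G_def J_def n_def)
  have closed: "closedin (top_of_set E) C"
    unfolding C_def
    by (intro closedin_Int continuous_closedin_preimage_constant smooth_on_continuous_on sH sJ)
  have neg: "D V r < 0" "w r * D (D V) r - D V r > 0" if "r \<in> C" for r
  proof -
    have r: "r \<in> E" "H r = G" "J r = 0" using that by (auto simp: C_def)
    have "D V r * w r powr (- n) < 0" using r(2) Gneg by (simp add: H_def)
    then show "D V r < 0" by (auto simp: mult_less_0_iff not_less[symmetric])
    moreover have "w r * D (D V) r - D V r = (1 - n) * (- D V r)" using r(3) by (simp add: J_def algebra_simps)
    ultimately show "w r * D (D V) r - D V r > 0" using n1 by (simp add: mult_pos_neg)
  qed
  have "open C"
    unfolding open_contains_ball
  proof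
    fix r1 assume r1: "r1 \<in> C"
    define S where "S = {r \<in> E. 0 < - D V r} \<inter> {r \<in> E. 0 < w r * D (D V) r - D V r}"
    have "open S"
      unfolding S_def
      by (intro open_Int open_Collect_pos open_einterval smooth_on_continuous_on smooth_on_minus
          smooth_on_diff smooth_on_mult smooth_w DV DDV)
    moreover have "r1 \<in> S" using r1 neg[OF r1] by (auto simp: S_def C_def)
    ultimately obtain e where e: "e > 0" "ball r1 e \<subseteq> S" using open_contains_ball by blast
    have S: "r \<in> E" "D V r < 0" "w r * D (D V) r - D V r > 0" if "r \<in> ball r1 e" for r
      using e(2) that by (auto simp: S_def)
    define \<beta> where "\<beta> r = 1 - w r * D (D V) r / D V r" for r
    \<comment> \<open>Every point of the ball lies in \<open>S\<close> and therefore carries a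
      strongly stable circle with closed orbits near it, so \<beta> takes only rational values
      there.\<close>
    have \<beta>: "\<beta> r = \<beta> r1" if "r \<in> ball r1 e" for r
    proof (rule constant_of_countable_range[of "ball r1 e" \<beta>])
      show "continuous_on (ball r1 e) \<beta>"
        unfolding \<beta>_def
        by (intro continuous_intros continuous_on_subset[OF smooth_on_continuous_on[OF smooth_w]]
            continuous_on_subset[OF smooth_on_continuous_on[OF DV]]
            continuous_on_subset[OF smooth_on_continuous_on[OF DDV]]) (use S in force)+
      have "\<beta> ` ball r1 e \<subseteq> \<rat>"
        using strongly_stable_beta(2)[OF V S \<xi> cl[OF S]] by (auto simp: \<beta>_def)
      then show "countable (\<beta> ` ball r1 e)" by (rule countable_subset) (rule countable_rat)
    qed (use that e in auto)
    have J: "J r = 0" if r: "r \<in> ball r1 e" for r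
    proof -
      have r1b: "r1 \<in> ball r1 e" using e by simp
      have "w r1 * D (D V) r1 = n * D V r1" using r1 by (simp add: C_def J_def)
      then have "\<beta> r1 = 1 - n" using S(2)[OF r1b] by (simp add: \<beta>_def)
      then show ?thesis using \<beta>[OF r] S(2)[OF r] by (simp add: \<beta>_def J_def field_simps)
    qed
    have "H r = G" if r: "r \<in> ball r1 e" for r
    proof -
      have "(H has_real_derivative 0) (at r)" if r: "r \<in> ball r1 e" for r
      proof -
        note wp = w_pos[OF S(1)[OF r]]
        have "(H has_real_derivative \<sigma> * \<xi>\<^sup>2 / (f r)\<^sup>2 * D (D V) r * w r powr (- n)
            + - n * w r powr (- n - 1) * (\<sigma> * \<xi>\<^sup>2 / (f r)\<^sup>2) * D V r) (at r)"
          unfolding H_def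
          by (rule DERIV_mult[OF D_DERIV[OF S(1)[OF r] DV S(1)[OF r]]
                DERIV_chain2[OF has_real_derivative_powr[OF wp] w_DERIV[OF S(1)[OF r]]]])
        also have "\<sigma> * \<xi>\<^sup>2 / (f r)\<^sup>2 * D (D V) r * w r powr (- n)
            + - n * w r powr (- n - 1) * (\<sigma> * \<xi>\<^sup>2 / (f r)\<^sup>2) * D V r
            = \<sigma> * \<xi>\<^sup>2 / (f r)\<^sup>2 * w r powr (- n - 1) * J r"
        proof -
          have "w r powr (- n) = w r powr (- n - 1) * w r"
            using wp by (simp add: powr_diff)
          then show ?thesis by (simp only: J_def) (simp add: algebra_simps diff_divide_distrib)
        qed
        finally show ?thesis using J[OF r] by simp
      qed
      then have "H r = H r1"
        by (rule DERIV_0_const_interval[OF convex_ball]) (use r e in auto)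
      then show ?thesis using r1 by (simp add: C_def)
    qed
    then have "ball r1 e \<subseteq> C" using J S(1) by (auto simp: C_def)
    then show "\<exists>e>0. ball r1 e \<subseteq> C" using e(1) by blast
  qed
  then have "openin (top_of_set E) C" by (rule open_subset[rotated]) (auto simp: C_def)
  moreover have "connected E" by (rule convex_connected[OF E_convex])
  ultimately have "C = E" using closed r0C unfolding connected_clopen by blast
  then have HG: "H r = G" and J0: "w r * D (D V) r = n * D V r" if "r \<in> E" for r
    using that by (auto simp: C_def J_def)
  have pl: "D V r = G * w r powr n" if "r \<in> E" for r
    using HG[OF that] w_pos[OF that] by (auto simp: H_def powr_minus field_simps)
  \<comment> \<open>Apply \<open>D\<close> to \<open>w * D\<^sup>2V = n * D V\<close>, using
    \<open>D w = 1\<close>; \<open>J2\<close> repeats this once more.\<close>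
  have J1: "w r * D (D (D V)) r = (n - 1) * D (D V) r" if r: "r \<in> E" for r
    using D_cong[OF open_einterval r J0] D_mult[OF smooth_w DDV r] D_cmult[OF DV r, of n] D_w[OF r]
    by (simp add: algebra_simps)
  have J2: "w r * D (D (D (D V))) r = (n - 2) * D (D (D V)) r" if r: "r \<in> E" for r
    using D_cong[OF open_einterval r J1] D_mult[OF smooth_w DDDV r] D_cmult[OF DDV r, of "n - 1"] D_w[OF r]
    by (simp add: algebra_simps)
  have "n = 0 \<or> n = - 3"
  proof -
    define y where "y = D V r0"
    define u where "u = w r0"
    have yn: "y \<noteq> 0" "u \<noteq> 0" "n \<noteq> 1" using r0(2) w_pos[OF r0(1)] n1 by (auto simp: y_def u_def)
    have D2: "D (D V) r0 = n * y / u" using J0[OF r0(1)] yn by (simp add: y_def u_def field_simps)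
    have D3: "D (D (D V)) r0 = n * (n - 1) * y / u ^ 2"
      using J1[OF r0(1)] yn unfolding D2 by (simp add: u_def field_simps power2_eq_square)
    have D4: "D (D (D (D V))) r0 = n * (n - 1) * (n - 2) * y / u ^ 3"
      using J2[OF r0(1)] yn unfolding D3 by (simp add: u_def field_simps power2_eq_square power3_eq_cube)
    have "5 * (n * (n - 1) * y / u ^ 2)\<^sup>2 = 3 * (n * y / u - y / u) * (n * (n - 1) * (n - 2) * y / u ^ 3)"
      using strongly_stable_beta(3)[OF V r0 cl[OF r0]] unfolding D2 D3 D4 y_def[symmetric] u_def[symmetric] .
    also have "\<dots> = 3 * n * (n - 2) * ((n - 1) * y / u ^ 2)\<^sup>2"
      using yn(2) by (simp add: field_simps power2_eq_square power3_eq_cube)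
    finally have "(5 * n\<^sup>2) * ((n - 1) * y / u ^ 2)\<^sup>2 = (3 * n * (n - 2)) * ((n - 1) * y / u ^ 2)\<^sup>2"
      by (simp add: power_mult_distrib power_divide mult.assoc)
    moreover have "((n - 1) * y / u ^ 2)\<^sup>2 \<noteq> 0" using yn by simp
    \<comment> \<open>The common factor could be cancelled because \<open>n < 1\<close> excludes
      \<open>n = 1\<close>. The remaining roots 0 and -3 are \<beta> = 1 and \<beta> = 4, the
      squares of the indices of the two potentials.\<close>
    ultimately have "5 * n\<^sup>2 = 3 * n * (n - 2)" by (metis mult_right_cancel)
    then have "n * (n + 3) = 0" by (simp add: power2_eq_square algebra_simps)
    then show ?thesis by auto
  qed
  then show ?thesis using that[OF _ Gneg pl] by blast
qed

text \<open>Integration of the power law with respect to \<open>w\<close>, with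
  \<open>A = - G\<close>: the exponent 0 gives \<open>- A * w\<close>, the exponent -3 gives
  \<open>A / (2 * w\<^sup>2)\<close>.\<close>

theorem locally_closing_imp_bertrand:
  assumes V: "smooth_on E V" and "locally_closing a b f V" "\<xi> \<in> \<rat>"
  shows "\<exists>i\<in>{1, 2}. \<exists>A>0. \<exists>B. \<forall>r\<in>E. V r = bertrand_potential f i A B r"
proof -
  obtain n G where nG: "n = 0 \<or> n = - 3" "G < 0" "\<And>r. r \<in> E \<Longrightarrow> D V r = G * w r powr n"
    using locally_closing_imp_power_law[OF assms] by blast
  from nG(1) show ?thesis
  proof
    assume n: "n = 0"
    have s: "smooth_on E (\<lambda>r. - G * w r)"
      by (intro smooth_on_mult smooth_on_const smooth_w open_einterval)
    have "D (\<lambda>r. V r + - G * w r) r = 0" if r: "r \<in> E" for r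
      using D_add[OF V s r] D_cmult[OF smooth_w r, of "- G"] D_w[OF r] nG(3)[OF r] w_pos[OF r] n by simp
    then obtain B where "\<And>r. r \<in> E \<Longrightarrow> V r + - G * w r = B"
      using D_0_const[OF smooth_on_add[OF open_einterval V s]] by blast
    then have "\<forall>r\<in>E. V r = bertrand_potential f 1 (- G) B r"
      using bertrand_potential_w(1)[where A = "- G" and B = B] by (simp add: algebra_simps)
    then show ?thesis using nG(2) by (intro bexI[of _ 1] exI[of _ "- G"]) auto
  next
    assume n: "n = - 3"
    have sw: "smooth_on E (\<lambda>r. w r powr (- 2))"
      by (intro smooth_on_powr smooth_w open_einterval w_pos)
    have Dw: "D (\<lambda>r. w r powr (- 2)) r = - 2 * w r powr (- 3)" if r: "r \<in> E" for r
    proof -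
      have "D (\<lambda>r. w r powr (- 2)) r
          = \<sigma> * (f r)\<^sup>2 / \<xi>\<^sup>2 * (- 2 * w r powr (- 2 - 1) * (\<sigma> * \<xi>\<^sup>2 / (f r)\<^sup>2))"
        by (rule D_eqI[OF DERIV_chain2[OF has_real_derivative_powr[OF w_pos[OF r]] w_DERIV[OF r]]])
      also have "\<dots> = - 2 * w r powr (- 2 - 1)" by (rule \<sigma>_cancel(1)[OF r])
      finally show ?thesis by simp
    qed
    have s: "smooth_on E (\<lambda>r. G / 2 * w r powr (- 2))"
      by (intro smooth_on_mult smooth_on_const sw open_einterval)
    have "D (\<lambda>r. V r + G / 2 * w r powr (- 2)) r = 0" if r: "r \<in> E" for r
      using D_add[OF V s r] D_cmult[OF sw r, of "G / 2"] Dw[OF r] nG(3)[OF r] n by simp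
    then obtain B where B: "\<And>r. r \<in> E \<Longrightarrow> V r + G / 2 * w r powr (- 2) = B"
      using D_0_const[OF smooth_on_add[OF open_einterval V s]] by blast
    have "V r = bertrand_potential f 2 (- G) B r" if r: "r \<in> E" for r
    proof -
      have "w r powr (- 2) = inverse ((w r)\<^sup>2)"
        using w_pos[OF r] by (simp add: powr_minus powr_numeral)
      then show ?thesis using B[OF r] bertrand_potential_w(2)[OF r, of "- G" B]
        by (simp add: field_simps)
    qed
    then show ?thesis using nG(2) by (intro bexI[of _ 2] exI[of _ "- G"]) auto
  qed
qed

end

section \<open>From a noncircular bounded orbit to a strongly stable circle\<close>

text \<open>Let \<open>y\<close> be the first point with \<open>G y \<le> k\<close>. The mean value
  theorem on \<open>{p..y}\<close> gives a point of negative slope, and everything up to it is still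
  above level \<open>k\<close>.\<close>

lemma descending_point:
  fixes G :: "real \<Rightarrow> real"
  assumes "p < q" and G: "\<And>x. p \<le> x \<Longrightarrow> x \<le> q \<Longrightarrow> (G has_real_derivative G' x) (at x)"
    and "G p > k" "G q \<le> k"
  obtains z where "p < z" "z < q" "\<And>x. p \<le> x \<Longrightarrow> x \<le> z \<Longrightarrow> G x > k" "G' z < 0"
proof -
  have cG: "continuous_on {p..q} G"
    by (intro continuous_at_imp_continuous_on ballI DERIV_isCont[OF G]) auto
  define S where "S = {x \<in> {p..q}. G x \<le> k}"
  have S: "S = {p..q} \<inter> G -` {..k}" by (auto simp: S_def)
  then have "closed S" using continuous_closed_preimage[OF cG closed_atLeastAtMost closed_atMost] by simp
  then have "compact S" using compact_Int_closed[OF compact_Icc, of S p q] by (simp add: S_def Int_absorb1 subset_iff)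
  moreover have "q \<in> S" using assms by (simp add: S_def)
  ultimately obtain y where y: "y \<in> S" "\<And>x. x \<in> S \<Longrightarrow> y \<le> x"
    using compact_attains_inf[of S] by blast
  have y': "p \<le> y" "y \<le> q" "G y \<le> k" using y(1) by (auto simp: S_def)
  then have py: "p < y" using assms(3) by (cases "p = y") auto
  have above: "G x > k" if "p \<le> x" "x < y" for x
    using y(2)[of x] that y'(2) by (force simp: S_def)
  obtain z where z: "p < z" "z < y" "G y - G p = (y - p) * G' z"
    using MVT2[OF py, of G G'] G y'(2) by force
  have "(y - p) * G' z < 0" using z(3) y'(3) assms(3) by linarith
  then have "G' z < 0" using py by (simp add: mult_less_0_iff)
  then show ?thesis using that[of z] z above y'(2) by force
qed

text \<open>If the speed stayed above half its initial value, \<open>r\<close> would run past its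
  bound. So it falls to that level, and a descending point of the speed has negative acceleration,
  while \<open>r\<close> has only increased until then.\<close>

lemma bounded_decelerates:
  fixes r v A :: "real \<Rightarrow> real"
  assumes r: "\<And>t. (r has_real_derivative v t) (at t)" and v: "\<And>t. (v has_real_derivative A t) (at t)"
    and "\<And>t. r t \<le> M" and "v t0 > 0"
  obtains t1 where "r t1 > r t0" "A t1 < 0"
proof -
  define c where "c = v t0 / 2"
  have c: "c > 0" "v t0 > c" using assms(4) by (auto simp: c_def)
  \<comment> \<open>After time \<open>L\<close>, a speed above \<open>c\<close> carries
    \<open>r\<close> beyond \<open>M + c\<close>.\<close>
  define L where "L = (M - r t0) / c + 1"
  have L: "L > 0" using assms(3)[of t0] c(1) by (simp add: L_def add_nonneg_pos)
  have "\<exists>q>t0. v q \<le> c"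
  proof (rule ccontr)
    assume "\<not> (\<exists>q>t0. v q \<le> c)"
    then have *: "v q > c" if "q > t0" for q using that by force
    obtain z where z: "t0 < z" "z < t0 + L" "r (t0 + L) - r t0 = (t0 + L - t0) * v z"
      using MVT2[of t0 "t0 + L" r v] L r by auto
    have "r (t0 + L) - r t0 > L * c" using *[OF z(1)] z(3) L by simp
    moreover have "L * c = M - r t0 + c" using c(1) by (simp add: L_def field_simps)
    ultimately show False using assms(3)[of "t0 + L"] c(1) by linarith
  qed
  then obtain q where q: "q > t0" "v q \<le> c" by blast
  obtain z where z: "t0 < z" "z < q" "\<And>x. t0 \<le> x \<Longrightarrow> x \<le> z \<Longrightarrow> v x > c" "A z < 0"
    using descending_point[OF q(1) v c(2) q(2)] by blast
  have "r t0 < r z"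
  proof (rule DERIV_pos_imp_increasing[OF z(1)])
    fix x assume "t0 \<le> x" "x \<le> z"
    then have "v x > 0" using z(3)[of x] c(1) by simp
    then show "\<exists>y. (r has_real_derivative y) (at x) \<and> 0 < y" using r by blast
  qed
  then show ?thesis using that z(4) by blast
qed

text \<open>For positive speed, \<open>bounded_decelerates\<close> is used forwards and, for
  \<open>t1\<close>, on the reversed and reflected motion \<open>- r (- t)\<close>. Negative speed
  is reduced to this by reversing time.\<close>

lemma bounded_turning_points:
  fixes r v A :: "real \<Rightarrow> real"
  assumes r: "\<And>t. (r has_real_derivative v t) (at t)" and v: "\<And>t. (v has_real_derivative A t) (at t)"
    and M: "\<And>t. \<bar>r t\<bar> \<le> M" and "v t0 \<noteq> 0"
  obtains t1 t2 where "r t1 < r t2" "A t1 > 0" "A t2 < 0"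
proof -
  have *: "\<exists>t1 t2. r t1 < r t2 \<and> A t1 > 0 \<and> A t2 < 0"
    if r: "\<And>t. (r has_real_derivative v t) (at t)" and v: "\<And>t. (v has_real_derivative A t) (at t)"
      and M: "\<And>t. \<bar>r t\<bar> \<le> M" and pos: "v t0 > 0" for r v A :: "real \<Rightarrow> real" and t0
  proof -
    have Mr: "r t \<le> M" "- r t \<le> M" for t using M[of t] by linarith+
    obtain t2 where t2: "r t2 > r t0" "A t2 < 0" using bounded_decelerates[OF r v Mr(1) pos] by blast
    have "((\<lambda>t. - r (- t)) has_real_derivative v (- t)) (at t)" for t
      using DERIV_minus[OF DERIV_mirror[THEN iffD1, OF r[of "- t"]]] by simp
    moreover have "((\<lambda>t. v (- t)) has_real_derivative - A (- t)) (at t)" for t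
      using DERIV_mirror[THEN iffD1, OF v[of "- t"]] by simp
    ultimately obtain t1 where t1: "- r (- t1) > - r (- (- t0))" "- A (- t1) < 0"
      using bounded_decelerates[of "\<lambda>t. - r (- t)" "\<lambda>t. v (- t)" "\<lambda>t. - A (- t)" M "- t0"] Mr(2) pos
      by (metis minus_minus)
    have "r (- t1) < r t2" "A (- t1) > 0" using t1 t2 by auto
    then show ?thesis using t2(2) by blast
  qed
  show ?thesis
  proof (cases "v t0 > 0")
    case True
    then show ?thesis using *[OF r v M] that by blast
  next
    case False
    then have neg: "- v (- (- t0)) > 0" using assms(4) by simp
    have 1: "((\<lambda>t. r (- t)) has_real_derivative - v (- t)) (at t)" for t
      using DERIV_mirror[THEN iffD1, OF r[of "- t"]] by simp
    have 2: "((\<lambda>t. - v (- t)) has_real_derivative A (- t)) (at t)" for t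
      using DERIV_minus[OF DERIV_mirror[THEN iffD1, OF v[of "- t"]]] by simp
    show ?thesis using *[OF 1 2 M neg] that by blast
  qed
qed

context surface
begin

lemma nonsingular_boundedD:
  assumes V: "smooth_on E V" and nb: "nonsingular_bounded a b f V I r \<phi> K"
  shows "I = UNIV" "K \<noteq> 0" "motion V K UNIV r (deriv r) \<phi>"
    and "\<exists>r1 r2. {r1..r2} \<subseteq> E \<and> (\<forall>t. r t \<in> {r1..r2})"
proof -
  show I: "I = UNIV" and K: "K \<noteq> 0"
    using nb by (auto simp: nonsingular_bounded_def bounded_trajectory_def)
  have "solution_on a b f V UNIV r \<phi>" "has_momentum f UNIV r \<phi> K"
    using nb I by (auto simp: nonsingular_bounded_def bounded_trajectory_def trajectory_def)
  then show "motion V K UNIV r (deriv r) \<phi>" by (rule solution_imp_motion[OF V])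
  show "\<exists>r1 r2. {r1..r2} \<subseteq> E \<and> (\<forall>t. r t \<in> {r1..r2})"
    using nb I by (auto simp: nonsingular_bounded_def bounded_trajectory_def)
qed

text \<open>On the compact radial range of the orbit \<open>f\<close> is bounded, so the angular
  velocity has a fixed sign and stays away from 0; the angle therefore runs over the whole line. The
  factor \<open>sgn K\<close> makes it increasing before the inversion.\<close>

lemma time_of_angle:
  assumes V: "smooth_on E V" and nb: "nonsingular_bounded a b f V I r \<phi> K"
  obtains T where "\<And>t. T (\<phi> t) = t" "\<And>x. \<phi> (T x) = x"
    "\<And>x. (T has_real_derivative (f (r (T x)))\<^sup>2 / K) (at x)"
proof -
  note mo = nonsingular_boundedD(3)[OF assms] and K = nonsingular_boundedD(2)[OF assms]
  obtain r1 r2 where r12: "{r1..r2} \<subseteq> E" "\<And>t. r t \<in> {r1..r2}"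
    using nonsingular_boundedD(4)[OF assms] by blast
  have "continuous_on {r1..r2} f"
    by (rule continuous_on_subset[OF smooth_on_continuous_on[OF smooth_f] r12(1)])
  then obtain x0 where x0: "x0 \<in> {r1..r2}" "\<forall>x\<in>{r1..r2}. f x \<le> f x0"
    using continuous_attains_sup[OF compact_Icc, of r1 r2 f] r12(2) by (metis empty_iff)
  define c where "c = \<bar>K\<bar> / (f x0)\<^sup>2"
  have fx0: "f x0 > 0" using f_pos x0(1) r12(1) by blast
  have c: "c > 0" using K fx0 by (simp add: c_def)
  have fr: "f (r t) > 0" "f (r t) \<le> f x0" for t using f_pos motionD(1)[OF mo] x0(2) r12(2) by auto
  have ge: "c \<le> sgn K * (K / (f (r t))\<^sup>2)" for t
  proof -
    have "(f (r t))\<^sup>2 \<le> (f x0)\<^sup>2" using fr[of t] by (intro power_mono) auto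
    then have "c \<le> \<bar>K\<bar> / (f (r t))\<^sup>2" unfolding c_def using fr[of t] K by (intro divide_left_mono) auto
    then show ?thesis by (simp add: sgn_mult_self_eq mult_sgn_abs abs_sgn mult.commute)
  qed
  have d: "((\<lambda>t. sgn K * \<phi> t) has_real_derivative sgn K * (K / (f (r t))\<^sup>2)) (at t)" for t
    by (rule DERIV_cmult[OF motionD(4)[OF mo UNIV_I]])
  show ?thesis
  proof (rule global_inverse[OF d c ge])
    fix Q assume Q: "\<And>x. Q (sgn K * \<phi> x) = x" "\<And>y. sgn K * \<phi> (Q y) = y"
      "\<And>y. (Q has_real_derivative inverse (sgn K * (K / (f (r (Q y)))\<^sup>2))) (at y)"
    have s: "sgn K * sgn K = 1" "sgn K \<noteq> 0" using K by (auto simp: sgn_if)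
    show thesis
    proof (rule that[of "\<lambda>x. Q (sgn K * x)"])
      show "\<phi> (Q (sgn K * x)) = x" for x
        using Q(2)[of "sgn K * x"] s(2) by simp
      show "((\<lambda>x. Q (sgn K * x)) has_real_derivative (f (r (Q (sgn K * x))))\<^sup>2 / K) (at x)" for x
      proof -
        have "((\<lambda>x. Q (sgn K * x)) has_real_derivative
            inverse (sgn K * (K / (f (r (Q (sgn K * x))))\<^sup>2)) * sgn K) (at x)"
          by (rule DERIV_chain2[OF Q(3)]) (auto intro!: derivative_eq_intros)
        then show ?thesis using s(2) K fr(1) by (simp add: field_simps)
      qed
    qed (rule Q(1))
  qed
qed

lemma constant_radius_circular:
  assumes V: "smooth_on E V" and nb: "nonsingular_bounded a b f V I r \<phi> K" and c: "\<And>t. r t = c"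
  shows "circular I r \<phi>"
proof -
  obtain T where T: "\<And>x. \<phi> (T x) = x" using time_of_angle[OF V nb] by metis
  have "z \<in> range (\<lambda>t. cis (\<phi> t))" if "cmod z = 1" for z
  proof -
    have "cis (\<phi> (T (Arg z))) = z" using that cis_Arg[of z] by (cases "z = 0") (auto simp: T sgn_eq)
    then show ?thesis by (metis rangeI)
  qed
  then have "orbit I r \<phi> = circle c"
    unfolding orbit_def circle_def nonsingular_boundedD(1)[OF V nb] by (force simp: c image_iff)
  then show ?thesis by (auto simp: circular_def)
qed

lemma noncircular_bounded_turning:
  assumes V: "smooth_on E V" and nb: "nonsingular_bounded a b f V I r \<phi> K" and nc: "\<not> circular I r \<phi>"
  obtains x1 x2 where "x1 \<in> E" "x2 \<in> E" "x1 < x2" "deriv (effective_potential f V K) x1 < 0"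
    "deriv (effective_potential f V K) x2 > 0"
proof -
  note mo = nonsingular_boundedD(3)[OF V nb]
  obtain r1 r2 where r12: "{r1..r2} \<subseteq> E" "\<And>t. r t \<in> {r1..r2}"
    using nonsingular_boundedD(4)[OF V nb] by blast
  have M: "\<bar>r t\<bar> \<le> max \<bar>r1\<bar> \<bar>r2\<bar>" for t using r12(2)[of t] by auto
  have "\<exists>t0. deriv r t0 \<noteq> 0"
  proof (rule ccontr)
    assume "\<not> (\<exists>t0. deriv r t0 \<noteq> 0)"
    then have "(r has_real_derivative 0) (at t)" for t using motionD(2)[OF mo UNIV_I, of t] by simp
    then have "r t = r 0" for t by (intro DERIV_0_const_interval[of UNIV r t 0]) auto
    then show False using constant_radius_circular[OF V nb] nc by blast
  qed
  then obtain t0 where t0: "deriv r t0 \<noteq> 0" by blast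
  obtain t1 t2 where t: "r t1 < r t2" "- deriv (effective_potential f V K) (r t1) > 0"
      "- deriv (effective_potential f V K) (r t2) < 0"
    using bounded_turning_points[OF motionD(2,3)[OF mo UNIV_I] M t0] by blast
  show ?thesis by (rule that[of "r t1" "r t2"]) (use t motionD(1)[OF mo] in auto)
qed

text \<open>The derivative of the effective potential has the sign of
  \<open>\<sigma> * (K\<^sup>2 - g)\<close>, so its change of sign makes \<open>\<sigma> * g\<close>
  descend somewhere at a positive level of \<open>g\<close>, and there the circle is strongly
  stable. One end may be critical, which the weakly closing case needs.\<close>

lemma turning_imp_strongly_stable:
  assumes V: "smooth_on E V" and x: "x1 \<in> E" "x2 \<in> E" "x1 < x2" and K: "K \<noteq> 0"
    and U: "deriv (effective_potential f V K) x1 \<le> 0" "deriv (effective_potential f V K) x2 \<ge> 0"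
      "deriv (effective_potential f V K) x1 \<noteq> 0 \<or> deriv (effective_potential f V K) x2 \<noteq> 0"
  shows "\<exists>r0 K0. strongly_stable a b f V r0 K0"
proof -
  \<comment> \<open>Where positive, \<open>g r\<close> is the squared momentum of the circular orbit
    at \<open>r\<close>.\<close>
  define g where "g r = - \<xi>\<^sup>2 * D V r / w r" for r
  note DV = smooth_D_E[OF V]
  have sg: "smooth_on E g" unfolding g_def
    by (intro smooth_on_divide smooth_on_mult smooth_on_const DV smooth_w open_einterval) (use w_pos in force)
  have Dg: "deriv g r = - \<sigma> * (\<xi>\<^sup>2 / (f r))\<^sup>2 * (w r * D (D V) r - D V r) / (w r)\<^sup>2" if r: "r \<in> E" for r
  proof -
    note wp = w_pos[OF r]
    have "(g has_real_derivative (- \<xi>\<^sup>2 * (\<sigma> * \<xi>\<^sup>2 / (f r)\<^sup>2 * D (D V) r) * w r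
        - (- \<xi>\<^sup>2 * D V r) * (\<sigma> * \<xi>\<^sup>2 / (f r)\<^sup>2)) / (w r * w r)) (at r)"
      unfolding g_def
      by (rule DERIV_divide[OF DERIV_cmult[OF D_DERIV[OF r DV r]] w_DERIV[OF r]]) (use wp in simp)
    also have "(- \<xi>\<^sup>2 * (\<sigma> * \<xi>\<^sup>2 / (f r)\<^sup>2 * D (D V) r) * w r
        - (- \<xi>\<^sup>2 * D V r) * (\<sigma> * \<xi>\<^sup>2 / (f r)\<^sup>2)) = - \<sigma> * (\<xi>\<^sup>2 / (f r))\<^sup>2 * (w r * D (D V) r - D V r)"
      using f_pos[OF r] by (simp add: field_simps power2_eq_square)
    finally show ?thesis by (simp add: DERIV_imp_deriv power2_eq_square)
  qed
  have dU: "deriv (effective_potential f V K) r = \<sigma> * w r / (f r)\<^sup>2 * (K\<^sup>2 - g r)" if r: "r \<in> E" for r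
    using w_pos[OF r] \<xi>_pos f_pos[OF r]
    unfolding deriv_D[OF r] D_effective_potential[OF V r] g_def by (simp add: field_simps)
  have sgnU: "sgn (deriv (effective_potential f V K) r) = \<sigma> * sgn (K\<^sup>2 - g r)" if r: "r \<in> E" for r
    using w_pos[OF r] f_pos[OF r] \<sigma> unfolding dU[OF r] by (auto simp: sgn_mult)
  have K2: "K\<^sup>2 > 0" using K by simp
  have seg: "z \<in> E" if "x1 \<le> z" "z \<le> x2" for z
    by (rule E_between[OF x(1,2) that])
  have "\<exists>z\<in>E. g z > 0 \<and> \<sigma> * deriv g z < 0"
    using \<sigma>
  proof
    assume s: "\<sigma> = 1"
    have gx: "g x1 \<ge> K\<^sup>2" "g x2 \<le> K\<^sup>2" "g x1 \<noteq> K\<^sup>2 \<or> g x2 \<noteq> K\<^sup>2"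
      using sgnU[OF x(1)] sgnU[OF x(2)] U s by (auto simp: sgn_if split: if_splits)
    \<comment> \<open>The level is cut off at 0 before averaging, so that it is positive and
      \<open>g > k\<close> guarantees a real nonzero momentum.\<close>
    define k where "k = (g x1 + max 0 (g x2)) / 2"
    have k: "g x1 > k" "g x2 \<le> k" "k > 0" using gx less_le_trans[OF K2 gx(1)] by (auto simp: k_def max_def)
    obtain z where "x1 < z" "z < x2" "g z > k" "deriv g z < 0"
      using descending_point[of x1 x2 g "deriv g" k] smooth_on_DERIV[OF sg seg] x(3) k(1,2) by (metis less_imp_le order_refl)
    then show ?thesis using seg[of z] s k(3) by (intro bexI[of _ z]) auto
  next
    assume s: "\<sigma> = - 1"
    have gx: "g x2 \<ge> K\<^sup>2" "g x1 \<le> K\<^sup>2" "g x1 \<noteq> K\<^sup>2 \<or> g x2 \<noteq> K\<^sup>2"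
      using sgnU[OF x(1)] sgnU[OF x(2)] U s by (auto simp: sgn_if split: if_splits)
    define k where "k = (g x2 + max 0 (g x1)) / 2"
    have k: "g (- (- x2)) > k" "g (- (- x1)) \<le> k" "k > 0" using gx less_le_trans[OF K2 gx(1)] by (auto simp: k_def max_def)
    have d: "((\<lambda>x. g (- x)) has_real_derivative - deriv g (- x)) (at x)" if "- x2 \<le> x" "x \<le> - x1" for x
      using DERIV_mirror[THEN iffD1, OF smooth_on_DERIV[OF sg seg[of "- x"]]] that by simp
    obtain z where "- x2 < z" "z < - x1" "g (- z) > k" "- deriv g (- z) < 0"
      using descending_point[of "- x2" "- x1" "\<lambda>x. g (- x)" "\<lambda>x. - deriv g (- x)" k, OF _ d k(1,2)] x(3)
      by (metis less_imp_le neg_less_iff_less order_refl)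
    then show ?thesis using seg[of "- z"] s k(3) by (intro bexI[of _ "- z"]) auto
  qed
  then obtain z where z: "z \<in> E" "g z > 0" "\<sigma> * deriv g z < 0" by blast
  note wp = w_pos[OF z(1)]
  have "D V z < 0"
  proof (rule ccontr)
    assume "\<not> D V z < 0"
    then have "g z \<le> 0" using wp by (simp add: g_def divide_nonpos_pos)
    then show False using z(2) by linarith
  qed
  moreover have "w z * D (D V) z - D V z > 0"
  proof (rule ccontr)
    assume "\<not> w z * D (D V) z - D V z > 0"
    moreover have "\<sigma> * deriv g z = - ((\<xi>\<^sup>2 / (f z))\<^sup>2 * (w z * D (D V) z - D V z) / (w z)\<^sup>2)"
      unfolding Dg[OF z(1)] using \<sigma> by auto
    ultimately have "\<sigma> * deriv g z \<ge> 0" by (simp add: divide_nonpos_nonneg mult_nonneg_nonpos)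
    then show False using z(3) by simp
  qed
  ultimately show ?thesis using strongly_stable_beta(1)[OF V z(1)] by blast
qed

lemma cond_exists_imp_strongly_stable:
  assumes "smooth_on E V" "nonsingular_bounded a b f V I r \<phi> K" "\<not> circular I r \<phi>"
  shows "cond_exists_loc a b f V"
  unfolding cond_exists_loc_def
  using noncircular_bounded_turning[OF assms] turning_imp_strongly_stable[OF assms(1)]
    nonsingular_boundedD(2)[OF assms(1,2)] by (metis less_imp_le less_irrefl)

end

section \<open>Orbital stability\<close>

text \<open>The two cases treat times after and before \<open>t0\<close>:
  \<open>W * exp (- C * t)\<close> is nonincreasing and \<open>W * exp (C * t)\<close> is
  nondecreasing.\<close>

lemma gronwall_zero:
  fixes W :: "real \<Rightarrow> real"
  assumes I: "convex I" "t0 \<in> I" "t \<in> I"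
    and W: "\<And>x. x \<in> I \<Longrightarrow> (W has_real_derivative W' x) (at x)"
      "\<And>x. x \<in> I \<Longrightarrow> \<bar>W' x\<bar> \<le> C * W x" "W t0 = 0"
  shows "W t \<le> 0"
proof (cases "t0 \<le> t")
  case True
  have "W t * exp (- C * t) \<le> W t0 * exp (- C * t0)"
  proof (rule DERIV_nonpos_imp_nonincreasing[OF True])
    fix x assume "t0 \<le> x" "x \<le> t"
    then have x: "x \<in> I" using I by (meson is_interval_convex_1 mem_is_interval_1_I)
    have "((\<lambda>x. W x * exp (- C * x)) has_real_derivative (W' x - C * W x) * exp (- C * x)) (at x)"
      by (auto intro!: derivative_eq_intros W(1)[OF x] simp: algebra_simps)
    moreover have "(W' x - C * W x) * exp (- C * x) \<le> 0"
      using W(2)[OF x] by (intro mult_nonpos_nonneg) auto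
    ultimately show "\<exists>y. ((\<lambda>x. W x * exp (- C * x)) has_real_derivative y) (at x) \<and> y \<le> 0" by blast
  qed
  then show ?thesis using W(3) by (simp add: mult_le_0_iff)
next
  case False
  then have le: "t \<le> t0" by simp
  have "W t * exp (C * t) \<le> W t0 * exp (C * t0)"
  proof (rule DERIV_nonneg_imp_nondecreasing[OF le])
    fix x assume "t \<le> x" "x \<le> t0"
    then have x: "x \<in> I" using I by (meson is_interval_convex_1 mem_is_interval_1_I)
    have "((\<lambda>x. W x * exp (C * x)) has_real_derivative (W' x + C * W x) * exp (C * x)) (at x)"
      by (auto intro!: derivative_eq_intros W(1)[OF x] simp: algebra_simps)
    moreover have "(W' x + C * W x) * exp (C * x) \<ge> 0"
      using W(2)[OF x] by (intro mult_nonneg_nonneg) auto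
    ultimately show "\<exists>y. ((\<lambda>x. W x * exp (C * x)) has_real_derivative y) (at x) \<and> 0 \<le> y" by blast
  qed
  then show ?thesis using W(3) by (simp add: mult_le_0_iff)
qed

context surface
begin

text \<open>On the compact radial range swept by the two motions between \<open>t0\<close> and
  \<open>t\<close>, the force is Lipschitz with constant \<open>L\<close>. The squared distance in
  the radial phase plane then satisfies Gronwall's inequality with \<open>1 + L\<close>, by
  \<open>2 * p * q \<le> p\<^sup>2 + q\<^sup>2\<close>; equal radii give equal angular
  velocities.\<close>

lemma motion_unique:
  assumes V: "smooth_on E V" and I: "convex I" "t0 \<in> I" "t \<in> I"
    and m: "motion V K I r v \<phi>" and m': "motion V K I r' v' \<phi>'"
    and init: "r t0 = r' t0" "v t0 = v' t0" "\<phi> t0 = \<phi>' t0"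
  shows "r t = r' t \<and> v t = v' t \<and> \<phi> t = \<phi>' t"
proof -
  let ?U = "effective_potential f V K"
  note sU = smooth_effective_potential[OF V, of K]
  have rv: "r t = r' t \<and> v t = v' t" if t: "t \<in> I" for t
  proof -
    define S where "S = closed_segment t0 t"
    have S: "S \<subseteq> I" "convex S" "t0 \<in> S" "t \<in> S" "compact S"
      using closed_segment_subset[OF I(2) t I(1)] by (auto simp: S_def)
    have cr: "continuous_on S r" "continuous_on S r'"
      using S(1) motionD(2)[OF m] motionD(2)[OF m']
      by (auto intro!: continuous_at_imp_continuous_on DERIV_isCont)
    define R where "R = r ` S \<union> r' ` S"
    have R: "compact R" "R \<noteq> {}" "R \<subseteq> E"
      using S cr motionD(1)[OF m] motionD(1)[OF m']
      by (auto simp: R_def intro!: compact_Un compact_continuous_image)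
    obtain x1 where x1: "x1 \<in> R" "\<forall>x\<in>R. x1 \<le> x" using compact_attains_inf[OF R(1,2)] by blast
    obtain x2 where x2: "x2 \<in> R" "\<forall>x\<in>R. x \<le> x2" using compact_attains_sup[OF R(1,2)] by blast
    have sub: "{x1..x2} \<subseteq> E"
    proof
      fix z assume "z \<in> {x1..x2}"
      then show "z \<in> E" using E_between[of x1 x2 z] x1(1) x2(1) R(3) by auto
    qed
    have "continuous_on {x1..x2} (\<lambda>x. \<bar>deriv (deriv ?U) x\<bar>)"
      by (intro continuous_on_rabs continuous_on_subset[OF
          smooth_on_continuous_on[OF smooth_on_deriv[OF smooth_on_deriv[OF sU]]] sub])
    moreover have "x1 \<in> {x1..x2}" using x1 x2 by auto
    ultimately obtain y where y: "\<forall>x\<in>{x1..x2}. \<bar>deriv (deriv ?U) x\<bar> \<le> \<bar>deriv (deriv ?U) y\<bar>"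
      using continuous_attains_sup[OF compact_Icc, of x1 x2] by blast
    define L where "L = \<bar>deriv (deriv ?U) y\<bar>"
    have Lip: "\<bar>deriv ?U p - deriv ?U q\<bar> \<le> L * \<bar>p - q\<bar>" if "p \<in> R" "q \<in> R" for p q
    proof -
      have pq: "p \<in> {x1..x2}" "q \<in> {x1..x2}" using that x1(2) x2(2) by auto
      have d: "(deriv ?U has_real_derivative deriv (deriv ?U) z) (at z within {x1..x2})"
        if "z \<in> {x1..x2}" for z
        by (rule has_field_derivative_at_within[OF
              smooth_on_DERIV[OF smooth_on_deriv[OF sU] subsetD[OF sub that]]])
      have "norm (deriv ?U p - deriv ?U q) \<le> L * norm (p - q)"
        by (rule field_differentiable_bound[OF _ d _ pq]) (use y in \<open>auto simp: L_def\<close>)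
      then show ?thesis by simp
    qed
    define W where "W t = (r t - r' t)\<^sup>2 + (v t - v' t)\<^sup>2" for t
    define W' where "W' t = 2 * (r t - r' t) * (v t - v' t)
      - 2 * (v t - v' t) * (deriv ?U (r t) - deriv ?U (r' t))" for t
    have "W t \<le> 0"
    proof (rule gronwall_zero[of S t0 t W W' "1 + L"])
      fix x assume x: "x \<in> S"
      then have xI: "x \<in> I" using S(1) by blast
      show "(W has_real_derivative W' x) (at x)"
        unfolding W_def W'_def
        by (auto intro!: derivative_eq_intros motionD(2,3)[OF m xI] motionD(2,3)[OF m' xI]
            simp: algebra_simps)
      define p where "p = \<bar>r x - r' x\<bar>"
      define q where "q = \<bar>v x - v' x\<bar>"
      define h where "h = \<bar>deriv ?U (r x) - deriv ?U (r' x)\<bar>"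
      have h: "h \<le> L * p" unfolding h_def p_def by (rule Lip) (use x in \<open>auto simp: R_def\<close>)
      have "\<bar>W' x\<bar> \<le> \<bar>2 * (r x - r' x) * (v x - v' x)\<bar>
          + \<bar>2 * (v x - v' x) * (deriv ?U (r x) - deriv ?U (r' x))\<bar>"
        unfolding W'_def by (rule abs_triangle_ineq4)
      also have "\<dots> = 2 * p * q + 2 * q * h" unfolding p_def q_def h_def abs_mult by simp
      also have "\<dots> \<le> 2 * p * q + 2 * q * (L * p)"
        using h by (intro add_left_mono mult_left_mono) (auto simp: q_def)
      also have "\<dots> = (1 + L) * (2 * p * q)" by (simp add: algebra_simps)
      also have "\<dots> \<le> (1 + L) * (p\<^sup>2 + q\<^sup>2)"
        by (intro mult_left_mono sum_squares_bound) (simp add: L_def)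
      also have "p\<^sup>2 + q\<^sup>2 = W x" by (simp add: p_def q_def W_def)
      finally show "\<bar>W' x\<bar> \<le> (1 + L) * W x" .
    qed (use S init in \<open>auto simp: W_def\<close>)
    then have "(r t - r' t)\<^sup>2 + (v t - v' t)\<^sup>2 = 0"
      unfolding W_def by (smt (verit) zero_le_power2)
    then show ?thesis by (simp add: sum_power2_eq_zero_iff)
  qed
  have "((\<lambda>t. \<phi> t - \<phi>' t) has_real_derivative 0) (at x)" if x: "x \<in> I" for x
    using DERIV_diff[OF motionD(4)[OF m x] motionD(4)[OF m' x]] rv[OF x] by simp
  then have "\<phi> t - \<phi>' t = \<phi> t0 - \<phi>' t0"
    by (rule DERIV_0_const_interval[OF I(1) _ I(3,2)])
  then show ?thesis using rv[OF I(3)] init(3) by simp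
qed

end

section \<open>Phase circles: stability at a minimum, instability at a maximum\<close>

lemma polar_coordinates:
  fixes x y :: real
  obtains \<alpha> where "x = sqrt (x\<^sup>2 + y\<^sup>2) * sin \<alpha>" "y = sqrt (x\<^sup>2 + y\<^sup>2) * cos \<alpha>"
proof
  let ?z = "Complex y x"
  have n: "cmod ?z = sqrt (x\<^sup>2 + y\<^sup>2)" by (simp add: cmod_def add.commute)
  show "x = sqrt (x\<^sup>2 + y\<^sup>2) * sin (Arg ?z)" "y = sqrt (x\<^sup>2 + y\<^sup>2) * cos (Arg ?z)"
    using rcis_cmod_Arg[of ?z] n by (metis Im_rcis complex.sel(2), metis Re_rcis complex.sel(1))
qed

text \<open>Compared with the point of the phase circle at the same angle; the angle itself
  contributes no distance.\<close>

lemma infdist_phase_circle_le: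
  "infdist (phase_point r \<phi> t) (circle r0 \<times> {(0, \<omega>)}) \<le> \<bar>r t - r0\<bar> + \<bar>deriv r t\<bar> + \<bar>deriv \<phi> t - \<omega>\<bar>"
proof -
  have "(r0, cis (\<phi> t)) \<in> circle r0" by (simp add: circle_def)
  then have "infdist (phase_point r \<phi> t) (circle r0 \<times> {(0, \<omega>)})
      \<le> dist (phase_point r \<phi> t) ((r0, cis (\<phi> t)), (0, \<omega>))"
    by (intro infdist_le) auto
  also have "\<dots> = sqrt (\<bar>r t - r0\<bar>\<^sup>2 + (sqrt (\<bar>deriv r t\<bar>\<^sup>2 + \<bar>deriv \<phi> t - \<omega>\<bar>\<^sup>2))\<^sup>2)"
    by (simp add: phase_point_def dist_Pair_Pair dist_real_def)
  also have "\<dots> \<le> \<bar>r t - r0\<bar> + sqrt (\<bar>deriv r t\<bar>\<^sup>2 + \<bar>deriv \<phi> t - \<omega>\<bar>\<^sup>2)"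
    by (rule sqrt_sum_squares_le_sum) auto
  also have "\<dots> \<le> \<bar>r t - r0\<bar> + (\<bar>deriv r t\<bar> + \<bar>deriv \<phi> t - \<omega>\<bar>)"
    by (intro add_left_mono sqrt_sum_squares_le_sum) auto
  finally show ?thesis by simp
qed

lemma infdist_phase_circle_less:
  assumes "infdist (phase_point r \<phi> t) (circle r0 \<times> {(0, \<omega>)}) < \<delta>"
  shows "\<bar>r t - r0\<bar> < \<delta>" "\<bar>deriv r t\<bar> < \<delta>"
proof -
  have ne: "circle r0 \<times> {(0 :: real, \<omega>)} \<noteq> {}" by (auto simp: circle_def intro!: exI[of _ 1])
  have "\<exists>p\<in>circle r0 \<times> {(0, \<omega>)}. dist (phase_point r \<phi> t) p < \<delta>"
    using assms unfolding infdist_notempty[OF ne] by (subst (asm) cINF_less_iff[OF ne]) (auto intro!: bdd_belowI[of _ 0])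
  then obtain z where z: "dist (phase_point r \<phi> t) ((r0, z), (0, \<omega>)) < \<delta>" by (auto simp: circle_def)
  have "dist (fst (fst (phase_point r \<phi> t))) (fst (fst ((r0, z), (0 :: real, \<omega>)))) < \<delta>"
    "dist (fst (snd (phase_point r \<phi> t))) (fst (snd ((r0, z), (0 :: real, \<omega>)))) < \<delta>"
    using z dist_fst_le dist_snd_le by (meson le_less_trans)+
  then show "\<bar>r t - r0\<bar> < \<delta>" "\<bar>deriv r t\<bar> < \<delta>" by (simp_all add: phase_point_def dist_real_def)
qed

context well
begin

text \<open>In the plane of \<open>s\<close> and \<open>r'\<close> the initial state lies on a
  circle of radius \<rho> < l. The explicit oscillation through it agrees with the trajectory by
  uniqueness and exists for all times, so maximality gives \<open>J = UNIV\<close>, and \<rho>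
  bounds the radial velocity.\<close>

lemma trajectory_near_minimum:
  assumes tr: "trajectory a b f V J r \<phi>" and mom: "has_momentum f J r \<phi> K" and J: "0 \<in> J"
    and r0: "r 0 \<in> N" and small0: "sqrt ((s (r 0))\<^sup>2 + (deriv r 0)\<^sup>2) < l"
  shows "J = UNIV" "r t \<in> N" "\<bar>deriv r t\<bar> \<le> sqrt ((s (r 0))\<^sup>2 + (deriv r 0)\<^sup>2)"
proof -
  define \<rho> where "\<rho> = sqrt ((s (r 0))\<^sup>2 + (deriv r 0)\<^sup>2)"
  have \<rho>: "\<bar>\<rho>\<bar> < l" "\<rho> \<ge> 0" using small0 by (auto simp: \<rho>_def)
  obtain \<alpha>0 where \<alpha>0: "s (r 0) = \<rho> * sin \<alpha>0" "deriv r 0 = \<rho> * cos \<alpha>0"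
    unfolding \<rho>_def by (rule polar_coordinates)
  have sol: "solution_on a b f V J r \<phi>" using tr by (simp add: trajectory_def)
  then have Jp: "open J" "convex J" by (auto simp: solution_on_def is_interval_convex_1)
  note mo = solution_imp_motion[OF V sol mom]
  have "J = UNIV \<and> r t \<in> N \<and> \<bar>deriv r t\<bar> \<le> \<rho>"
  proof (rule oscillation[OF \<rho>(1), of 0 \<alpha>0 "\<phi> 0"])
    fix \<alpha> \<phi>' assume \<alpha>: "\<alpha> 0 = \<alpha>0" and \<phi>': "\<phi>' 0 = \<phi> 0"
      and mo': "motion V K UNIV (\<lambda>t. X (\<rho> * sin (\<alpha> t))) (\<lambda>t. \<rho> * cos (\<alpha> t)) \<phi>'"
    have "motion V K J (\<lambda>t. X (\<rho> * sin (\<alpha> t))) (\<lambda>t. \<rho> * cos (\<alpha> t)) \<phi>'"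
      using mo' by (simp add: motion_def)
    then have eq: "r t = X (\<rho> * sin (\<alpha> t)) \<and> deriv r t = \<rho> * cos (\<alpha> t) \<and> \<phi> t = \<phi>' t" if "t \<in> J" for t
      by (rule motion_unique[OF V Jp(2) J that mo]) (use \<alpha> \<phi>' \<alpha>0 X_s[OF r0] in auto)
    have sol': "solution_on a b f V UNIV (\<lambda>t. X (\<rho> * sin (\<alpha> t))) \<phi>'"
      by (rule motion_imp_solution(1)[OF V _ _ _ mo']) auto
    have "UNIV = J"
      by (rule tr[unfolded trajectory_def, THEN conjunct2, rule_format, of _ "\<lambda>t. X (\<rho> * sin (\<alpha> t))" \<phi>'])
        (use sol' eq in auto)
    then have UN: "J = UNIV" by simp
    have "\<bar>\<rho> * cos (\<alpha> t)\<bar> \<le> \<rho>"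
      using mult_left_mono[OF abs_cos_le_one[of "\<alpha> t"] \<rho>(2)] \<rho>(2) by (simp add: abs_mult)
    then show ?thesis using UN eq[of t] X_N[OF small[OF \<rho>(1)]] by simp
  qed
  then show "J = UNIV" "r t \<in> N" "\<bar>deriv r t\<bar> \<le> sqrt ((s (r 0))\<^sup>2 + (deriv r 0)\<^sup>2)"
    by (simp_all add: \<rho>_def)
qed

end

context surface
begin

text \<open>The bound \<epsilon> is split into thirds: a small well confines the radius, a small
  amplitude bounds the radial velocity, and continuity of \<omega> controls the angular velocity,
  which at fixed momentum depends on the radius alone.\<close>

lemma strongly_stable_imp_orbitally_stable:
  assumes V: "smooth_on E V" and st: "strongly_stable a b f V r0 K"
  shows "orbitally_stable_circular a b f V r0 K"
proof -
  have r0: "r0 \<in> E" and K: "K \<noteq> 0" and U': "deriv (effective_potential f V K) r0 = 0"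
    using st by (auto simp: strongly_stable_iff[OF V])
  define \<phi>0 where "\<phi>0 = (\<lambda>t. K / (f r0)\<^sup>2 * t)"
  have ct: "circular_trajectory a b f V r0 K UNIV (\<lambda>_. r0) \<phi>0"
    unfolding \<phi>0_def by (rule circular_motion[OF V r0 U' K])
  define \<omega> where "\<omega> x = K / (f x)\<^sup>2" for x
  have ph: "phase_point (\<lambda>_. r0) \<phi>0 ` UNIV = circle r0 \<times> {(0, \<omega> r0)}"
    unfolding \<omega>_def by (rule circular_trajectoryD(4)[OF V ct])
  have "isCont \<omega> r0"
    unfolding \<omega>_def using smooth_on_isCont[OF smooth_f r0] f_pos[OF r0] by (intro continuous_intros) auto
  have stable: "\<exists>\<delta>>0. \<forall>J r \<phi>. trajectory a b f V J r \<phi> \<and> has_momentum f J r \<phi> K \<and> 0 \<in> J \<and>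
      infdist (phase_point r \<phi> 0) (circle r0 \<times> {(0, \<omega> r0)}) < \<delta> \<longrightarrow>
      {0..} \<subseteq> J \<and> (\<forall>t\<ge>0. infdist (phase_point r \<phi> t) (circle r0 \<times> {(0, \<omega> r0)}) < \<epsilon>)"
    if \<epsilon>: "\<epsilon> > 0" for \<epsilon>
  proof -
    obtain d where d: "d > 0" "\<And>x. \<bar>x - r0\<bar> < d \<Longrightarrow> \<bar>\<omega> x - \<omega> r0\<bar> < \<epsilon> / 3"
      using \<open>isCont \<omega> r0\<close> \<epsilon> by (force simp: continuous_at_eps_delta dist_real_def dest: spec[of _ "\<epsilon> / 3"])
    define e where "e = min d (\<epsilon> / 3)"
    have e: "e > 0" "e \<le> d" "e \<le> \<epsilon> / 3" using d(1) \<epsilon> by (auto simp: e_def)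
    obtain N s l where W: "well a b f \<xi> \<sigma> V K r0 N s l" and Ne: "N \<subseteq> ball r0 e"
      using strongly_stable_well[OF V st e(1)] by blast
    interpret well a b f \<xi> \<sigma> V K r0 N s l by (fact W)
    define q where "q = min l (\<epsilon> / 3)"
    have q: "q > 0" "q \<le> l" "q \<le> \<epsilon> / 3" using l(1) \<epsilon> by (auto simp: q_def)
    obtain d1 where d1: "d1 > 0" "ball r0 d1 \<subseteq> N" using N(1,4) open_contains_ball by blast
    have "isCont s r0" by (rule smooth_on_isCont[OF s(1) N(4)])
    then obtain d2 where d2: "d2 > 0" "\<And>x. \<bar>x - r0\<bar> < d2 \<Longrightarrow> \<bar>s x\<bar> < q / 2"
      using q(1) by (force simp: continuous_at_eps_delta dist_real_def s(2) dest: spec[of _ "q / 2"])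
    define \<delta> where "\<delta> = min (min d1 d2) (q / 2)"
    have \<delta>: "\<delta> > 0" "\<delta> \<le> d1" "\<delta> \<le> d2" "\<delta> \<le> q / 2" using d1 d2 q by (auto simp: \<delta>_def)
    show ?thesis
    proof (intro exI[of _ \<delta>] conjI allI impI \<delta>(1))
      fix J r \<phi>
      assume *: "trajectory a b f V J r \<phi> \<and> has_momentum f J r \<phi> K \<and> 0 \<in> J \<and>
        infdist (phase_point r \<phi> 0) (circle r0 \<times> {(0, \<omega> r0)}) < \<delta>"
      note near = infdist_phase_circle_less[OF *[THEN conjunct2, THEN conjunct2, THEN conjunct2]]
      have rN: "r 0 \<in> N" using near(1) \<delta>(2) d1(2) by (auto simp: subset_iff dist_real_def abs_minus_commute)
      have "sqrt ((s (r 0))\<^sup>2 + (deriv r 0)\<^sup>2) \<le> \<bar>s (r 0)\<bar> + \<bar>deriv r 0\<bar>"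
        using sqrt_sum_squares_le_sum_abs by blast
      also have "\<dots> < q" using d2(2)[of "r 0"] near \<delta> by linarith
      finally have sm: "sqrt ((s (r 0))\<^sup>2 + (deriv r 0)\<^sup>2) < q" .
      note tr = trajectory_near_minimum[OF *[THEN conjunct1] *[THEN conjunct2, THEN conjunct1]
          *[THEN conjunct2, THEN conjunct2, THEN conjunct1] rN less_le_trans[OF sm q(2)]]
      show "{0..} \<subseteq> J" using tr(1) by simp
      fix t :: real
      have rt: "\<bar>r t - r0\<bar> < e" using subsetD[OF Ne tr(2), of t] by (simp add: dist_real_def abs_minus_commute)
      have sol: "solution_on a b f V J r \<phi>" using * by (simp add: trajectory_def)
      have "deriv \<phi> t = \<omega> (r t)"
        using DERIV_imp_deriv[OF motionD(4)[OF solution_imp_motion[OF V sol, of K], of t]] * tr(1)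
        by (simp add: \<omega>_def)
      then have "\<bar>deriv \<phi> t - \<omega> r0\<bar> < \<epsilon> / 3" using d(2)[of "r t"] rt e(2) by simp
      then show "infdist (phase_point r \<phi> t) (circle r0 \<times> {(0, \<omega> r0)}) < \<epsilon>"
        using infdist_phase_circle_le[of r \<phi> t r0 "\<omega> r0"] rt e(3) tr(3)[of t] sm q(3) by linarith
    qed
  qed
  have "orbitally_stable a b f V UNIV (\<lambda>_. r0) \<phi>0"
    unfolding orbitally_stable_def ph
    using stable ct by (intro exI[of _ K]) (auto simp: circular_trajectory_def)
  then show ?thesis using ct unfolding orbitally_stable_circular_def by blast
qed

text \<open>If the effective potential has its maximum at \<open>r0\<close>, the motion through \<open>r0\<close> with radial speed
  \<open>\<eta>\<close> never slows down below \<open>\<eta>\<close>.\<close>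

lemma maximum_not_orbitally_stable:
  assumes V: "smooth_on E V" and r0: "r0 \<in> E"
    and max: "\<And>r. r \<in> E \<Longrightarrow> effective_potential f V K r \<le> effective_potential f V K r0"
  shows "\<not> orbitally_stable_circular a b f V r0 K"
proof
  let ?U = "effective_potential f V K"
  note sU = smooth_effective_potential[OF V, of K]
  assume "orbitally_stable_circular a b f V r0 K"
  then obtain I r\<^sub>c \<phi>\<^sub>c where ct: "circular_trajectory a b f V r0 K I r\<^sub>c \<phi>\<^sub>c"
    and st: "orbitally_stable a b f V I r\<^sub>c \<phi>\<^sub>c" by (auto simp: orbitally_stable_circular_def)
  have I: "I \<noteq> {}" using ct by (auto simp: circular_trajectory_def trajectory_def solution_on_def)
  define \<omega> where "\<omega> = K / (f r0)\<^sup>2"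
  have ph: "phase_point r\<^sub>c \<phi>\<^sub>c ` I = circle r0 \<times> {(0, \<omega>)}"
    unfolding \<omega>_def by (rule circular_trajectoryD(4)[OF V ct])
  obtain K' where K': "has_momentum f I r\<^sub>c \<phi>\<^sub>c K'" and
    st': "\<forall>\<epsilon>>0. \<exists>\<delta>>0. \<forall>J r \<phi>. trajectory a b f V J r \<phi> \<and> has_momentum f J r \<phi> K' \<and> 0 \<in> J \<and>
      infdist (phase_point r \<phi> 0) (circle r0 \<times> {(0, \<omega>)}) < \<delta> \<longrightarrow>
      {0..} \<subseteq> J \<and> (\<forall>t\<ge>0. infdist (phase_point r \<phi> t) (circle r0 \<times> {(0, \<omega>)}) < \<epsilon>)"
    using st unfolding orbitally_stable_def ph by blast
  have KK: "K' = K" using K' ct I by (auto simp: circular_trajectory_def has_momentum_def)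
  obtain \<delta> where \<delta>: "\<delta> > 0" and st1: "\<And>J r \<phi>. trajectory a b f V J r \<phi> \<Longrightarrow> has_momentum f J r \<phi> K \<Longrightarrow> 0 \<in> J \<Longrightarrow>
      infdist (phase_point r \<phi> 0) (circle r0 \<times> {(0, \<omega>)}) < \<delta> \<Longrightarrow>
      {0..} \<subseteq> J \<and> (\<forall>t\<ge>0. infdist (phase_point r \<phi> t) (circle r0 \<times> {(0, \<omega>)}) < 1)"
    using st'[rule_format, of 1] unfolding KK by auto
  define \<eta> where "\<eta> = \<delta> / 2"
  have \<eta>: "\<eta> > 0" "\<eta> < \<delta>" using \<delta> by (auto simp: \<eta>_def)
  \<comment> \<open>The radial speed at radius \<open>x\<close> given by energy conservation for the
    motion that crosses \<open>r0\<close> with speed \<eta>. Maximality at \<open>r0\<close> keeps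
    the radicand at least \<open>\<eta>\<^sup>2\<close> throughout \<open>E\<close>, so this motion
    never turns back.\<close>
  define q where "q x = sqrt (\<eta>\<^sup>2 + 2 * (?U r0 - ?U x))" for x
  have q2: "\<eta>\<^sup>2 + 2 * (?U r0 - ?U x) \<ge> \<eta>\<^sup>2" if "x \<in> E" for x using max[OF that] by simp
  have q_ge: "q x \<ge> \<eta>" if "x \<in> E" for x
    unfolding q_def using real_sqrt_le_mono[OF q2[OF that]] \<eta>(1) by simp
  have q_pos: "q x > 0" if "x \<in> E" for x using q_ge[OF that] \<eta>(1) by simp
  have q_DERIV: "(q has_real_derivative - deriv ?U x / q x) (at x)" if x: "x \<in> E" for x
  proof -
    have p: "\<eta>\<^sup>2 + 2 * (?U r0 - ?U x) > 0" using q2[OF x] \<eta>(1) by (smt (verit) zero_less_power2)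
    have "((\<lambda>x. \<eta>\<^sup>2 + 2 * (?U r0 - ?U x)) has_real_derivative 2 * - deriv ?U x) (at x)"
      by (auto intro!: derivative_eq_intros smooth_on_DERIV[OF sU x])
    then have "((\<lambda>x. sqrt (\<eta>\<^sup>2 + 2 * (?U r0 - ?U x))) has_real_derivative
        inverse (sqrt (\<eta>\<^sup>2 + 2 * (?U r0 - ?U x))) / 2 * (2 * - deriv ?U x)) (at x)"
      by (rule DERIV_chain2[where f = sqrt, rotated]) (rule DERIV_real_sqrt[OF p])
    moreover have "inverse c / 2 * (2 * - u) = - u / c" for c u :: real
      by (cases "c = 0") (simp_all add: field_simps)
    ultimately show ?thesis unfolding q_def by (simp only:)
  qed
  have cq: "isCont q x" if "x \<in> E" for x by (rule DERIV_isCont[OF q_DERIV[OF that]])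
  have "isCont (\<lambda>x. 1 / q x) x" if "x \<in> E" for x
    using cq[OF that] q_pos[OF that] by (intro continuous_intros) auto
  then obtain \<tau>0 where \<tau>0: "\<And>x. x \<in> E \<Longrightarrow> (\<tau>0 has_real_derivative 1 / q x) (at x)"
    using antiderivative_exists[OF ab, of "\<lambda>x. 1 / q x"] by blast
  \<comment> \<open>Time elapsed on the way from \<open>r0\<close> to \<open>x\<close>; its inverse
    \<open>R\<close> is the radius as a function of time.\<close>
  define \<tau> where "\<tau> x = \<tau>0 x - \<tau>0 r0" for x
  have \<tau>: "(\<tau> has_real_derivative 1 / q x) (at x)" if "x \<in> E" for x
    unfolding \<tau>_def using \<tau>0[OF that] by (auto intro!: derivative_eq_intros)
  have "isCont (\<lambda>x. K / (f x)\<^sup>2 / q x) x" if "x \<in> E" for x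
    using cq[OF that] q_pos[OF that] smooth_on_isCont[OF smooth_f that] f_pos[OF that]
    by (intro continuous_intros) auto
  then obtain \<Psi> where \<Psi>: "\<And>x. x \<in> E \<Longrightarrow> (\<Psi> has_real_derivative K / (f x)\<^sup>2 / q x) (at x)"
    using antiderivative_exists[OF ab, of "\<lambda>x. K / (f x)\<^sup>2 / q x"] by blast
  define R where "R = inv_into E \<tau>"
  define J where "J = \<tau> ` E"
  have q_inv: "1 / q x > 0" if "x \<in> E" for x using q_pos[OF that] by simp
  have inv_J: "open J" "convex J" and R_\<tau>: "\<And>x. x \<in> E \<Longrightarrow> R (\<tau> x) = x"
    and R_E: "\<And>t. t \<in> J \<Longrightarrow> R t \<in> E" and \<tau>_R: "\<And>t. t \<in> J \<Longrightarrow> \<tau> (R t) = t"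
    and dR: "\<And>t. t \<in> J \<Longrightarrow> (R has_real_derivative q (R t)) (at t)"
    using interval_inverse[OF open_einterval E_convex \<tau> q_inv] unfolding R_def J_def by simp_all
  have J0: "0 \<in> J" and R0: "R 0 = r0" using r0 R_\<tau>[OF r0] by (auto simp: J_def \<tau>_def image_iff)
  have mo: "motion V K J R (\<lambda>t. q (R t)) (\<lambda>t. \<Psi> (R t))"
    unfolding motion_def
  proof (intro ballI conjI)
    fix t assume t: "t \<in> J"
    note RE = R_E[OF t]
    show "R t \<in> E" "(R has_real_derivative q (R t)) (at t)" by (fact RE dR[OF t])+
    show "((\<lambda>t. q (R t)) has_real_derivative - deriv ?U (R t)) (at t)"
      using DERIV_chain2[OF q_DERIV[OF RE] dR[OF t]] q_pos[OF RE] by simp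
    show "((\<lambda>t. \<Psi> (R t)) has_real_derivative K / (f (R t))\<^sup>2) (at t)"
      using DERIV_chain2[OF \<Psi>[OF RE] dR[OF t]] q_pos[OF RE] by simp
  qed
  have Jint: "is_interval J" using inv_J(2) by (simp add: is_interval_convex_1)
  have Jne: "J \<noteq> {}" using J0 by blast
  note sol = motion_imp_solution[OF V inv_J(1) Jint Jne mo]
  have traj: "trajectory a b f V J R (\<lambda>t. \<Psi> (R t))"
    unfolding trajectory_def
  proof (intro conjI allI impI sol(1))
    fix J' r' \<phi>'
    assume *: "solution_on a b f V J' r' \<phi>' \<and> J \<subseteq> J' \<and> (\<forall>t\<in>J. r' t = R t \<and> \<phi>' t = \<Psi> (R t))"
    have J': "open J'" "is_interval J'" and r': "\<And>t. t \<in> J' \<Longrightarrow> r' t \<in> E"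
      "\<And>t. t \<in> J' \<Longrightarrow> isCont r' t"
      using * by (auto simp: solution_on_def differentiable_imp_continuous_within)
    \<comment> \<open>The times at which an extension still obeys \<open>\<tau> (r' t) = t\<close>
      are exactly those in \<open>J\<close>, because \<open>J\<close> is the full image of \<tau>.
      So \<open>J\<close> is open and closed in the connected \<open>J'\<close>.\<close>
    have JZ: "J = {t \<in> J'. \<tau> (r' t) - t = 0}"
    proof
      show "J \<subseteq> {t \<in> J'. \<tau> (r' t) - t = 0}" using * \<tau>_R by auto
      show "{t \<in> J'. \<tau> (r' t) - t = 0} \<subseteq> J" using r'(1) by (force simp: J_def)
    qed
    have "continuous_on J' (\<lambda>t. \<tau> (r' t) - t)"
      by (intro continuous_at_imp_continuous_on ballI continuous_diff continuous_ident
          isCont_o2[OF r'(2) DERIV_isCont[OF \<tau>[OF r'(1)]]])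
    then have "closedin (top_of_set J') J"
      unfolding JZ by (rule continuous_closedin_preimage_constant)
    moreover have "openin (top_of_set J') J" using * inv_J(1) by (intro open_subset) auto
    moreover have "connected J'" using J'(2) by (simp add: is_interval_connected)
    ultimately show "J' = J" using J0 unfolding connected_clopen by blast
  qed
  have d0: "deriv (\<lambda>t. \<Psi> (R t)) 0 = \<omega>"
    using DERIV_imp_deriv[OF motionD(4)[OF mo J0]] by (simp add: \<omega>_def R0)
  have "q r0 = \<eta>" using \<eta>(1) by (simp add: q_def)
  then have "infdist (phase_point R (\<lambda>t. \<Psi> (R t)) 0) (circle r0 \<times> {(0, \<omega>)}) < \<delta>"
    using infdist_phase_circle_le[of R "\<lambda>t. \<Psi> (R t)" 0 r0 \<omega>] \<eta> sol(3)[OF J0] by (simp add: R0 d0)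
  then have far: "{0..} \<subseteq> J" "\<And>t. t \<ge> 0 \<Longrightarrow> infdist (phase_point R (\<lambda>t. \<Psi> (R t)) t) (circle r0 \<times> {(0, \<omega>)}) < 1"
    using st1[OF traj sol(2) J0] by auto
  \<comment> \<open>At speed at least \<eta>, the radius moves by at least 1 in time 1 / \<eta>,
    which violates stability for \<epsilon> = 1.\<close>
  obtain z where z: "0 < z" "z < 1 / \<eta>" "R (1 / \<eta>) - R 0 = (1 / \<eta> - 0) * q (R z)"
    using MVT2[of 0 "1 / \<eta>" R "\<lambda>t. q (R t)"] dR far(1) \<eta>(1) by force
  have "z \<in> J" using far(1) z(1) by auto
  then have "q (R z) \<ge> \<eta>" by (intro q_ge R_E)
  then have "1 / \<eta> * q (R z) \<ge> 1" using \<eta>(1) by (simp add: field_simps)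
  then have "R (1 / \<eta>) - r0 \<ge> 1" using z(3) by (simp add: R0)
  moreover have "\<bar>R (1 / \<eta>) - r0\<bar> < 1"
    using infdist_phase_circle_less(1)[OF far(2)[of "1 / \<eta>"]] \<eta>(1) by simp
  ultimately show False by simp
qed

text \<open>Without a strongly stable circle, take any orbitally stable one. If the effective
  potential were higher somewhere, the mean value theorem would give a point where it rises away
  from \<open>r0\<close>; together with the critical point \<open>r0\<close> this produces a
  strongly stable circle. So \<open>r0\<close> is a global maximum, against its stability.\<close>

lemma weakly_closing_imp_locally_closing:
  assumes V: "smooth_on E V" and "weakly_closing a b f V"
  shows "locally_closing a b f V"
proof -
  have fl: "cond_forall_loc_orbital a b f V" and
    all: "\<And>r0. r0 \<in> E \<Longrightarrow> \<exists>K. orbitally_stable_circular a b f V r0 K"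
    using assms(2) by (auto simp: weakly_closing_def)
  have "cond_forall_loc a b f V"
    using fl strongly_stable_imp_orbitally_stable[OF V]
    unfolding cond_forall_loc_def cond_forall_loc_orbital_def by blast
  moreover have "cond_exists_loc a b f V"
  proof (rule ccontr)
    assume ne: "\<not> cond_exists_loc a b f V"
    obtain r0 where r0: "r0 \<in> E" using einterval_nonempty[OF ab] by blast
    obtain K where K: "orbitally_stable_circular a b f V r0 K" using all[OF r0] by blast
    let ?U = "effective_potential f V K"
    note sU = smooth_effective_potential[OF V, of K]
    have U0: "deriv ?U r0 = 0" and K0: "K \<noteq> 0"
    proof -
      obtain I r \<phi> where "circular_trajectory a b f V r0 K I r \<phi>"
        using K by (auto simp: orbitally_stable_circular_def)
      from circular_trajectoryD(2,3)[OF V this]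
      show "deriv ?U r0 = 0" "K \<noteq> 0" .
    qed
    have "?U r \<le> ?U r0" if r: "r \<in> E" for r
    proof (rule ccontr)
      assume nle: "\<not> ?U r \<le> ?U r0"
      have seg: "z \<in> E" if "min r r0 \<le> z" "z \<le> max r r0" for z
        using E_between[OF r r0, of z] E_between[OF r0 r, of z] that by (auto simp: min_def max_def split: if_splits)
      note dU = smooth_on_DERIV[OF sU]
      show False
      proof (cases "r < r0")
        case True
        obtain z where z: "r < z" "z < r0" "?U r0 - ?U r = (r0 - r) * deriv ?U z"
          using MVT2[OF True, of ?U "deriv ?U"] dU[OF seg] True by auto
        have "(r0 - r) * deriv ?U z < 0" using z(3) nle by linarith
        then have neg: "deriv ?U z < 0" using True by (simp add: mult_less_0_iff)
        have zE: "z \<in> E" using seg z True by auto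
        then show False
          using turning_imp_strongly_stable[OF V zE r0 z(2) K0] neg U0 ne by (auto simp: cond_exists_loc_def)
      next
        case False
        then have lt: "r0 < r" using nle by (cases "r = r0") auto
        obtain z where z: "r0 < z" "z < r" "?U r - ?U r0 = (r - r0) * deriv ?U z"
          using MVT2[OF lt, of ?U "deriv ?U"] dU[OF seg] lt by auto
        have "(r - r0) * deriv ?U z > 0" using z(3) nle by linarith
        then have pos: "deriv ?U z > 0" using lt by (simp add: zero_less_mult_iff)
        have zE: "z \<in> E" using seg z lt by auto
        then show False
          using turning_imp_strongly_stable[OF V r0 zE z(1) K0] pos U0 ne by (auto simp: cond_exists_loc_def)
      qed
    qed
    then show False using maximum_not_orbitally_stable[OF V r0] K by blast
  qed
  ultimately show ?thesis by (simp add: locally_closing_def)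
qed

end

section \<open>The generalized gravitational and oscillator potentials are closing\<close>

context well
begin

lemma cond_exists_near_minimum:
  assumes K: "K \<noteq> 0"
  shows "cond_exists a b f V"
proof -
  have \<rho>: "\<bar>l / 2\<bar> < l" using l(1) by simp
  show ?thesis
  proof (rule oscillation[OF \<rho>, of 0 0 0])
    fix \<alpha> \<phi> assume \<alpha>: "\<alpha> 0 = 0"
      and mo: "motion V K UNIV (\<lambda>t. X (l / 2 * sin (\<alpha> t))) (\<lambda>t. l / 2 * cos (\<alpha> t)) \<phi>"
    let ?r = "\<lambda>t. X (l / 2 * sin (\<alpha> t))"
    have "\<not> circular UNIV ?r \<phi>"
    proof
      assume "circular UNIV ?r \<phi>"
      then obtain c where "orbit UNIV ?r \<phi> = circle c" by (auto simp: circular_def)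
      then have "?r t = c" for t by (auto simp: orbit_def circle_def)
      then have "deriv ?r 0 = 0" by simp
      then show False using motion_UNIV_imp_trajectory(3)[OF V mo, of 0] l(1) by (simp add: \<alpha>)
    qed
    then show ?thesis unfolding cond_exists_def using oscillation_bounded[OF \<rho> K mo] by blast
  qed
qed

end

text \<open>In the parameter \<phi>, the vector \<open>(q, y)\<close> rotates with frequency
  \<omega>; \<open>g\<close> and \<open>h\<close> are its coordinates in the rotating frame, hence
  constant.\<close>

lemma rotation_integral:
  fixes q y \<phi> \<psi> :: "real \<Rightarrow> real"
  assumes q: "\<And>t. (q has_real_derivative \<omega> * \<psi> t * y t) (at t)"
    and y: "\<And>t. (y has_real_derivative - (\<omega> * \<psi> t * q t)) (at t)"
    and \<phi>: "\<And>t. (\<phi> has_real_derivative \<psi> t) (at t)"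
  obtains \<alpha> \<beta> where "\<And>t. q t = \<alpha> * cos (\<omega> * \<phi> t) + \<beta> * sin (\<omega> * \<phi> t)"
proof -
  define g where "g t = q t * cos (\<omega> * \<phi> t) - y t * sin (\<omega> * \<phi> t)" for t
  define h where "h t = q t * sin (\<omega> * \<phi> t) + y t * cos (\<omega> * \<phi> t)" for t
  have g: "(g has_real_derivative 0) (at t)" for t
    unfolding g_def by (auto intro!: derivative_eq_intros q y \<phi> simp: algebra_simps)
  have h: "(h has_real_derivative 0) (at t)" for t
    unfolding h_def by (auto intro!: derivative_eq_intros q y \<phi> simp: algebra_simps)
  have gh: "g t = g 0" "h t = h 0" for t
    using DERIV_0_const_interval[OF convex_UNIV g UNIV_I UNIV_I, of t 0]
      DERIV_0_const_interval[OF convex_UNIV h UNIV_I UNIV_I, of t 0] by auto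
  have "q t = g t * cos (\<omega> * \<phi> t) + h t * sin (\<omega> * \<phi> t)" for t
  proof -
    have "g t * cos (\<omega> * \<phi> t) + h t * sin (\<omega> * \<phi> t)
        = q t * ((sin (\<omega> * \<phi> t))\<^sup>2 + (cos (\<omega> * \<phi> t))\<^sup>2)"
      unfolding g_def h_def by algebra
    then show ?thesis by simp
  qed
  then show ?thesis using that gh by metis
qed

text \<open>Evaluation at the phases 0 and \<open>pi / 2\<close> says that the rotation by
  \<open>\<omega> * p\<close> fixes the nonzero vector (\<alpha>, \<beta>), so it is trivial; but
  \<open>\<omega> * p\<close> lies strictly between 0 and \<open>2 * pi\<close>.\<close>

lemma harmonic_minimal_period:
  fixes \<omega> :: real
  assumes "\<omega> > 0" "\<alpha> \<noteq> 0 \<or> \<beta> \<noteq> 0" "0 < p" "p < 2 * pi / \<omega>"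
    and per: "\<And>x. \<alpha> * cos (\<omega> * (x + p)) + \<beta> * sin (\<omega> * (x + p)) = \<alpha> * cos (\<omega> * x) + \<beta> * sin (\<omega> * x)"
  shows False
proof -
  define c where "c = cos (\<omega> * p)"
  define s where "s = sin (\<omega> * p)"
  have 1: "\<alpha> * c + \<beta> * s = \<alpha>" using per[of 0] by (simp add: c_def s_def)
  have "\<omega> * (pi / 2 / \<omega> + p) = pi / 2 + \<omega> * p" "\<omega> * (pi / 2 / \<omega>) = pi / 2"
    using assms(1) by (simp_all add: field_simps)
  then have 2: "- \<alpha> * s + \<beta> * c = \<beta>"
    using per[of "pi / 2 / \<omega>"] by (simp only: c_def s_def cos_add sin_add) simp
  have "(\<alpha>\<^sup>2 + \<beta>\<^sup>2) * c = \<alpha> * (\<alpha> * c + \<beta> * s) + \<beta> * (- \<alpha> * s + \<beta> * c)"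
    by (simp add: algebra_simps power2_eq_square)
  also have "\<dots> = (\<alpha>\<^sup>2 + \<beta>\<^sup>2) * 1" unfolding 1 2 by (simp add: power2_eq_square)
  finally have "(\<alpha>\<^sup>2 + \<beta>\<^sup>2) * c = (\<alpha>\<^sup>2 + \<beta>\<^sup>2) * 1" .
  moreover have "\<alpha>\<^sup>2 + \<beta>\<^sup>2 \<noteq> 0" using assms(2) by (simp add: sum_power2_eq_zero_iff)
  ultimately have "c = 1" by (metis mult_left_cancel)
  then obtain k :: int where k: "\<omega> * p = of_int k * 2 * pi" unfolding c_def using cos_one_2pi_int by auto
  have "0 < \<omega> * p" "\<omega> * p < 2 * pi" using assms(1,3,4) by (simp_all add: field_simps)
  then have "0 < of_int k * (2 * pi)" "of_int k * (2 * pi) < 1 * (2 * pi)" using k by simp_all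
  then have "0 < (of_int k :: real)" "(of_int k :: real) < 1"
    using pi_gt_zero by (simp_all add: zero_less_mult_iff)
  then show False by simp
qed

section \<open>Circles and Binet's equation for the two potentials\<close>

context surface
begin

lemma w_inj: "x \<in> E \<Longrightarrow> y \<in> E \<Longrightarrow> w x = w y \<Longrightarrow> x = y"
proof (rule ccontr)
  have *: "False" if x: "x \<in> E" and y: "y \<in> E" and eq: "w x = w y" and lt: "x < y" for x y
  proof -
    have seg: "z \<in> E" if "x \<le> z" "z \<le> y" for z
      by (rule E_between[OF x y that])
    obtain z where z: "x < z" "z < y" "w y - w x = (y - x) * (\<sigma> * \<xi>\<^sup>2 / (f z)\<^sup>2)"
      using MVT2[OF lt, of w "\<lambda>z. \<sigma> * \<xi>\<^sup>2 / (f z)\<^sup>2"] w_DERIV[OF seg] by blast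
    then show False using eq lt \<xi>_pos f_pos[OF seg, of z] \<sigma>_sq(3) by simp
  qed
  assume "x \<in> E" "y \<in> E" "w x = w y" "x \<noteq> y"
  then show False using *[of x y] *[of y x] by (cases "x < y") auto
qed

definition is_bertrand :: "nat \<Rightarrow> real \<Rightarrow> real \<Rightarrow> (real \<Rightarrow> real) \<Rightarrow> bool" where
  "is_bertrand i A B V \<longleftrightarrow> i \<in> {1, 2} \<and> A > 0 \<and> (\<forall>r\<in>E. V r = bertrand_potential f i A B r)"

lemma is_bertrand_cases:
  assumes "is_bertrand i A B V"
  obtains "i = 1" "\<And>r. r \<in> E \<Longrightarrow> V r = - A * w r + B"
  | "i = 2" "\<And>r. r \<in> E \<Longrightarrow> V r = A / 2 * inverse ((w r)\<^sup>2) + B"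
proof -
  have *: "i = 1 \<or> i = 2" and V: "\<And>r. r \<in> E \<Longrightarrow> V r = bertrand_potential f i A B r"
    using assms by (auto simp: is_bertrand_def)
  from * show thesis
  proof
    assume i: "i = 1"
    have "V r = - A * w r + B" if "r \<in> E" for r
      unfolding V[OF that] i by (rule bertrand_potential_w(1)[OF that])
    then show thesis by (rule that(1)[OF i])
  next
    assume i: "i = 2"
    have "V r = A / 2 * inverse ((w r)\<^sup>2) + B" if "r \<in> E" for r
      unfolding V[OF that] i bertrand_potential_w(2)[OF that] by (simp add: field_simps)
    then show thesis by (rule that(2)[OF i])
  qed
qed

lemma smooth_inverse_w2: "smooth_on E (\<lambda>r. inverse ((w r)\<^sup>2))"
  by (intro smooth_on_inverse smooth_on_power smooth_w open_einterval) (use w_pos in force)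

lemma is_bertrand_smooth:
  assumes "is_bertrand i A B V"
  shows "smooth_on E V"
  using assms
proof (cases rule: is_bertrand_cases)
  case 1
  have "smooth_on E (\<lambda>r. - A * w r + B)"
    by (intro smooth_on_add smooth_on_mult smooth_on_const smooth_w open_einterval)
  then show ?thesis by (rule smooth_on_cong[OF open_einterval, rotated]) (rule 1(2))
next
  case 2
  have "smooth_on E (\<lambda>r. A / 2 * inverse ((w r)\<^sup>2) + B)"
    by (intro smooth_on_add smooth_on_mult smooth_on_const smooth_inverse_w2 open_einterval)
  then show ?thesis by (rule smooth_on_cong[OF open_einterval, rotated]) (rule 2(2))
qed

lemma D_w_inverse_power:
  assumes r: "r \<in> E"
  shows "D (\<lambda>r. inverse (w r ^ n)) r = - real n * inverse (w r ^ Suc n)"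
proof -
  have wp: "w r \<noteq> 0" using w_pos[OF r] by simp
  have "((\<lambda>r. inverse (w r ^ n)) has_real_derivative
      - (inverse (w r ^ n) * (real n * (\<sigma> * \<xi>\<^sup>2 / (f r)\<^sup>2 * w r ^ (n - Suc 0))) * inverse (w r ^ n))) (at r)"
    by (rule DERIV_inverse'[OF DERIV_power[OF w_DERIV[OF r]]]) (use wp in simp)
  then have "D (\<lambda>r. inverse (w r ^ n)) r = \<sigma> * (f r)\<^sup>2 / \<xi>\<^sup>2 *
      (- (inverse (w r ^ n) * (real n * (\<sigma> * \<xi>\<^sup>2 / (f r)\<^sup>2 * w r ^ (n - Suc 0))) * inverse (w r ^ n)))"
    by (rule D_eqI)
  also have "\<dots> = \<sigma> * (f r)\<^sup>2 / \<xi>\<^sup>2 * ((- (inverse (w r ^ n) * (real n * w r ^ (n - Suc 0)) * inverse (w r ^ n)))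
      * (\<sigma> * \<xi>\<^sup>2 / (f r)\<^sup>2))" by (simp only: mult_ac mult_minus_left mult_minus_right)
  also have "\<dots> = - (inverse (w r ^ n) * (real n * w r ^ (n - Suc 0)) * inverse (w r ^ n))"
    by (rule \<sigma>_cancel(1)[OF r])
  also have "\<dots> = - real n * inverse (w r ^ Suc n)"
    using wp by (cases n) (simp_all add: field_simps)
  finally show ?thesis .
qed

text \<open>The exponent is 0 for \<open>i = 1\<close> and 3 for \<open>i = 2\<close>, so one
  formula serves both. The sign of the second derivative is what makes each circle strongly
  stable.\<close>

lemma is_bertrand_D:
  assumes "is_bertrand i A B V" and r: "r \<in> E"
  shows "D V r = - A / w r ^ (i\<^sup>2 - 1)" "D (D V) r \<ge> 0"
proof -
  have "D V r = - A / w r ^ (i\<^sup>2 - 1) \<and> D (D V) r \<ge> 0"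
    using assms(1)
  proof (cases rule: is_bertrand_cases)
    case 1
    have D1: "D V r = - A" if r: "r \<in> E" for r
    proof -
      have "D V r = D (\<lambda>r. - A * w r + B) r" by (rule D_cong[OF open_einterval r 1(2)])
      also have "\<dots> = D (\<lambda>r. - A * w r) r + D (\<lambda>r. B) r"
        by (rule D_add[OF _ _ r]) (intro smooth_on_mult smooth_on_const smooth_w open_einterval)+
      finally show ?thesis using D_cmult[OF smooth_w r, of "- A"] D_w[OF r] by (simp add: D_const)
    qed
    show ?thesis using D1[OF r] 1(1) D_cong[OF open_einterval r D1] by (simp add: D_const)
  next
    case 2
    have s: "smooth_on E (\<lambda>r. inverse (w r ^ n))" for n
      by (intro smooth_on_inverse smooth_on_power smooth_w open_einterval) (use w_pos in force)
    have D1: "D V r = - A * inverse (w r ^ 3)" if r: "r \<in> E" for r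
    proof -
      have "D V r = D (\<lambda>r. A / 2 * inverse ((w r)\<^sup>2) + B) r" by (rule D_cong[OF open_einterval r 2(2)])
      also have "\<dots> = D (\<lambda>r. A / 2 * inverse ((w r)\<^sup>2)) r + D (\<lambda>r. B) r"
        by (rule D_add[OF _ _ r]) (intro smooth_on_mult smooth_on_const s open_einterval)+
      also have "\<dots> = A / 2 * (- real 2 * inverse (w r ^ Suc 2))"
        using D_cmult[OF s r, of "A / 2" 2] D_w_inverse_power[OF r, of 2] by (simp add: D_const)
      finally show ?thesis by (simp add: numeral_3_eq_3)
    qed
    have "D V r = - A / w r ^ (i\<^sup>2 - 1)" using D1[OF r] 2(1) by (simp add: divide_inverse)
    moreover have "D (D V) r = - A * (- real 3 * inverse (w r ^ Suc 3))"
      using D_cong[OF open_einterval r D1] D_cmult[OF s r, of "- A" 3] D_w_inverse_power[OF r, of 3] by simp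
    then have "D (D V) r \<ge> 0" using w_pos[OF r] assms(1) by (simp add: is_bertrand_def)
    ultimately show ?thesis by blast
  qed
  then show "D V r = - A / w r ^ (i\<^sup>2 - 1)" "D (D V) r \<ge> 0" by blast+
qed

lemma is_bertrand_circle:
  assumes "is_bertrand i A B V" and r: "r \<in> E"
  shows "D V r = - (K\<^sup>2 / \<xi>\<^sup>2 * w r) \<longleftrightarrow> K\<^sup>2 = \<xi>\<^sup>2 * (A / w r ^ i\<^sup>2)"
proof -
  have wp: "w r > 0" by (rule w_pos[OF r])
  have i: "i\<^sup>2 = Suc (i\<^sup>2 - 1)" using assms(1) by (auto simp: is_bertrand_def)
  have p: "w r ^ i\<^sup>2 = w r * w r ^ (i\<^sup>2 - 1)" by (subst i) simp
  have "D V r = - (K\<^sup>2 / \<xi>\<^sup>2 * w r) \<longleftrightarrow> A / w r ^ (i\<^sup>2 - 1) = K\<^sup>2 / \<xi>\<^sup>2 * w r"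
    by (simp add: is_bertrand_D(1)[OF assms])
  also have "\<dots> \<longleftrightarrow> K\<^sup>2 = \<xi>\<^sup>2 * (A / w r ^ i\<^sup>2)"
    unfolding p using wp \<xi>_pos by (auto simp: field_simps)
  finally show ?thesis .
qed

lemma is_bertrand_circular_orbit_iff:
  assumes ib: "is_bertrand i A B V" and r: "r \<in> E"
  shows "circular_orbit a b f V r K \<longleftrightarrow>
    K = \<xi> * sqrt (A / \<bar>theta f r\<bar> ^ i\<^sup>2) \<or> K = - \<xi> * sqrt (A / \<bar>theta f r\<bar> ^ i\<^sup>2)"
proof -
  define c where "c = A / w r ^ i\<^sup>2"
  have c: "c > 0" using ib w_pos[OF r] by (simp add: c_def is_bertrand_def)
  have "circular_orbit a b f V r K \<longleftrightarrow> K \<noteq> 0 \<and> D V r = - (K\<^sup>2 / \<xi>\<^sup>2 * w r)"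
    using circular_orbit_iff[OF is_bertrand_smooth[OF ib], of r K] r deriv_D[OF r]
      D_effective_potential[OF is_bertrand_smooth[OF ib] r, of K] f_pos[OF r] \<xi>_pos \<sigma>_sq(3) by auto
  also have "\<dots> \<longleftrightarrow> K\<^sup>2 = \<xi>\<^sup>2 * c"
  proof -
    have "\<xi>\<^sup>2 * c \<noteq> 0" using c \<xi>_pos by simp
    then show ?thesis using is_bertrand_circle[OF ib r, of K, folded c_def] by auto
  qed
  also have "\<xi>\<^sup>2 * c = (\<xi> * sqrt c)\<^sup>2" using c by (simp add: power_mult_distrib)
  also have "K\<^sup>2 = (\<xi> * sqrt c)\<^sup>2 \<longleftrightarrow> K = \<xi> * sqrt c \<or> K = - \<xi> * sqrt c"
    by (simp add: power2_eq_iff)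
  finally show ?thesis by (simp add: c_def abs_theta[OF r])
qed

lemma is_bertrand_strongly_stable:
  assumes ib: "is_bertrand i A B V" and r: "r \<in> E"
  shows "strongly_stable a b f V r (\<xi> * sqrt (A / w r ^ i\<^sup>2))"
proof -
  define c where "c = A / w r ^ i\<^sup>2"
  have c: "c > 0" using ib w_pos[OF r] by (simp add: c_def is_bertrand_def)
  define K where "K = \<xi> * sqrt c"
  have K: "K \<noteq> 0" "K\<^sup>2 = \<xi>\<^sup>2 * c" using c \<xi>_pos by (auto simp: K_def power_mult_distrib)
  have "K\<^sup>2 / \<xi>\<^sup>2 > 0" using K(1) \<xi>_pos by simp
  then have "strongly_stable a b f V r K"
    using is_bertrand_circle[OF ib r, of K, folded c_def] K is_bertrand_D(2)[OF ib r] r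
    by (simp add: strongly_stable_iff_D[OF is_bertrand_smooth[OF ib]])
  then show ?thesis by (simp add: K_def c_def)
qed

text \<open>Binet's equation: as a function of the angle, \<open>w\<^sup>i\<close> oscillates harmonically with frequency \<open>i \<xi>\<close>.
  For \<open>i = 2\<close> the energy integral eliminates the square of the radial velocity.\<close>

lemma is_bertrand_orbit_equation:
  assumes ib: "is_bertrand i A B V" and nb: "nonsingular_bounded a b f V I r \<phi> K"
  obtains z \<alpha> \<beta> where
    "\<And>t. w (r t) ^ i = z + \<alpha> * cos (real i * \<xi> * \<phi> t) + \<beta> * sin (real i * \<xi> * \<phi> t)"
proof -
  note V = is_bertrand_smooth[OF ib]
  note mo = nonsingular_boundedD(3)[OF V nb] and K = nonsingular_boundedD(2)[OF V nb]
  define v where "v = deriv r"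
  note mD = motionD[OF mo UNIV_I, folded v_def]
  define W where "W t = w (r t)" for t
  define F where "F t = (f (r t))\<^sup>2" for t
  have F: "F t > 0" for t using f_pos[OF mD(1)[of t]] by (simp add: F_def)
  have W: "W t > 0" for t using w_pos[OF mD(1)[of t]] by (simp add: W_def)
  have dW: "(W has_real_derivative \<sigma> * \<xi>\<^sup>2 / F t * v t) (at t)" for t
    unfolding W_def F_def by (rule DERIV_chain2[where f = w, OF w_DERIV[OF mD(1)] mD(2)])
  have dv: "(v has_real_derivative - (\<sigma> * \<xi>\<^sup>2 / F t * (- A / W t ^ (i\<^sup>2 - 1) + K\<^sup>2 / \<xi>\<^sup>2 * W t))) (at t)" for t
    using mD(3)[of t]
    unfolding deriv_D[OF mD(1)] D_effective_potential[OF V mD(1)] is_bertrand_D(1)[OF ib mD(1)] F_def W_def .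
  have d\<phi>: "(\<phi> has_real_derivative K / F t) (at t)" for t using mD(4) by (simp add: F_def)
  have i: "i = 1 \<or> i = 2" using ib by (auto simp: is_bertrand_def)
  then show ?thesis
  proof
    assume i: "i = 1"
    \<comment> \<open>The subtracted constant is the equilibrium value of \<open>w\<close> at
      momentum \<open>K\<close>; the second component \<open>\<xi> / K * (\<sigma> * v)\<close> is
      \<open>dw/d\<phi>\<close> divided by \<xi>.\<close>
    have q: "((\<lambda>t. W t - \<xi>\<^sup>2 * A / K\<^sup>2) has_real_derivative \<xi> * (K / F t) * (\<xi> / K * (\<sigma> * v t))) (at t)" for t
      by (rule DERIV_cong[OF DERIV_diff[OF dW DERIV_const]]) (use K in \<open>simp add: power2_eq_square\<close>)
    have y: "((\<lambda>t. \<xi> / K * (\<sigma> * v t)) has_real_derivative - (\<xi> * (K / F t) * (W t - \<xi>\<^sup>2 * A / K\<^sup>2))) (at t)" for t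
    proof (rule DERIV_cong[OF DERIV_cmult[OF DERIV_cmult[OF dv]]])
      have "\<xi> / K * (\<sigma> * - (\<sigma> * \<xi>\<^sup>2 / F t * (- A / W t ^ (i\<^sup>2 - 1) + K\<^sup>2 / \<xi>\<^sup>2 * W t)))
          = - (\<sigma> * \<sigma>) * (\<xi> / K * (\<xi>\<^sup>2 / F t * (- A + K\<^sup>2 / \<xi>\<^sup>2 * W t)))" using i by simp
      also have "\<dots> = - (\<xi> * (K / F t) * (W t - \<xi>\<^sup>2 * A / K\<^sup>2))"
        unfolding \<sigma>_sq(1) using K \<xi>_pos F[of t] by (simp add: field_simps power2_eq_square)
      finally show "\<xi> / K * (\<sigma> * - (\<sigma> * \<xi>\<^sup>2 / F t * (- A / W t ^ (i\<^sup>2 - 1) + K\<^sup>2 / \<xi>\<^sup>2 * W t)))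
          = - (\<xi> * (K / F t) * (W t - \<xi>\<^sup>2 * A / K\<^sup>2))" .
    qed
    obtain \<alpha> \<beta> where "\<And>t. W t - \<xi>\<^sup>2 * A / K\<^sup>2 = \<alpha> * cos (\<xi> * \<phi> t) + \<beta> * sin (\<xi> * \<phi> t)"
      using rotation_integral[OF q y d\<phi>] by blast
    then have "w (r t) ^ i = \<xi>\<^sup>2 * A / K\<^sup>2 + \<alpha> * cos (real i * \<xi> * \<phi> t) + \<beta> * sin (real i * \<xi> * \<phi> t)" for t
      by (simp add: i W_def algebra_simps)
    then show ?thesis by (rule that)
  next
    assume i: "i = 2"
    obtain c where c: "\<And>r. r \<in> E \<Longrightarrow> (w r)\<^sup>2 + c = \<xi>\<^sup>2 / (f r)\<^sup>2" using curvature_constant by metis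
    define H where "H = (v 0)\<^sup>2 / 2 + effective_potential f V K (r 0)"
    \<comment> \<open>The centre of the oscillation of \<open>w\<^sup>2\<close>, obtained by solving
      the energy integral with \<open>\<xi>\<^sup>2 / (f r)\<^sup>2 = w\<^sup>2 + c\<close>.\<close>
    define z where "z = (2 * H - 2 * B - K\<^sup>2 * c / \<xi>\<^sup>2) * \<xi>\<^sup>2 / (2 * K\<^sup>2)"
    \<comment> \<open>The left side is, up to a factor, the derivative of \<open>W * v\<close>;
      energy conservation makes it affine in \<open>W\<^sup>2\<close>, which closes the linear
      system.\<close>
    have energy: "(v t)\<^sup>2 + A / (W t)\<^sup>2 - K\<^sup>2 / \<xi>\<^sup>2 * (W t)\<^sup>2 = - (2 * K\<^sup>2 / \<xi>\<^sup>2 * ((W t)\<^sup>2 - z))" for t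
    proof -
      have "H = (v t)\<^sup>2 / 2 + effective_potential f V K (r t)"
        unfolding H_def v_def by (rule motion_energy[OF V convex_UNIV mo UNIV_I UNIV_I])
      moreover have "V (r t) = A / (2 * (W t)\<^sup>2) + B"
        using ib bertrand_potential_w(2)[OF mD(1)] i by (simp add: is_bertrand_def mD(1) W_def)
      moreover have "K\<^sup>2 / (2 * (f (r t))\<^sup>2) = K\<^sup>2 / (2 * \<xi>\<^sup>2) * (\<xi>\<^sup>2 / (f (r t))\<^sup>2)"
        using \<xi>_pos by simp
      ultimately have "H = (v t)\<^sup>2 / 2 + (A / (2 * (W t)\<^sup>2) + B) + K\<^sup>2 / (2 * \<xi>\<^sup>2) * ((W t)\<^sup>2 + c)"
        using c[OF mD(1)[of t]] by (simp add: effective_potential_def W_def)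
      then have "2 * H = (v t)\<^sup>2 + A / (W t)\<^sup>2 + 2 * B + K\<^sup>2 / \<xi>\<^sup>2 * (W t)\<^sup>2 + K\<^sup>2 * c / \<xi>\<^sup>2"
        by (simp add: algebra_simps add_divide_distrib)
      moreover have "2 * K\<^sup>2 / \<xi>\<^sup>2 * z = 2 * H - 2 * B - K\<^sup>2 * c / \<xi>\<^sup>2"
        using K \<xi>_pos by (simp add: z_def)
      ultimately show ?thesis by (simp add: right_diff_distrib)
    qed
    have q: "((\<lambda>t. (W t)\<^sup>2 - z) has_real_derivative 2 * \<xi> * (K / F t) * (\<xi> / K * (\<sigma> * (W t * v t)))) (at t)" for t
      by (rule DERIV_cong[OF DERIV_diff[OF DERIV_power[OF dW, of 2] DERIV_const]])
        (use K in \<open>simp add: power2_eq_square\<close>)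
    have y: "((\<lambda>t. \<xi> / K * (\<sigma> * (W t * v t))) has_real_derivative - (2 * \<xi> * (K / F t) * ((W t)\<^sup>2 - z))) (at t)" for t
    proof (rule DERIV_cong[OF DERIV_cmult[OF DERIV_cmult[OF DERIV_mult[OF dW dv]]]])
      let ?lhs = "\<xi> / K * (\<sigma> * (\<sigma> * \<xi>\<^sup>2 / F t * v t * v t
          + - (\<sigma> * \<xi>\<^sup>2 / F t * (- A / W t ^ (i\<^sup>2 - 1) + K\<^sup>2 / \<xi>\<^sup>2 * W t)) * W t))"
      have "?lhs = (\<sigma> * \<sigma>) * (\<xi> / K * (\<xi>\<^sup>2 / F t * ((v t)\<^sup>2
          + W t * (A / W t ^ (i\<^sup>2 - 1)) - K\<^sup>2 / \<xi>\<^sup>2 * (W t)\<^sup>2)))"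
        by (simp add: algebra_simps power2_eq_square add_divide_distrib)
      also have "W t * (A / W t ^ (i\<^sup>2 - 1)) = A / (W t)\<^sup>2"
        using W[of t] i by (simp add: field_simps eval_nat_numeral)
      also have "(\<sigma> * \<sigma>) * (\<xi> / K * (\<xi>\<^sup>2 / F t * ((v t)\<^sup>2 + A / (W t)\<^sup>2 - K\<^sup>2 / \<xi>\<^sup>2 * (W t)\<^sup>2)))
          = - (2 * \<xi> * (K / F t) * ((W t)\<^sup>2 - z))"
        unfolding \<sigma>_sq(1) energy using K \<xi>_pos F[of t] by (simp add: field_simps power2_eq_square)
      finally show "?lhs = - (2 * \<xi> * (K / F t) * ((W t)\<^sup>2 - z))" .
    qed
    obtain \<alpha> \<beta> where "\<And>t. (W t)\<^sup>2 - z = \<alpha> * cos (2 * \<xi> * \<phi> t) + \<beta> * sin (2 * \<xi> * \<phi> t)"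
      using rotation_integral[OF q y d\<phi>] by blast
    then have "w (r t) ^ i = z + \<alpha> * cos (real i * \<xi> * \<phi> t) + \<beta> * sin (real i * \<xi> * \<phi> t)" for t
      by (simp add: i W_def algebra_simps)
    then show ?thesis by (rule that)
  qed
qed

lemma is_bertrand_radius_of_angle:
  assumes ib: "is_bertrand i A B V" and nb: "nonsingular_bounded a b f V I r \<phi> K"
    and T: "\<And>x. \<phi> (T x) = x"
    and orb: "\<And>t. w (r t) ^ i = z + \<alpha> * cos (real i * \<xi> * \<phi> t) + \<beta> * sin (real i * \<xi> * \<phi> t)"
    and p: "real i * \<xi> * p = 2 * pi * of_int k"
  shows "r (T (x + p)) = r (T x)"
proof -
  have E: "r t \<in> E" for t
    using motionD(1)[OF nonsingular_boundedD(3)[OF is_bertrand_smooth[OF ib] nb]] by simp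
  have arg: "real i * \<xi> * (x + p) = real i * \<xi> * x + 2 * pi * of_int k"
    using p by (simp add: algebra_simps)
  have "w (r (T (x + p))) ^ i = w (r (T x)) ^ i"
    unfolding orb T arg by (simp add: cos_add sin_add cos_int_2pin sin_int_2pin)
  then have "w (r (T (x + p))) = w (r (T x))"
    by (rule power_eq_imp_eq_base[OF _ less_imp_le[OF w_pos[OF E]] less_imp_le[OF w_pos[OF E]]])
      (use ib in \<open>auto simp: is_bertrand_def\<close>)
  then show ?thesis by (rule w_inj[OF E E])
qed

text \<open>A noncircular orbit has a nonzero harmonic part, since otherwise injectivity of
  \<open>w\<close> would make the radius constant. The minimal period of \<open>w ^ i\<close> as a
  function of the angle then passes to the radius.\<close>

lemma is_bertrand_minimal_period:
  assumes ib: "is_bertrand i A B V" and nb: "nonsingular_bounded a b f V I r \<phi> K"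
    and nc: "\<not> circular I r \<phi>"
  shows "\<exists>\<rho>. (\<forall>t\<in>I. r t = \<rho> (\<phi> t)) \<and> minimal_period \<rho> (2 * pi / (real i * \<xi>))"
proof -
  note V = is_bertrand_smooth[OF ib]
  have ip: "real i * \<xi> > 0" using ib \<xi>_pos by (auto simp: is_bertrand_def)
  obtain T where T: "\<And>t. T (\<phi> t) = t" "\<And>x. \<phi> (T x) = x" using time_of_angle[OF V nb] by metis
  obtain z \<alpha> \<beta> where orb:
    "\<And>t. w (r t) ^ i = z + \<alpha> * cos (real i * \<xi> * \<phi> t) + \<beta> * sin (real i * \<xi> * \<phi> t)"
    using is_bertrand_orbit_equation[OF ib nb] by metis
  have ne: "\<alpha> \<noteq> 0 \<or> \<beta> \<noteq> 0"
  proof (rule ccontr)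
    assume "\<not> (\<alpha> \<noteq> 0 \<or> \<beta> \<noteq> 0)"
    then have *: "w (r t) ^ i = w (r 0) ^ i" for t by (simp add: orb)
    have E: "r t \<in> E" for t using motionD(1)[OF nonsingular_boundedD(3)[OF V nb]] by simp
    have "w (r t) = w (r 0)" for t
      by (rule power_eq_imp_eq_base[OF *[of t] less_imp_le[OF w_pos[OF E]] less_imp_le[OF w_pos[OF E]]])
        (use ib in \<open>auto simp: is_bertrand_def\<close>)
    then have "r t = r 0" for t by (rule w_inj[OF E E])
    then show False using constant_radius_circular[OF V nb] nc by blast
  qed
  have wT: "w (r (T x)) ^ i = z + \<alpha> * cos (real i * \<xi> * x) + \<beta> * sin (real i * \<xi> * x)" for x
    by (simp add: orb T)
  have "\<not> (\<forall>x. r (T (x + p)) = r (T x))" if p: "0 < p" "p < 2 * pi / (real i * \<xi>)" for p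
  proof
      assume "\<forall>x. r (T (x + p)) = r (T x)"
      then have "\<alpha> * cos (real i * \<xi> * (x + p)) + \<beta> * sin (real i * \<xi> * (x + p))
          = \<alpha> * cos (real i * \<xi> * x) + \<beta> * sin (real i * \<xi> * x)" for x
        using wT[of "x + p"] wT[of x] by simp
      then show False by (rule harmonic_minimal_period[OF ip ne p])
  qed
  moreover have "r (T (x + 2 * pi / (real i * \<xi>))) = r (T x)" for x
    by (rule is_bertrand_radius_of_angle[OF ib nb T(2) orb, of _ 1])
      (use ib \<xi>_pos in \<open>auto simp: is_bertrand_def\<close>)
  moreover have "0 < 2 * pi / (real i * \<xi>)" using ip by simp
  ultimately have "minimal_period (\<lambda>x. r (T x)) (2 * pi / (real i * \<xi>))"
    unfolding minimal_period_def by blast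
  then show ?thesis using T(1) by (intro exI[of _ "\<lambda>x. r (T x)"]) simp
qed

text \<open>With \<xi> = k / n, the radius repeats after the angle \<open>2 * pi * n\<close>. The
  rate of time per angle depends on the radius only, so this angle always takes the same time
  \<tau>.\<close>

lemma is_bertrand_closed:
  assumes ib: "is_bertrand i A B V" and nb: "nonsingular_bounded a b f V I r \<phi> K" and \<xi>: "\<xi> \<in> \<rat>"
  shows "closed_orbit I r \<phi>"
proof -
  note V = is_bertrand_smooth[OF ib]
  obtain T where T: "\<And>t. T (\<phi> t) = t" "\<And>x. \<phi> (T x) = x"
    and dT: "\<And>x. (T has_real_derivative (f (r (T x)))\<^sup>2 / K) (at x)"
    using time_of_angle[OF V nb] by metis
  obtain z \<alpha> \<beta> where orb:
    "\<And>t. w (r t) ^ i = z + \<alpha> * cos (real i * \<xi> * \<phi> t) + \<beta> * sin (real i * \<xi> * \<phi> t)"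
    using is_bertrand_orbit_equation[OF ib nb] by metis
  obtain k n :: int where n: "n > 0" "\<xi> = of_int k / of_int n"
    using \<xi> by (metis Rats_cases')
  define p where "p = 2 * pi * of_int n"
  have "real i * \<xi> * p = 2 * pi * of_int (int i * k)" using n by (simp add: p_def)
  note per = is_bertrand_radius_of_angle[OF ib nb T(2) orb this]
  define \<tau> where "\<tau> = T (0 + p) - T 0"
  have T_shift: "T (x + p) = T x + \<tau>" for x
  proof -
    have "((\<lambda>x. T (x + p) - T x) has_real_derivative 0) (at x)" for x
    proof -
      have "((\<lambda>x. T (x + p)) has_real_derivative (f (r (T x)))\<^sup>2 / K) (at x)"
        using dT[of "x + p"] unfolding per by (subst (asm) DERIV_shift)
      from DERIV_diff[OF this dT[of x]] show ?thesis by simp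
    qed
    from DERIV_0_const_interval[OF convex_UNIV this UNIV_I UNIV_I, of x 0]
    show ?thesis by (simp add: \<tau>_def)
  qed
  have step: "r (t + \<tau>) = r t \<and> \<phi> (t + \<tau>) = \<phi> t + p" for t
    using T_shift[of "\<phi> t"] per[of "\<phi> t"] T by metis
  have cis: "cis (\<phi> (t + \<tau>)) = cis (\<phi> t)" for t
  proof -
    have "cis p = 1" unfolding p_def by (rule cis_multiple_2pi) simp
    then show ?thesis using step[of t] by (simp flip: cis_mult)
  qed
  have "\<tau> \<noteq> 0" using step[of 0] n(1) by (auto simp: p_def)
  have "\<exists>S>0. \<forall>t. r (t + S) = r t \<and> cis (\<phi> (t + S)) = cis (\<phi> t)"
  \<comment> \<open>For \<open>K < 0\<close> the angle decreases in time and \<tau> is negative;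
    then \<open>- \<tau>\<close> is the period.\<close>
  proof (cases "\<tau> > 0")
    case True
    then show ?thesis using step cis by blast
  next
    case False
    then have "- \<tau> > 0" using \<open>\<tau> \<noteq> 0\<close> by simp
    moreover have "r (t + - \<tau>) = r t \<and> cis (\<phi> (t + - \<tau>)) = cis (\<phi> t)" for t
      using step[of "t + - \<tau>"] cis[of "t + - \<tau>"] by simp
    ultimately show ?thesis by blast
  qed
  then show ?thesis by (simp add: closed_orbit_def nonsingular_boundedD(1)[OF V nb])
qed

section \<open>The five classes coincide\<close>

abbreviation "closing_classes \<equiv>
  {semilocally_closing, locally_closing, closing, strongly_closing, weakly_closing}"

lemma is_bertrand_imp_closing_classes:
  assumes ib: "is_bertrand i A B V" and \<xi>: "\<xi> \<in> \<rat>" and P: "P \<in> closing_classes"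
  shows "P a b f V"
proof -
  note V = is_bertrand_smooth[OF ib]
  have closed: "\<And>I r \<phi> K. nonsingular_bounded a b f V I r \<phi> K \<Longrightarrow> closed_orbit I r \<phi>"
    by (rule is_bertrand_closed[OF ib _ \<xi>])
  have near: "closed_near a b f V r0 K0" for r0 K0
    unfolding closed_near_def using closed by (intro exI[of _ 1]) auto
  have st: "\<exists>K. strongly_stable a b f V r0 K" if "r0 \<in> E" for r0
    using is_bertrand_strongly_stable[OF ib that] by blast
  obtain r0 where r0: "r0 \<in> E" using einterval_nonempty[OF ab] by blast
  have ex: "cond_exists a b f V"
  proof -
    obtain K where K: "strongly_stable a b f V r0 K" using st[OF r0] by blast
    obtain N s l where "well a b f \<xi> \<sigma> V K r0 N s l" using strongly_stable_well[OF V K zero_less_one] by metis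
    moreover have "K \<noteq> 0" using K by (simp add: strongly_stable_def)
    ultimately show ?thesis by (rule well.cond_exists_near_minimum)
  qed
  have fl: "cond_forall_loc a b f V" using near by (simp add: cond_forall_loc_def)
  have flo: "cond_forall_loc_orbital a b f V" using near by (simp add: cond_forall_loc_orbital_def)
  have "closing a b f V" unfolding closing_def cond_forall_def using ex closed by blast
  moreover have "locally_closing a b f V"
    unfolding locally_closing_def cond_exists_loc_def using st[OF r0] fl by blast
  moreover have "semilocally_closing a b f V"
    using ex fl closed unfolding semilocally_closing_def cond_exists_def cond_forall_semiloc_def by blast
  moreover have "strongly_closing a b f V" unfolding strongly_closing_def using st fl by blast
  moreover have "weakly_closing a b f V"
    unfolding weakly_closing_def using st flo strongly_stable_imp_orbitally_stable[OF V] by blast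
  ultimately show ?thesis using P by blast
qed

lemma closing_classes_imp_locally_closing:
  assumes V: "smooth_on E V" and P: "P \<in> closing_classes" "P a b f V"
  shows "locally_closing a b f V"
proof -
  have "locally_closing a b f V" if "closing a b f V"
  proof -
    have "cond_exists_loc a b f V"
      using that cond_exists_imp_strongly_stable[OF V] unfolding closing_def cond_exists_def by blast
    moreover have "closed_near a b f V r0 K0" for r0 K0
      using that unfolding closing_def cond_forall_def closed_near_def by (intro exI[of _ 1]) auto
    ultimately show ?thesis by (simp add: locally_closing_def cond_forall_loc_def)
  qed
  moreover have "locally_closing a b f V" if "semilocally_closing a b f V"
    using that cond_exists_imp_strongly_stable[OF V]
    unfolding semilocally_closing_def locally_closing_def by blast
  moreover have "locally_closing a b f V" if "strongly_closing a b f V"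
    using that einterval_nonempty[OF ab]
    unfolding strongly_closing_def locally_closing_def cond_exists_loc_def by blast
  ultimately show ?thesis using P weakly_closing_imp_locally_closing[OF V] by blast
qed

theorem closing_classes_iff_bertrand:
  assumes "\<xi> \<in> \<rat>" and "P \<in> closing_classes"
  shows "central_potential a b V \<and> P a b f V \<longleftrightarrow>
    (\<exists>i\<in>{1, 2}. \<exists>A>0. \<exists>B. \<forall>r\<in>E. V r = bertrand_potential f i A B r)"
proof
  assume "central_potential a b V \<and> P a b f V"
  then have V: "smooth_on E V" and Pv: "P a b f V" by (simp_all add: central_potential_def)
  show "\<exists>i\<in>{1, 2}. \<exists>A>0. \<exists>B. \<forall>r\<in>E. V r = bertrand_potential f i A B r"
    by (rule locally_closing_imp_bertrand[OF V _ assms(1)],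
        rule closing_classes_imp_locally_closing[where P = P, OF V assms(2) Pv])
next
  assume "\<exists>i\<in>{1, 2}. \<exists>A>0. \<exists>B. \<forall>r\<in>E. V r = bertrand_potential f i A B r"
  then obtain i A B where ib: "is_bertrand i A B V" unfolding is_bertrand_def by blast
  show "central_potential a b V \<and> P a b f V"
    unfolding central_potential_def
    using is_bertrand_smooth[OF ib] is_bertrand_imp_closing_classes[where P = P, OF ib assms] by (rule conjI)
qed

end

section \<open>The shape of \<open>f\<close> and the ends of the interval\<close>

context surface
begin

lemma sqrt_f'_sq: "r \<in> E \<Longrightarrow> sqrt ((deriv f r)\<^sup>2) = - \<sigma> * deriv f r"
proof -
  assume r: "r \<in> E"
  have "- \<sigma> * deriv f r = w r * f r" using \<sigma> by (auto simp: deriv_f[OF r])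
  then have "- \<sigma> * deriv f r > 0" using w_pos[OF r] f_pos[OF r] by simp
  then show ?thesis using \<sigma> by auto
qed

text \<open>Separation of variables in \<open>(f')\<^sup>2 + c * f\<^sup>2 = \<xi>\<^sup>2\<close>,
  where \<open>f'\<close> has the sign of \<open>- \<sigma>\<close>: with
  \<open>k = sqrt \<bar>c\<bar>\<close>, the arcsin or arsinh of \<open>k * f / \<xi>\<close> is
  affine in \<open>r\<close> with slope \<open>- \<sigma> * k\<close>.\<close>

lemma curvature_constant_form:
  assumes c: "\<And>r. r \<in> E \<Longrightarrow> (deriv f r)\<^sup>2 + c * (f r)\<^sup>2 = \<xi>\<^sup>2"
  shows "\<exists>r0. \<forall>r\<in>E. (c = 0 \<longrightarrow> f r = - \<sigma> * \<xi> * (r - r0)) \<and>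
    (c > 0 \<longrightarrow> f r = \<xi> / sqrt c * sin (sqrt c * (r - r0))) \<and>
    (c < 0 \<longrightarrow> f r = - \<sigma> * \<xi> / sqrt (- c) * sinh (sqrt (- c) * (r - r0)))"
proof -
  consider "c = 0" | "c > 0" | "c < 0" by linarith
  then show ?thesis
  proof cases
    case 1
    have d: "((\<lambda>r. f r + \<sigma> * \<xi> * r) has_real_derivative 0) (at r)" if r: "r \<in> E" for r
    proof -
      have "- \<sigma> * deriv f r = \<xi>"
      proof -
        have "(deriv f r)\<^sup>2 = \<xi>\<^sup>2" using c[OF r] 1 by simp
        then have "sqrt (\<xi>\<^sup>2) = - \<sigma> * deriv f r" using sqrt_f'_sq[OF r] by (simp only:)
        then show ?thesis using \<xi>_pos by simp
      qed
      then have "deriv f r + \<sigma> * \<xi> = 0" using \<sigma> by auto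
      moreover have "((\<lambda>r. f r + \<sigma> * \<xi> * r) has_real_derivative deriv f r + \<sigma> * \<xi>) (at r)"
        by (auto intro!: derivative_eq_intros f_DERIV[OF r])
      ultimately show ?thesis by simp
    qed
    obtain k where k: "\<And>r. r \<in> E \<Longrightarrow> f r + \<sigma> * \<xi> * r = k" using DERIV_0_const_E[OF d] by blast
    have "f r = - \<sigma> * \<xi> * (r - \<sigma> * k / \<xi>)" if "r \<in> E" for r
      using k[OF that] \<sigma> \<xi>_pos by (auto simp: algebra_simps)
    then show ?thesis using 1 by (intro exI[of _ "\<sigma> * k / \<xi>"]) simp
  next
    case 2
    define k where "k = sqrt c"
    have k: "k > 0" "k\<^sup>2 = c" using 2 by (simp_all add: k_def)
    have sq: "1 - (k * f r / \<xi>)\<^sup>2 = (deriv f r / \<xi>)\<^sup>2" if r: "r \<in> E" for r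
      using c[OF r] \<xi>_pos k(2) by (simp add: power_divide power_mult_distrib field_simps)
    have less1: "- 1 < k * f r / \<xi>" "k * f r / \<xi> < 1" if r: "r \<in> E" for r
    proof -
      have pos: "k * f r / \<xi> > 0" using k(1) f_pos[OF r] \<xi>_pos by simp
      have "deriv f r \<noteq> 0" using deriv_f[OF r] w_pos[OF r] f_pos[OF r] \<sigma>_sq(3) by simp
      then have "(deriv f r / \<xi>)\<^sup>2 > 0" using \<xi>_pos by simp
      then have "(k * f r / \<xi>)\<^sup>2 < 1" using sq[OF r] by linarith
      then have "(k * f r / \<xi>)\<^sup>2 < 1\<^sup>2" by simp
      then show "k * f r / \<xi> < 1" by (rule power2_less_imp_less) simp
      show "- 1 < k * f r / \<xi>" using pos by simp
    qed
    have d: "((\<lambda>r. arcsin (k * f r / \<xi>) + \<sigma> * k * r) has_real_derivative 0) (at r)" if r: "r \<in> E" for r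
    proof -
      have sqr: "sqrt (1 - (k * f r / \<xi>)\<^sup>2) = - \<sigma> * deriv f r / \<xi>"
      proof -
        have "sqrt ((deriv f r / \<xi>)\<^sup>2) = sqrt ((deriv f r)\<^sup>2) / \<xi>" using \<xi>_pos by simp
        then show ?thesis unfolding sq[OF r] sqrt_f'_sq[OF r] .
      qed
      have nz: "deriv f r \<noteq> 0" using deriv_f[OF r] w_pos[OF r] f_pos[OF r] \<sigma>_sq(3) by simp
      have "((\<lambda>r. k * f r / \<xi>) has_real_derivative k * deriv f r / \<xi>) (at r)"
        by (rule DERIV_cdivide[OF DERIV_cmult[OF f_DERIV[OF r]]])
      then have "((\<lambda>r. arcsin (k * f r / \<xi>)) has_real_derivative
          inverse (sqrt (1 - (k * f r / \<xi>)\<^sup>2)) * (k * deriv f r / \<xi>)) (at r)"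
        by (rule DERIV_chain2[where f = arcsin, rotated]) (rule DERIV_arcsin[OF less1[OF r]])
      then have "((\<lambda>r. arcsin (k * f r / \<xi>) + \<sigma> * k * r) has_real_derivative
          inverse (sqrt (1 - (k * f r / \<xi>)\<^sup>2)) * (k * deriv f r / \<xi>) + \<sigma> * k) (at r)"
        by (intro DERIV_add) (auto intro!: derivative_eq_intros)
      moreover have "inverse (sqrt (1 - (k * f r / \<xi>)\<^sup>2)) * (k * deriv f r / \<xi>) + \<sigma> * k = 0"
        unfolding sqr using \<sigma> nz \<xi>_pos by (auto simp: field_simps)
      ultimately show ?thesis by simp
    qed
    obtain p where p: "\<And>r. r \<in> E \<Longrightarrow> arcsin (k * f r / \<xi>) + \<sigma> * k * r = p" using DERIV_0_const_E[OF d] by blast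
    \<comment> \<open>The sine form carries no sign. For decreasing \<open>f\<close> the argument is
      therefore reflected by \<open>sin (pi - x) = sin x\<close>, which shifts the centre by
      \<open>pi / k\<close>.\<close>
    define r0 where "r0 = (if \<sigma> = 1 then (p - pi) / k else - (p / k))"
    have "f r = \<xi> / k * sin (k * (r - r0))" if r: "r \<in> E" for r
    proof -
      have "k * f r / \<xi> = sin (arcsin (k * f r / \<xi>))" using less1[OF r] by simp
      also have "arcsin (k * f r / \<xi>) = p - \<sigma> * k * r" using p[OF r] by simp
      also have "sin (p - \<sigma> * k * r) = sin (k * (r - r0))"
      proof (cases "\<sigma> = 1")
        case True
        have "k * (r - r0) = pi - (p - \<sigma> * k * r)" using True k(1) by (simp add: r0_def field_simps)
        then show ?thesis by simp
      next
        case False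
        then have "k * (r - r0) = p - \<sigma> * k * r" using \<sigma> k(1) by (simp add: r0_def field_simps)
        then show ?thesis by simp
      qed
      finally show ?thesis using k(1) \<xi>_pos by (simp add: field_simps)
    qed
    then show ?thesis using 2 by (intro exI[of _ r0]) (simp add: k_def)
  next
    case 3
    define k where "k = sqrt (- c)"
    have k: "k > 0" "k\<^sup>2 = - c" using 3 by (simp_all add: k_def)
    have sq: "(k * f r / \<xi>)\<^sup>2 + 1 = (deriv f r / \<xi>)\<^sup>2" if r: "r \<in> E" for r
      using c[OF r] \<xi>_pos k(2) by (simp add: power_divide power_mult_distrib field_simps)
    have d: "((\<lambda>r. arsinh (k * f r / \<xi>) + \<sigma> * k * r) has_real_derivative 0) (at r)" if r: "r \<in> E" for r
    proof -
      have sqr: "sqrt ((k * f r / \<xi>)\<^sup>2 + 1) = - \<sigma> * deriv f r / \<xi>"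
      proof -
        have "sqrt ((deriv f r / \<xi>)\<^sup>2) = sqrt ((deriv f r)\<^sup>2) / \<xi>" using \<xi>_pos by simp
        then show ?thesis unfolding sq[OF r] sqrt_f'_sq[OF r] .
      qed
      have nz: "deriv f r \<noteq> 0" using deriv_f[OF r] w_pos[OF r] f_pos[OF r] \<sigma>_sq(3) by simp
      have "((\<lambda>r. k * f r / \<xi>) has_real_derivative k * deriv f r / \<xi>) (at r)"
        by (rule DERIV_cdivide[OF DERIV_cmult[OF f_DERIV[OF r]]])
      then have "((\<lambda>r. arsinh (k * f r / \<xi>)) has_real_derivative
          1 / sqrt ((k * f r / \<xi>)\<^sup>2 + 1) * (k * deriv f r / \<xi>)) (at r)"
        by (rule DERIV_chain2[where f = arsinh, rotated]) (rule arsinh_real_has_field_derivative)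
      then have "((\<lambda>r. arsinh (k * f r / \<xi>) + \<sigma> * k * r) has_real_derivative
          1 / sqrt ((k * f r / \<xi>)\<^sup>2 + 1) * (k * deriv f r / \<xi>) + \<sigma> * k) (at r)"
        by (intro DERIV_add) (auto intro!: derivative_eq_intros)
      moreover have "1 / sqrt ((k * f r / \<xi>)\<^sup>2 + 1) * (k * deriv f r / \<xi>) + \<sigma> * k = 0"
        unfolding sqr using \<sigma> nz \<xi>_pos by (auto simp: field_simps)
      ultimately show ?thesis by simp
    qed
    obtain p where p: "\<And>r. r \<in> E \<Longrightarrow> arsinh (k * f r / \<xi>) + \<sigma> * k * r = p" using DERIV_0_const_E[OF d] by blast
    have "f r = - \<sigma> * \<xi> / k * sinh (k * (r - \<sigma> * p / k))" if r: "r \<in> E" for r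
    proof -
      have "k * f r / \<xi> = sinh (arsinh (k * f r / \<xi>))" by simp
      also have "arsinh (k * f r / \<xi>) = - \<sigma> * (k * (r - \<sigma> * p / k))"
        using p[OF r] \<sigma> k(1) by (auto simp: field_simps)
      also have "sinh (- \<sigma> * (k * (r - \<sigma> * p / k))) = - \<sigma> * sinh (k * (r - \<sigma> * p / k))"
        using \<sigma> by auto
      finally show ?thesis using k(1) \<xi>_pos by (simp add: field_simps)
    qed
    then show ?thesis using 3 by (intro exI[of _ "\<sigma> * p / k"]) (simp add: k_def)
  qed
qed

lemma theta_sqrt:
  assumes c: "\<And>r. r \<in> E \<Longrightarrow> (w r)\<^sup>2 + c = \<xi>\<^sup>2 / (f r)\<^sup>2" and r: "r \<in> E"
  shows "theta f r = \<sigma> * sqrt (\<xi>\<^sup>2 / (f r)\<^sup>2 - c)"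
proof -
  have "\<xi>\<^sup>2 / (f r)\<^sup>2 - c = (w r)\<^sup>2" using c[OF r] by simp
  then have "sqrt (\<xi>\<^sup>2 / (f r)\<^sup>2 - c) = w r" using w_pos[OF r] by simp
  then show ?thesis using \<sigma> by (auto simp: w_def)
qed

text \<open>An affine relation, differentiated by \<open>D\<close>, would make \<open>w ^ 3\<close>
  constant, but \<open>w\<close> is injective.\<close>

lemma bertrand_potentials_independent:
  assumes "A1 > 0" "A2 > 0"
  shows "\<not> (\<exists>m k. m \<noteq> 0 \<and> (\<forall>r\<in>E. bertrand_potential f 2 A2 B2 r = m * bertrand_potential f 1 A1 B1 r + k))"
proof
  assume "\<exists>m k. m \<noteq> 0 \<and> (\<forall>r\<in>E. bertrand_potential f 2 A2 B2 r = m * bertrand_potential f 1 A1 B1 r + k)"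
  then obtain m k where m: "m \<noteq> 0"
    and eq: "\<And>r. r \<in> E \<Longrightarrow> bertrand_potential f 2 A2 B2 r = m * bertrand_potential f 1 A1 B1 r + k" by blast
  have ib: "is_bertrand 1 A1 B1 (bertrand_potential f 1 A1 B1)" "is_bertrand 2 A2 B2 (bertrand_potential f 2 A2 B2)"
    using assms by (auto simp: is_bertrand_def)
  note s1 = is_bertrand_smooth[OF ib(1)]
  have cube: "w r ^ 3 = A2 / (m * A1)" if r: "r \<in> E" for r
  proof -
    have "D (bertrand_potential f 2 A2 B2) r = D (\<lambda>r. m * bertrand_potential f 1 A1 B1 r + k) r"
      by (rule D_cong[OF open_einterval r eq])
    also have "\<dots> = D (\<lambda>r. m * bertrand_potential f 1 A1 B1 r) r + D (\<lambda>r. k) r"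
      by (rule D_add[OF _ _ r]) (intro smooth_on_mult smooth_on_const s1 open_einterval)+
    also have "\<dots> = m * (- A1)"
      using D_cmult[OF s1 r, of m] is_bertrand_D(1)[OF ib(1) r] by (simp add: D_const)
    finally have "- A2 / w r ^ 3 = m * (- A1)" using is_bertrand_D(1)[OF ib(2) r] by simp
    then show ?thesis using w_pos[OF r] m assms by (simp add: field_simps)
  qed
  obtain r where r: "r \<in> E" using einterval_nonempty[OF ab] by blast
  obtain e where e: "e > 0" "cball r e \<subseteq> E" using r open_einterval open_contains_cball by blast
  have re: "r + e \<in> E" using e by (auto simp: subset_iff dist_real_def)
  have "w r = w (r + e)"
    by (rule power_eq_imp_eq_base[of _ 3])
      (use cube[OF r] cube[OF re] w_pos[OF r] w_pos[OF re] in auto)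
  then have "r = r + e" by (rule w_inj[OF r re])
  then show False using e(1) by simp
qed

section \<open>Limits at the two ends of the interval\<close>

lemma near_end_E:
  assumes "e \<in> {a, b}"
  shows "\<forall>\<^sub>F r in near_end a b e. r \<in> E"
  unfolding near_end_def eventually_filtercomap
  by (intro exI[of _ "\<lambda>x. x \<in> {a<..<b}"] conjI eventually_at_topological[THEN iffD2])
    (auto simp: einterval_iff intro!: exI[of _ UNIV])

lemma near_end_beyond:
  assumes "r1 \<in> E"
  shows "\<forall>\<^sub>F r in near_end a b a. r < r1" "\<forall>\<^sub>F r in near_end a b b. r1 < r"
proof -
  have r1: "a < ereal r1" "ereal r1 < b" using assms by (auto simp: einterval_iff)
  show "\<forall>\<^sub>F r in near_end a b a. r < r1"
    unfolding near_end_def eventually_filtercomap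
  proof (intro exI[of _ "\<lambda>x. x < ereal r1"] conjI)
    show "\<forall>\<^sub>F x in at a within {a<..<b}. x < ereal r1"
      unfolding eventually_at_topological by (intro exI[of _ "{..<ereal r1}"]) (use r1 in auto)
  qed auto
  show "\<forall>\<^sub>F r in near_end a b b. r1 < r"
    unfolding near_end_def eventually_filtercomap
  proof (intro exI[of _ "\<lambda>x. ereal r1 < x"] conjI)
    show "\<forall>\<^sub>F x in at b within {a<..<b}. ereal r1 < x"
      unfolding eventually_at_topological by (intro exI[of _ "{ereal r1<..}"]) (use r1 in auto)
  qed auto
qed

text \<open>Along a trivial filter every limit statement would hold; this is what permits denying
  attainment at the wrong end.\<close>

lemma near_end_not_bot:
  assumes "e \<in> {a, b}"
  shows "near_end a b e \<noteq> bot"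
proof
  assume "near_end a b e = bot"
  then have "\<forall>\<^sub>F r in near_end a b e. False" by simp
  then obtain P where P: "\<forall>\<^sub>F x in at e within {a<..<b}. P x" "\<And>x. P (ereal x) \<Longrightarrow> False"
    unfolding near_end_def eventually_filtercomap by blast
  obtain S where S: "open S" "e \<in> S" "\<And>x. x \<in> S \<Longrightarrow> x \<noteq> e \<Longrightarrow> x \<in> {a<..<b} \<Longrightarrow> P x"
    using P(1) unfolding eventually_at_topological by blast
  have "\<exists>x. ereal x \<in> S \<and> ereal x \<in> {a<..<b}"
  proof (cases "e = a")
    case True
    obtain y where y: "y > a" "{a..<y} \<subseteq> S" using open_right[OF S(1), of a b] S(2) ab True by auto
    obtain x where "a < ereal x" "ereal x < min y b" using ereal_dense2[of a "min y b"] y(1) ab by auto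
    then show ?thesis using y(2) by (intro exI[of _ x]) (auto simp: subset_iff)
  next
    case False
    then have e: "e = b" using assms by simp
    obtain y where y: "y < b" "{y<..b} \<subseteq> S" using open_left[OF S(1), of b a] S(2) ab e by auto
    obtain x where "max y a < ereal x" "ereal x < b" using ereal_dense2[of "max y a" b] y(1) ab by auto
    then show ?thesis using y(2) by (intro exI[of _ x]) (auto simp: subset_iff)
  qed
  then obtain x where "ereal x \<in> S" "ereal x \<in> {a<..<b}" by blast
  then show False using S(3)[of "ereal x"] P(2) assms by auto
qed

text \<open>Since \<open>\<sigma> * h\<close> strictly decreases, the infimum is approached at
  exactly one end, determined by \<sigma> alone. Applied to \<open>f\<close>, to the potentials and
  to the negative of \<bar>\<theta>\<bar>, it puts all extrema at the same end.\<close>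

lemma inf_attained_iff:
  fixes h :: "real \<Rightarrow> real"
  assumes h: "\<And>r. r \<in> E \<Longrightarrow> (h has_real_derivative h' r) (at r)" "\<And>r. r \<in> E \<Longrightarrow> \<sigma> * h' r < 0"
    and e: "e \<in> {a, b}"
  shows "inf_attained_at_end a b h e \<longleftrightarrow> e = (if \<sigma> = 1 then b else a)"
proof -
  let ?e = "if \<sigma> = 1 then b else a" and ?e' = "if \<sigma> = 1 then a else b"
  let ?L = "INF r\<in>E. ereal (h r)"
  have mono: "\<sigma> * h y < \<sigma> * h x" if "x \<in> E" "y \<in> E" "x < y" for x y
  proof (rule DERIV_neg_imp_decreasing[OF that(3), of "\<lambda>x. \<sigma> * h x"])
    fix z assume "x \<le> z" "z \<le> y"
    then have z: "z \<in> E" by (rule E_between[OF that(1,2)])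
    show "\<exists>d. ((\<lambda>x. \<sigma> * h x) has_real_derivative d) (at z) \<and> d < 0"
      using DERIV_cmult[OF h(1)[OF z], of \<sigma>] h(2)[OF z] by blast
  qed
  have beyond: "\<forall>\<^sub>F r in near_end a b ?e. r \<in> E \<and> h r < h r1"
    and beyond': "\<forall>\<^sub>F r in near_end a b ?e'. r \<in> E \<and> h r1 < h r" if r1: "r1 \<in> E" for r1
  proof -
    show "\<forall>\<^sub>F r in near_end a b ?e. r \<in> E \<and> h r < h r1"
    proof (cases "\<sigma> = 1")
      case True
      then show ?thesis using near_end_E[of b] near_end_beyond(2)[OF r1] mono[OF r1]
        by (auto elim: eventually_elim2)
    next
      case False
      then show ?thesis using near_end_E[of a] near_end_beyond(1)[OF r1] mono[OF _ r1] \<sigma>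
        by (auto elim: eventually_elim2)
    qed
    show "\<forall>\<^sub>F r in near_end a b ?e'. r \<in> E \<and> h r1 < h r"
    proof (cases "\<sigma> = 1")
      case True
      then show ?thesis using near_end_E[of a] near_end_beyond(1)[OF r1] mono[OF _ r1]
        by (auto elim: eventually_elim2)
    next
      case False
      then show ?thesis using near_end_E[of b] near_end_beyond(2)[OF r1] mono[OF r1] \<sigma>
        by (auto elim: eventually_elim2)
    qed
  qed
  have yes: "inf_attained_at_end a b h ?e"
    unfolding inf_attained_at_end_def
  proof (rule order_tendstoI)
    fix y assume "y < ?L"
    then have below: "y < ereal (h r)" if "r \<in> E" for r
      using INF_lower[OF that, of "\<lambda>r. ereal (h r)"] by simp
    have "\<forall>\<^sub>F r in near_end a b ?e. r \<in> E" by (rule near_end_E) simp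
    then show "\<forall>\<^sub>F r in near_end a b ?e. y < ereal (h r)"
      by (rule eventually_mono) (rule below)
  next
    fix y assume "?L < y"
    then obtain r1 where r1: "r1 \<in> E" "ereal (h r1) < y" by (auto simp: INF_less_iff)
    show "\<forall>\<^sub>F r in near_end a b ?e. ereal (h r) < y"
      using beyond[OF r1(1)]
    proof (rule eventually_mono)
      fix r assume "r \<in> E \<and> h r < h r1"
      then have "ereal (h r) < ereal (h r1)" by simp
      then show "ereal (h r) < y" using r1(2) by (rule less_trans)
    qed
  qed
  \<comment> \<open>Towards the other end \<open>h\<close> eventually exceeds \<open>h r1\<close>,
    which is already strictly above the infimum.\<close>
  have no: "\<not> inf_attained_at_end a b h ?e'"
  proof
    assume "inf_attained_at_end a b h ?e'"
    then have lim: "((\<lambda>r. ereal (h r)) \<longlongrightarrow> ?L) (near_end a b ?e')" by (simp add: inf_attained_at_end_def)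
    have nb: "near_end a b ?e \<noteq> bot" "near_end a b ?e' \<noteq> bot" by (rule near_end_not_bot, simp)+
    obtain r1 where r1: "r1 \<in> E" using einterval_nonempty[OF ab] by blast
    obtain r2 where r2: "r2 \<in> E" "h r2 < h r1" using eventually_happens[OF beyond[OF r1]] nb(1) by auto
    have "?L < ereal (h r1)" using INF_lower[OF r2(1), of "\<lambda>r. ereal (h r)"] r2(2) by (simp add: le_less_trans)
    then have "\<forall>\<^sub>F r in near_end a b ?e'. ereal (h r) < ereal (h r1)" by (rule order_tendstoD(2)[OF lim])
    then have "\<forall>\<^sub>F r in near_end a b ?e'. False"
      using beyond'[OF r1] by eventually_elim auto
    then show False using nb(2) by simp
  qed
  show ?thesis
  proof (cases "e = ?e")
    case True
    then show ?thesis using yes by simp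
  next
    case False
    then have "e = ?e'" using e by (auto split: if_splits)
    then show ?thesis using no False by simp
  qed
qed

lemma inf_f_attained_iff:
  "e \<in> {a, b} \<Longrightarrow> inf_attained_at_end a b f e \<longleftrightarrow> e = (if \<sigma> = 1 then b else a)"
proof (rule inf_attained_iff[OF f_DERIV])
  show "\<sigma> * deriv f r < 0" if "r \<in> E" for r
  proof -
    have "\<sigma> * deriv f r = - (w r * f r)" using \<sigma> by (auto simp: deriv_f[OF that])
    then show ?thesis using w_pos[OF that] f_pos[OF that] by simp
  qed
qed

lemma inf_bertrand_attained_iff:
  assumes ib: "is_bertrand i A B V" and e: "e \<in> {a, b}"
  shows "inf_attained_at_end a b V e \<longleftrightarrow> e = (if \<sigma> = 1 then b else a)"
proof (rule inf_attained_iff[OF smooth_on_DERIV[OF is_bertrand_smooth[OF ib]] _ e])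
  show "\<sigma> * deriv V r < 0" if r: "r \<in> E" for r
  proof -
    have "\<sigma> * deriv V r = \<xi>\<^sup>2 / (f r)\<^sup>2 * D V r" using \<sigma> by (auto simp: deriv_D[OF r])
    moreover have "D V r < 0"
      using is_bertrand_D(1)[OF ib r] ib w_pos[OF r] by (simp add: is_bertrand_def)
    ultimately show ?thesis using \<xi>_pos f_pos[OF r] by (simp add: mult_pos_neg divide_neg_pos)
  qed
qed

lemma sup_theta_attained_iff:
  assumes e: "e \<in> {a, b}"
  shows "sup_attained_at_end a b (\<lambda>r. \<bar>theta f r\<bar>) e \<longleftrightarrow> e = (if \<sigma> = 1 then b else a)"
proof -
  have "sup_attained_at_end a b (\<lambda>r. \<bar>theta f r\<bar>) e \<longleftrightarrow> inf_attained_at_end a b (\<lambda>r. - \<bar>theta f r\<bar>) e"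
    unfolding sup_attained_at_end_def inf_attained_at_end_def
    using ereal_INF_uminus_eq[of "\<lambda>r. ereal \<bar>theta f r\<bar>" E]
    by (subst ereal_Lim_uminus) (simp only: uminus_ereal.simps)
  also have "\<dots> \<longleftrightarrow> e = (if \<sigma> = 1 then b else a)"
  proof (rule inf_attained_iff[OF _ _ e])
    fix r assume r: "r \<in> E"
    show "((\<lambda>r. - \<bar>theta f r\<bar>) has_real_derivative - (\<sigma> * \<xi>\<^sup>2 / (f r)\<^sup>2)) (at r)"
      by (rule has_field_derivative_transform_within_open[OF DERIV_minus[OF w_DERIV[OF r]] open_einterval r])
        (simp add: abs_theta)
    show "\<sigma> * - (\<sigma> * \<xi>\<^sup>2 / (f r)\<^sup>2) < 0" using \<sigma> \<xi>_pos f_pos[OF r] by auto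
  qed
  finally show ?thesis .
qed

end

lemma constant_sign_on_interval:
  fixes g :: "real \<Rightarrow> real"
  assumes "connected S" "continuous_on S g" "\<And>x. x \<in> S \<Longrightarrow> g x \<noteq> 0"
  obtains \<sigma> where "\<sigma> = 1 \<or> \<sigma> = - 1" "\<And>x. x \<in> S \<Longrightarrow> \<sigma> * g x > 0"
proof (cases "\<forall>x\<in>S. g x > 0")
  case True
  then show ?thesis using that[of 1] by simp
next
  case False
  then obtain p where p: "p \<in> S" "g p < 0" using assms(3) by force
  have "g x < 0" if x: "x \<in> S" for x
  proof (rule ccontr)
    assume "\<not> g x < 0"
    then have "{g p..g x} \<subseteq> g ` S"
      using connected_contains_Icc[OF connected_continuous_image[OF assms(2,1)]] p(1) x by blast
    moreover have "0 \<in> {g p..g x}" using p(2) \<open>\<not> g x < 0\<close> by simp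
    ultimately show False using assms(3) by (metis imageE subsetD)
  qed
  then show ?thesis using that[of "- 1"] by simp
qed

theorem mainTheorem1:
  fixes a b :: ereal and f :: "real \<Rightarrow> real" and \<xi> :: real
  assumes "a < b"
    and "smooth_on (einterval a b) f"
    and "\<forall>r\<in>einterval a b. f r > 0"
    and "\<xi> \<in> \<rat>" and "\<xi> > 0"
    and "\<forall>r\<in>einterval a b. deriv (deriv f) r * f r - (deriv f r)\<^sup>2 = - \<xi>\<^sup>2"
    and "\<forall>r\<in>einterval a b. deriv f r \<noteq> 0"
  shows
    "(\<exists>c. (\<forall>r\<in>einterval a b. scalar_curvature f r / 2 = c) \<and>
        (\<exists>r0 \<sigma>. (\<sigma> = 1 \<or> \<sigma> = - 1) \<and>
           (\<forall>r\<in>einterval a b.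
              (c = 0 \<longrightarrow> f r = \<sigma> * \<xi> * (r - r0)) \<and>
              (c > 0 \<longrightarrow> f r = \<xi> / sqrt c * sin (sqrt c * (r - r0))) \<and>
              (c < 0 \<longrightarrow> f r = \<sigma> * \<xi> / sqrt (- c) * sinh (sqrt (- c) * (r - r0))))) \<and>
        ((\<forall>r\<in>einterval a b. theta f r = sqrt (\<xi>\<^sup>2 / (f r)\<^sup>2 - c)) \<or>
         (\<forall>r\<in>einterval a b. theta f r = - sqrt (\<xi>\<^sup>2 / (f r)\<^sup>2 - c))))
     \<and>
     (\<forall>P\<in>{semilocally_closing, locally_closing, closing, strongly_closing, weakly_closing}. \<forall>V.
        central_potential a b V \<and> P a b f V \<longleftrightarrow>
        (\<exists>i\<in>{1, 2}. \<exists>A>0. \<exists>B. \<forall>r\<in>einterval a b. V r = bertrand_potential f i A B r))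
     \<and>
     (\<forall>A1>0. \<forall>B1. \<forall>A2>0. \<forall>B2.
        \<not> (\<exists>m k. m \<noteq> 0 \<and> (\<forall>r\<in>einterval a b.
              bertrand_potential f 2 A2 B2 r = m * bertrand_potential f 1 A1 B1 r + k)))
     \<and>
     (\<forall>i\<in>{1, 2}. \<forall>A>0. \<forall>B.
        (\<forall>I r \<phi> K.
           nonsingular_bounded a b f (bertrand_potential f i A B) I r \<phi> K \<and> \<not> circular I r \<phi>
           \<longrightarrow> (\<exists>\<rho>. (\<forall>t\<in>I. r t = \<rho> (\<phi> t)) \<and> minimal_period \<rho> (2 * pi / (real i * \<xi>)))) \<and>
        (\<forall>r0\<in>einterval a b. \<forall>K.
           circular_orbit a b f (bertrand_potential f i A B) r0 K \<longleftrightarrow>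
           K = \<xi> * sqrt (A / \<bar>theta f r0\<bar> ^ i\<^sup>2) \<or> K = - \<xi> * sqrt (A / \<bar>theta f r0\<bar> ^ i\<^sup>2)))
     \<and>
     (\<exists>!e. e \<in> {a, b} \<and> inf_attained_at_end a b f e)
     \<and>
     (\<forall>e\<in>{a, b}.
        (inf_attained_at_end a b f e \<longleftrightarrow> sup_attained_at_end a b (\<lambda>r. \<bar>theta f r\<bar>) e) \<and>
        (inf_attained_at_end a b f e \<longrightarrow>
           (\<forall>i\<in>{1, 2}. \<forall>A>0. \<forall>B. inf_attained_at_end a b (bertrand_potential f i A B) e)))"
proof -
  have conn: "connected (einterval a b)" by (rule convex_connected[OF convex_einterval])
  have cont: "continuous_on (einterval a b) (theta f)"
    unfolding theta_def[abs_def]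
    by (intro continuous_on_divide continuous_on_minus smooth_on_continuous_on smooth_on_deriv assms(2))
      (use assms(3) in force)
  have nz: "theta f r \<noteq> 0" if "r \<in> einterval a b" for r
    using assms(3,7) that by (force simp: theta_def)
  obtain \<sigma> where \<sigma>: "\<sigma> = 1 \<or> \<sigma> = - 1" "\<And>r. r \<in> einterval a b \<Longrightarrow> \<sigma> * theta f r > 0"
    using constant_sign_on_interval[OF conn cont nz] by metis
  interpret surface a b f \<xi> \<sigma>
    by unfold_locales (use assms \<sigma> in auto)
  have ib: "is_bertrand i A B (bertrand_potential f i A B)" if "i \<in> {1, 2}" "A > 0" for i A B
    using that by (simp add: is_bertrand_def)
  let ?e = "if \<sigma> = 1 then b else a"
  have e: "?e \<in> {a, b}" by simp
  obtain c where c: "\<And>r. r \<in> E \<Longrightarrow> deriv (deriv f) r = - c * f r"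
      "\<And>r. r \<in> E \<Longrightarrow> (deriv f r)\<^sup>2 + c * (f r)\<^sup>2 = \<xi>\<^sup>2"
      "\<And>r. r \<in> E \<Longrightarrow> (w r)\<^sup>2 + c = \<xi>\<^sup>2 / (f r)\<^sup>2"
    using curvature_constant by blast
  have curv: "\<forall>r\<in>E. scalar_curvature f r / 2 = c"
    using c(1) f_pos by (force simp: scalar_curvature_def)
  obtain r0 where r0: "\<forall>r\<in>E. (c = 0 \<longrightarrow> f r = - \<sigma> * \<xi> * (r - r0)) \<and>
      (c > 0 \<longrightarrow> f r = \<xi> / sqrt c * sin (sqrt c * (r - r0))) \<and>
      (c < 0 \<longrightarrow> f r = - \<sigma> * \<xi> / sqrt (- c) * sinh (sqrt (- c) * (r - r0)))"
    using curvature_constant_form[OF c(2)] by blast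
  have th: "(\<forall>r\<in>E. theta f r = sqrt (\<xi>\<^sup>2 / (f r)\<^sup>2 - c)) \<or>
      (\<forall>r\<in>E. theta f r = - sqrt (\<xi>\<^sup>2 / (f r)\<^sup>2 - c))"
    using theta_sqrt[OF c(3)] \<sigma>(1) by auto
  have s': "- \<sigma> = 1 \<or> - \<sigma> = - 1" using \<sigma>(1) by auto
  show ?thesis
  proof (intro conjI)
    show "\<exists>c. (\<forall>r\<in>E. scalar_curvature f r / 2 = c) \<and>
        (\<exists>r0 \<sigma>. (\<sigma> = 1 \<or> \<sigma> = - 1) \<and>
           (\<forall>r\<in>E.
              (c = 0 \<longrightarrow> f r = \<sigma> * \<xi> * (r - r0)) \<and>
              (c > 0 \<longrightarrow> f r = \<xi> / sqrt c * sin (sqrt c * (r - r0))) \<and>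
              (c < 0 \<longrightarrow> f r = \<sigma> * \<xi> / sqrt (- c) * sinh (sqrt (- c) * (r - r0))))) \<and>
        ((\<forall>r\<in>E. theta f r = sqrt (\<xi>\<^sup>2 / (f r)\<^sup>2 - c)) \<or>
         (\<forall>r\<in>E. theta f r = - sqrt (\<xi>\<^sup>2 / (f r)\<^sup>2 - c)))"
      \<comment> \<open>The sign in the formulas for \<open>f\<close> is that of
        \<open>deriv f\<close>, opposite to the sign \<sigma> of \<theta>.\<close>
      by (rule exI[of _ c], intro conjI curv th, rule exI[of _ r0], rule exI[of _ "- \<sigma>"])
        (intro conjI s' r0)
    show "\<forall>P\<in>closing_classes. \<forall>V. central_potential a b V \<and> P a b f V \<longleftrightarrow>
        (\<exists>i\<in>{1, 2}. \<exists>A>0. \<exists>B. \<forall>r\<in>E. V r = bertrand_potential f i A B r)"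
      by (intro ballI allI closing_classes_iff_bertrand[OF assms(4)])
    show "\<forall>A1>0. \<forall>B1. \<forall>A2>0. \<forall>B2. \<not> (\<exists>m k. m \<noteq> 0 \<and> (\<forall>r\<in>E.
        bertrand_potential f 2 A2 B2 r = m * bertrand_potential f 1 A1 B1 r + k))"
      by (intro allI impI bertrand_potentials_independent)
    show "\<forall>i\<in>{1, 2}. \<forall>A>0. \<forall>B.
        (\<forall>I r \<phi> K.
           nonsingular_bounded a b f (bertrand_potential f i A B) I r \<phi> K \<and> \<not> circular I r \<phi>
           \<longrightarrow> (\<exists>\<rho>. (\<forall>t\<in>I. r t = \<rho> (\<phi> t)) \<and> minimal_period \<rho> (2 * pi / (real i * \<xi>)))) \<and>
        (\<forall>r0\<in>E. \<forall>K.
           circular_orbit a b f (bertrand_potential f i A B) r0 K \<longleftrightarrow>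
           K = \<xi> * sqrt (A / \<bar>theta f r0\<bar> ^ i\<^sup>2) \<or> K = - \<xi> * sqrt (A / \<bar>theta f r0\<bar> ^ i\<^sup>2))"
      by (intro ballI allI impI conjI is_bertrand_minimal_period[OF ib] is_bertrand_circular_orbit_iff[OF ib])
        auto
    show "\<exists>!e. e \<in> {a, b} \<and> inf_attained_at_end a b f e"
      by (rule ex1I[of _ ?e]) (use e inf_f_attained_iff in blast)+
    show "\<forall>e\<in>{a, b}.
        (inf_attained_at_end a b f e \<longleftrightarrow> sup_attained_at_end a b (\<lambda>r. \<bar>theta f r\<bar>) e) \<and>
        (inf_attained_at_end a b f e \<longrightarrow>
           (\<forall>i\<in>{1, 2}. \<forall>A>0. \<forall>B. inf_attained_at_end a b (bertrand_potential f i A B) e))"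
      by (intro ballI conjI impI allI)
        (simp_all only: inf_f_attained_iff sup_theta_attained_iff inf_bertrand_attained_iff[OF ib])
  qed
qed

end
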